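(* For $f\in\mathcal{M}^2_\omega(\mathcal{R})$, let $f_0=f(0+i\cdot)$ be its boundary values on the imaginary axis. Then $\mathcal{F}f_0\in L^2(\mathbf{R},e^{2e^\xi}d\xi)$ and $$\|f\|_{\mathcal{M}^2_\omega(\mathcal{R})}=\|\mathcal{F}f_0\|_{L^2(\mathbf{R},e^{2e^\xi}d\xi)}.$$ Conversely, if $\psi\in L^2(\mathbf{R},e^{2e^\xi}d\xi)$ and for $z\in\mathcal{R}$ we set $$f(z)=\frac1{\sqrt{2\pi}}\int_{-\infty}^{+\infty}\psi(\xi)e^{z\xi}\,d\xi,$$ then $f\in\mathcal{M}^2_\omega(\mathcal{R})$, the equality $\|f\|_{\mathcal{M}^2_\omega(\mathcal{R})}=\|\mathcal{F}f_0\|_{L^2(\mathbf{R},e^{2e^\xi}d\xi)}$ holds, and $\psi=\mathcal{F}f_0$.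
   Context: $\mathcal{R}=\{z\in\mathbf{C}:\Re z>0\}$ and $\overline{\mathcal{R}}$ is its closure. For $0<b<\infty$, $S_b=\{x+iy:0<x<b\}$ and $H^2(S_b)$ is the space of holomorphic $f$ on $S_b$ with $\sup_{0<x<b}\int_{-\infty}^{+\infty}|f(x+iy)|^2\,dy<\infty$; for such $f$ the functions $f(x+i\cdot)$ have a limit in $L^2(\mathbf{R})$ as $x\to0^+$, denoted $f(0+i\cdot)$ (boundary values on the imaginary axis). Let $\omega=\sum_{n=0}^{+\infty}\frac{2^n}{n!}\,\delta_{n/2}(x)\otimes dy$ be the Borel measure on $\overline{\mathcal{R}}$. The space $\mathcal{M}^2_\omega(\mathcal{R})$ consists of the holomorphic functions $f$ on $\mathcal{R}$ such that $f\in H^2(S_b)$ for every $0<b<\infty$ and $f\in L^2(\overline{\mathcal{R}},d\omega)$ (with $f$ on the imaginary axis understood as its boundary values), with norm $\|f\|_{\mathcal{M}^2_\omega(\mathcal{R})}^2=\sum_{n\ge0}\frac{2^n}{n!}\int_{-\infty}^{+\infty}|f(\frac n2+iy)|^2\,dy$. The Fourier transform is $(\mathcal{F}\psi)(\xi)=\frac1{\sqrt{2\pi}}\int_{-\infty}^{+\infty}\psi(x)e^{-ix\xi}\,dx$ for $\psi\in L^1(\mathbf{R})$, extended to $L^2(\mathbf{R})$ as usual. *)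

theory Defs
  imports "HOL-Probability.Probability"
begin

(* Elements of the L^2 spaces are represented by functions rather than by classes modulo
   null sets. On the real line lborel is used, i.e. representatives are Borel measurable. *)

definition L2 :: "'a measure \<Rightarrow> ('a \<Rightarrow> complex) set" where
  "L2 M = {g \<in> borel_measurable M. integrable M (\<lambda>x. (cmod (g x))\<^sup>2)}"

definition L2norm :: "'a measure \<Rightarrow> ('a \<Rightarrow> complex) \<Rightarrow> real" where
  "L2norm M g = sqrt (LINT x|M. (cmod (g x))\<^sup>2)"

definition L2_tendsto ::
  "'a measure \<Rightarrow> ('i \<Rightarrow> 'a \<Rightarrow> complex) \<Rightarrow> ('a \<Rightarrow> complex) \<Rightarrow> 'i filter \<Rightarrow> bool" where
  "L2_tendsto M u g F \<longleftrightarrow>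
     ((\<lambda>i. \<integral>\<^sup>+ x. ennreal ((cmod (u i x - g x))\<^sup>2) \<partial>M) \<longlongrightarrow> 0) F"


definition fourier_L1 :: "(real \<Rightarrow> complex) \<Rightarrow> real \<Rightarrow> complex" where
  "fourier_L1 \<psi> \<xi> =
     complex_of_real (1 / sqrt (2 * pi)) *
       (LINT x|lborel. \<psi> x * exp (- (\<i> * complex_of_real x * complex_of_real \<xi>)))"

(* The extension by continuity from the dense subspace of integrable functions in L^2. The
   limit is determined up to a null set by Plancherel's theorem; fourier_L2 picks one
   representative. *)

definition is_fourier_L2 :: "(real \<Rightarrow> complex) \<Rightarrow> (real \<Rightarrow> complex) \<Rightarrow> bool" where
  "is_fourier_L2 \<psi> g \<longleftrightarrow>
     \<psi> \<in> L2 lborel \<and> g \<in> L2 lborel \<and>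
     (\<exists>\<phi>::nat \<Rightarrow> real \<Rightarrow> complex.
        (\<forall>n. integrable lborel (\<phi> n) \<and> \<phi> n \<in> L2 lborel) \<and>
        L2_tendsto lborel \<phi> \<psi> sequentially \<and>
        L2_tendsto lborel (\<lambda>n. fourier_L1 (\<phi> n)) g sequentially)"

definition fourier_L2 :: "(real \<Rightarrow> complex) \<Rightarrow> real \<Rightarrow> complex" where
  "fourier_L2 \<psi> = (SOME g. is_fourier_L2 \<psi> g)"


definition right_half_plane :: "complex set" where
  "right_half_plane = {z. 0 < Re z}"

definition strip :: "real \<Rightarrow> complex set" where
  "strip b = {z. 0 < Re z \<and> Re z < b}"

definition H2_strip :: "real \<Rightarrow> (complex \<Rightarrow> complex) set" where
  "H2_strip b = {f. f holomorphic_on strip b \<and>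
     (SUP x\<in>{0<..<b}. \<integral>\<^sup>+ y. ennreal ((cmod (f (Complex x y)))\<^sup>2) \<partial>lborel) < \<infinity>}"

definition is_boundary_value :: "(complex \<Rightarrow> complex) \<Rightarrow> (real \<Rightarrow> complex) \<Rightarrow> bool" where
  "is_boundary_value f g \<longleftrightarrow>
     g \<in> L2 lborel \<and> L2_tendsto lborel (\<lambda>x y. f (Complex x y)) g (at_right 0)"

definition boundary_value :: "(complex \<Rightarrow> complex) \<Rightarrow> real \<Rightarrow> complex" where
  "boundary_value f = (SOME g. is_boundary_value f g)"

definition extend_to_boundary :: "(complex \<Rightarrow> complex) \<Rightarrow> complex \<Rightarrow> complex" where
  "extend_to_boundary f z = (if Re z = 0 then boundary_value f (Im z) else f z)"


(* The map Complex identifies the plane, on which the product measures of a Dirac mass and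
   Lebesgue measure live, with the complex numbers. *)

definition omega :: "complex measure" where
  "omega = measure_of (closure right_half_plane)
     (sets (restrict_space borel (closure right_half_plane)))
     (\<lambda>A. \<Sum>n. ennreal (2 ^ n / fact n) *
        emeasure (distr (return borel (real n / 2) \<Otimes>\<^sub>M lborel) borel (\<lambda>(x, y). Complex x y)) A)"

definition M2_omega :: "(complex \<Rightarrow> complex) set" where
  "M2_omega = {f. f holomorphic_on right_half_plane \<and>
     (\<forall>b>0. f \<in> H2_strip b) \<and> extend_to_boundary f \<in> L2 omega}"

definition M2_omega_norm :: "(complex \<Rightarrow> complex) \<Rightarrow> real" where
  "M2_omega_norm f = sqrt (\<Sum>n. 2 ^ n / fact n *
     (LINT y|lborel. (cmod (extend_to_boundary f (Complex (real n / 2) y)))\<^sup>2))"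

definition weighted_lborel :: "real measure" where
  "weighted_lborel = density lborel (\<lambda>\<xi>. ennreal (exp (2 * exp \<xi>)))"


(* measure_of returns the zero measure if its last argument is not countably additive on the
   given sigma-algebra; the following facts show that this is not the case for omega. *)

lemma closure_right_half_plane: "closure right_half_plane = {z. 0 \<le> Re z}"
proof -
  have "right_half_plane = {z. inner 1 z > 0}" "{z. 0 \<le> Re z} = {z. inner 1 z \<ge> 0}"
    by (auto simp: right_half_plane_def inner_complex_def)
  then show ?thesis
    using closure_halfspace_gt[of "1::complex" 0] by simp
qed

lemma space_omega: "space omega = {z. 0 \<le> Re z}"
  by (simp add: omega_def space_measure_of_conv closure_right_half_plane)

lemma sets_omega: "sets omega = sets (restrict_space borel {z. 0 \<le> Re z})"
  unfolding omega_def closure_right_half_plane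
  using sets.space_closed[of "restrict_space borel {z::complex. 0 \<le> Re z}"]
    sets.sigma_sets_eq[of "restrict_space borel {z::complex. 0 \<le> Re z}"]
  by (simp add: sets_measure_of space_restrict_space)

lemma Complex_measurable: "(\<lambda>(x, y). Complex x y) \<in> borel_measurable (borel \<Otimes>\<^sub>M borel)"
proof -
  have "(\<lambda>(x, y). Complex x y) = (\<lambda>p. complex_of_real (fst p) + \<i> * complex_of_real (snd p))"
    by (auto simp: fun_eq_iff complex_eq_iff)
  then show ?thesis by simp
qed

lemma emeasure_omega:
  assumes A: "A \<in> sets borel" "A \<subseteq> {z. 0 \<le> Re z}"
  shows "emeasure omega A =
    (\<Sum>n. ennreal (2 ^ n / fact n) * emeasure lborel {y. Complex (real n / 2) y \<in> A})"
proof -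
  let ?H = "{z::complex. 0 \<le> Re z}"
  let ?D = "\<lambda>n. distr (return borel (real n / 2) \<Otimes>\<^sub>M lborel) borel (\<lambda>(x, y). Complex x y)"
  let ?\<mu> = "\<lambda>A. \<Sum>n. ennreal (2 ^ n / fact n) * emeasure (?D n) A"
  have H: "?H \<in> sets borel" by measurable
  have sub: "B \<in> sets borel" if "B \<in> sets (restrict_space borel ?H)" for B
    using that H by (auto simp: sets_restrict_space_iff)
  have alg: "sigma_algebra ?H (sets (restrict_space borel ?H))"
    using sets.sigma_algebra_axioms[of "restrict_space borel ?H"]
    by (simp add: space_restrict_space)
  have pos: "positive (sets (restrict_space borel ?H)) ?\<mu>"
    by (simp add: positive_def)
  have add: "countably_additive (sets (restrict_space borel ?H)) ?\<mu>"
  proof (rule countably_additiveI)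
    fix B :: "nat \<Rightarrow> complex set"
    assume B: "range B \<subseteq> sets (restrict_space borel ?H)" "disjoint_family B"
    have "(\<Sum>i. ?\<mu> (B i)) =
        (\<Sum>i. \<integral>\<^sup>+ n. ennreal (2 ^ n / fact n) * emeasure (?D n) (B i) \<partial>count_space UNIV)"
      by (simp add: nn_integral_count_space_nat)
    also have "\<dots> =
        (\<integral>\<^sup>+ n. (\<Sum>i. ennreal (2 ^ n / fact n) * emeasure (?D n) (B i)) \<partial>count_space UNIV)"
      by (subst nn_integral_suminf) auto
    also have "\<dots> = (\<Sum>n. \<Sum>i. ennreal (2 ^ n / fact n) * emeasure (?D n) (B i))"
      by (simp add: nn_integral_count_space_nat)
    also have "\<dots> = ?\<mu> (\<Union>i. B i)"
    proof (intro arg_cong[where f = suminf] ext)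
      fix n
      have "(\<Sum>i. emeasure (?D n) (B i)) = emeasure (?D n) (\<Union>i. B i)"
        using B sub by (intro suminf_emeasure) auto
      then show "(\<Sum>i. ennreal (2 ^ n / fact n) * emeasure (?D n) (B i)) =
          ennreal (2 ^ n / fact n) * emeasure (?D n) (\<Union>i. B i)"
        by simp
    qed
    finally show "(\<Sum>i. ?\<mu> (B i)) = ?\<mu> (\<Union>i. B i)" .
  qed
  have "emeasure (?D n) A = emeasure lborel {y. Complex (real n / 2) y \<in> A}" for n
  proof -
    have m: "(\<lambda>(x, y). Complex x y) \<in> borel_measurable (return borel (real n / 2) \<Otimes>\<^sub>M lborel)"
      using Complex_measurable by (simp cong: measurable_cong_sets sets_pair_measure_cong)
    let ?P = "(\<lambda>(x, y). Complex x y) -` A \<inter>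
      space (return borel (real n / 2) \<Otimes>\<^sub>M (lborel :: real measure))"
    have P: "?P \<in> sets (return borel (real n / 2) \<Otimes>\<^sub>M lborel)"
      using m A(1) by (rule measurable_sets)
    have "emeasure (?D n) A = emeasure (return borel (real n / 2) \<Otimes>\<^sub>M lborel) ?P"
      using m A(1) by (rule emeasure_distr)
    also have "\<dots> = (\<integral>\<^sup>+ x. emeasure lborel (Pair x -` ?P) \<partial>return borel (real n / 2))"
      using P by (rule lborel.emeasure_pair_measure_alt)
    also have "\<dots> = emeasure lborel (Pair (real n / 2) -` ?P)"
      using lborel.measurable_emeasure_Pair[OF P] by (subst nn_integral_return) auto
    also have "Pair (real n / 2) -` ?P = {y. Complex (real n / 2) y \<in> A}"
      by (auto simp: space_pair_measure)
    finally show ?thesis .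
  qed
  moreover have "emeasure omega A = ?\<mu> A"
    unfolding omega_def closure_right_half_plane
    using A H by (intro emeasure_measure_of_sigma alg pos add) (auto simp: sets_restrict_space_iff)
  ultimately show ?thesis by simp
qed

end

theory Submission
  imports Defs "HOL-Complex_Analysis.Cauchy_Integral_Theorem"
begin

text \<open>A function \<open>f\<close> that lies in \<open>H\<^sup>2\<close> of every strip restricts to a square-integrable function
\<open>f(x + i\<cdot>)\<close> on each line \<open>Re z = x\<close>. Up to a constant, \<open>e\<^bsup>-x\<xi>\<^esup> \<F>(f(x + i\<cdot>))(\<xi>)\<close> is the integral of
\<open>f(z) e\<^bsup>-z\<xi>\<^esup>\<close> along that line, so Cauchy's theorem makes it independent of \<open>x\<close>: there is one function \<open>g\<close> with
\<open>\<F>(f(x + i\<cdot>))(\<xi>) = e\<^bsup>x\<xi>\<^esup> g(\<xi>)\<close> for all \<open>x > 0\<close> (\<open>H2_strip_fourier_representation\<close>). Letting \<open>x\<close> tend to \<open>0\<close>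
identifies \<open>g\<close> with the Fourier transform of the boundary values (\<open>boundary_value_fourier\<close>). By Plancherel's
theorem the line \<open>Re z = n/2\<close> contributes \<open>\<integral> e\<^bsup>n\<xi>\<^esup> \<bar>g(\<xi>)\<bar>\<^sup>2 d\<xi>\<close> to the norm, and
\<open>\<Sum>n. 2\<^sup>n/n! e\<^bsup>n\<xi>\<^esup>\<close> is the exponential series of \<open>2e\<^sup>\<xi>\<close>, which is where the weight comes from
(\<open>M2_omega_norm_eq\<close>).

Conversely, the weight dominates \<open>e\<^bsup>2x\<xi>\<^esup>\<close> for every \<open>x \<ge> 0\<close>, so for \<open>\<psi>\<close> in the weighted space the integral
defining \<open>f\<close> converges absolutely and is, on each vertical line, an inverse Fourier transform of \<open>e\<^bsup>x\<xi>\<^esup> \<psi>(\<xi>)\<close>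
(\<open>laplace_fourier\<close>). Thus \<open>\<psi>\<close> takes the place of \<open>g\<close>, and the same boundary and norm computations apply.

Both halves rest on the \<open>L\<^sup>2\<close> theory of the Fourier transform. For \<open>\<phi>\<close> in \<open>L\<^sup>1 \<inter> L\<^sup>2\<close>, damping \<open>\<bar>\<F>\<phi>\<bar>\<^sup>2\<close> by a
wide Gaussian turns its integral into an average of the autocorrelation of \<open>\<phi>\<close> over small shifts; this gives
\<open>\<parallel>\<F>\<phi>\<parallel> \<le> \<parallel>\<phi>\<parallel>\<close> at once, and equality first for continuous \<open>\<phi>\<close> and then, by density, for all
(\<open>Plancherel_L1\<close>). Completeness of \<open>L\<^sup>2\<close> extends the transform, and the multiplication formula
\<open>\<integral> \<F>\<phi> \<cdot> \<eta> = \<integral> \<phi> \<cdot> \<F>\<eta>\<close> together with the isometry yields the inversion theorem (\<open>Fourier_inversion_L2\<close>).\<close>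

section \<open>Square-integrable functions\<close>

lemma L2_measurable [measurable_dest]: "g \<in> L2 M \<Longrightarrow> g \<in> borel_measurable M"
  by (simp add: L2_def)

lemma L2_integrable: "g \<in> L2 M \<Longrightarrow> integrable M (\<lambda>x. (cmod (g x))\<^sup>2)"
  by (simp add: L2_def)

lemma L2_iff_nn_integral:
  "g \<in> L2 M \<longleftrightarrow> g \<in> borel_measurable M \<and> (\<integral>\<^sup>+x. ennreal ((cmod (g x))\<^sup>2) \<partial>M) < \<infinity>"
  by (auto simp: L2_def integrable_iff_bounded)

lemma L2norm_nonneg [simp]: "0 \<le> L2norm M g"
  by (simp add: L2norm_def)

lemma L2norm_power2: "(L2norm M g)\<^sup>2 = (LINT x|M. (cmod (g x))\<^sup>2)"
  by (simp add: L2norm_def)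

lemma nn_integral_L2: "g \<in> L2 M \<Longrightarrow> (\<integral>\<^sup>+x. ennreal ((cmod (g x))\<^sup>2) \<partial>M) = ennreal ((L2norm M g)\<^sup>2)"
  by (simp add: L2norm_power2 nn_integral_eq_integral L2_integrable)

lemma L2I_bound:
  assumes g: "g \<in> L2 M" and h: "h \<in> borel_measurable M"
    and le: "AE x in M. cmod (h x) \<le> C * cmod (g x)"
  shows "h \<in> L2 M"
proof -
  have "integrable M (\<lambda>x. (cmod (h x))\<^sup>2)"
  proof (rule Bochner_Integration.integrable_bound)
    show "integrable M (\<lambda>x. C\<^sup>2 * (cmod (g x))\<^sup>2)"
      using L2_integrable[OF g] by simp
    show "AE x in M. norm ((cmod (h x))\<^sup>2) \<le> norm (C\<^sup>2 * (cmod (g x))\<^sup>2)"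
      using le
    proof eventually_elim
      case (elim x)
      then have "(cmod (h x))\<^sup>2 \<le> (C * cmod (g x))\<^sup>2" by (intro power_mono) auto
      then show ?case by (simp add: power_mult_distrib)
    qed
  qed (use h in measurable)
  then show ?thesis using h by (simp add: L2_def)
qed

lemma L2_cmult:
  assumes g: "g \<in> L2 M" shows "(\<lambda>x. c * g x) \<in> L2 M"
  using L2_measurable[OF g] by (intro L2I_bound[OF g, where C = "cmod c"]) (auto simp: norm_mult)

lemma L2_indicator:
  assumes g: "g \<in> L2 M" and A: "A \<in> sets M" shows "(\<lambda>x. indicator A x *\<^sub>R g x) \<in> L2 M"
  using L2_measurable[OF g] A
  by (intro L2I_bound[OF g, where C = 1]) (auto simp: indicator_def)

lemma borel_measurable_cnj [measurable]: "cnj \<in> borel_measurable borel"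
  by (intro borel_measurable_continuous_onI continuous_intros)

lemma L2_cnj:
  assumes g: "g \<in> L2 M" shows "(\<lambda>x. cnj (g x)) \<in> L2 M"
proof (rule L2I_bound[OF g])
  show "(\<lambda>x. cnj (g x)) \<in> borel_measurable M"
    by (rule measurable_compose[OF L2_measurable[OF g] borel_measurable_cnj])
  show "AE x in M. cmod (cnj (g x)) \<le> 1 * cmod (g x)" by simp
qed

lemma L2_add:
  assumes u: "u \<in> L2 M" and v: "v \<in> L2 M"
  shows "(\<lambda>x. u x + v x) \<in> L2 M"
proof -
  note [measurable] = u v
  have "(cmod (u x + v x))\<^sup>2 \<le> 2 * (cmod (u x))\<^sup>2 + 2 * (cmod (v x))\<^sup>2" for x
  proof -
    have "(cmod (u x + v x))\<^sup>2 \<le> (cmod (u x) + cmod (v x))\<^sup>2"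
      by (intro power_mono norm_triangle_ineq) auto
    also have "\<dots> \<le> 2 * (cmod (u x))\<^sup>2 + 2 * (cmod (v x))\<^sup>2"
      using sum_squares_bound[of "cmod (u x)" "cmod (v x)"] by (simp add: power2_sum)
    finally show ?thesis .
  qed
  then have *: "AE x in M. norm ((cmod (u x + v x))\<^sup>2) \<le> norm (2 * (cmod (u x))\<^sup>2 + 2 * (cmod (v x))\<^sup>2)"
    by simp
  have "integrable M (\<lambda>x. 2 * (cmod (u x))\<^sup>2 + 2 * (cmod (v x))\<^sup>2)"
    using L2_integrable[OF u] L2_integrable[OF v] by simp
  from Bochner_Integration.integrable_bound[OF this _ *]
  have "integrable M (\<lambda>x. (cmod (u x + v x))\<^sup>2)"
    by simp
  then show ?thesis by (simp add: L2_def)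
qed

lemma L2_diff:
  assumes "u \<in> L2 M" "v \<in> L2 M" shows "(\<lambda>x. u x - v x) \<in> L2 M"
  using L2_add[OF assms(1) L2_cmult[OF assms(2), of "-1"]] by simp

lemma L2norm_cong_AE:
  assumes "u \<in> borel_measurable M" "v \<in> borel_measurable M" "AE x in M. u x = v x"
  shows "L2norm M u = L2norm M v"
  unfolding L2norm_def using assms by (intro arg_cong[where f = sqrt] integral_cong_AE) auto

lemma L2_cong_AE:
  assumes u: "u \<in> L2 M" and "v \<in> borel_measurable M" "AE x in M. u x = v x"
  shows "v \<in> L2 M"
proof (rule L2I_bound[OF u])
  show "AE x in M. cmod (v x) \<le> 1 * cmod (u x)"
    using assms(3) by eventually_elim simp
qed fact

lemma ennreal_power2_le_imp_le:
  assumes "x\<^sup>2 \<le> (ennreal c)\<^sup>2" "0 \<le> c" shows "x \<le> ennreal c"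
proof (cases x)
  case (real r)
  with assms have "r\<^sup>2 \<le> c\<^sup>2" by (simp add: ennreal_power)
  with assms real show ?thesis using power2_le_imp_le by auto
next
  case top
  with assms show ?thesis by (simp add: ennreal_power top_unique)
qed

lemma
  assumes u: "u \<in> L2 M" and v: "v \<in> L2 M"
  shows integrable_L2_mult: "integrable M (\<lambda>x. u x * v x)"
    and L2_Cauchy_Schwarz: "(LINT x|M. cmod (u x) * cmod (v x)) \<le> L2norm M u * L2norm M v"
proof -
  note [measurable] = u v
  let ?I = "\<integral>\<^sup>+x. ennreal (cmod (u x)) * ennreal (cmod (v x)) \<partial>M"
  have "?I\<^sup>2 \<le> (\<integral>\<^sup>+x. (ennreal (cmod (u x)))\<^sup>2 \<partial>M) * (\<integral>\<^sup>+x. (ennreal (cmod (v x)))\<^sup>2 \<partial>M)"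
    by (rule Cauchy_Schwarz_nn_integral) measurable
  also have "\<dots> = (ennreal (L2norm M u * L2norm M v))\<^sup>2"
    by (simp add: ennreal_power nn_integral_L2 u v ennreal_mult[symmetric] power_mult_distrib)
  finally have le: "?I \<le> ennreal (L2norm M u * L2norm M v)"
    by (rule ennreal_power2_le_imp_le) simp
  have eq: "?I = (\<integral>\<^sup>+x. ennreal (cmod (u x) * cmod (v x)) \<partial>M)"
    by (simp add: ennreal_mult)
  have fin: "(\<integral>\<^sup>+x. ennreal (cmod (u x) * cmod (v x)) \<partial>M) < \<infinity>"
    using le unfolding eq by (rule le_less_trans) simp
  then show "integrable M (\<lambda>x. u x * v x)"
    by (simp add: integrable_iff_bounded norm_mult)
  then have "integrable M (\<lambda>x. cmod (u x) * cmod (v x))"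
    using integrable_norm[of M "\<lambda>x. u x * v x"] by (simp add: norm_mult)
  then have "ennreal (LINT x|M. cmod (u x) * cmod (v x)) \<le> ennreal (L2norm M u * L2norm M v)"
    using le unfolding eq by (subst (asm) nn_integral_eq_integral) auto
  then show "(LINT x|M. cmod (u x) * cmod (v x)) \<le> L2norm M u * L2norm M v"
    by (simp add: ennreal_le_iff)
qed

lemma L2norm_triangle_add:
  assumes u: "u \<in> L2 M" and v: "v \<in> L2 M"
  shows "L2norm M (\<lambda>x. u x + v x) \<le> L2norm M u + L2norm M v"
proof -
  note [measurable] = u v
  have int: "integrable M (\<lambda>x. cmod (u x) * cmod (v x))"
    using integrable_norm[OF integrable_L2_mult[OF u v]] by (simp add: norm_mult)
  have "(L2norm M (\<lambda>x. u x + v x))\<^sup>2 \<le>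
      (LINT x|M. (cmod (u x))\<^sup>2 + (cmod (v x))\<^sup>2 + 2 * (cmod (u x) * cmod (v x)))"
    unfolding L2norm_power2
  proof (rule integral_mono)
    show "(cmod (u x + v x))\<^sup>2 \<le> (cmod (u x))\<^sup>2 + (cmod (v x))\<^sup>2 + 2 * (cmod (u x) * cmod (v x))" for x
      using power_mono[OF norm_triangle_ineq[of "u x" "v x"], of 2] by (simp add: power2_sum)
  qed (use L2_integrable[OF L2_add[OF u v]] L2_integrable[OF u] L2_integrable[OF v] int in auto)
  also have "\<dots> = (L2norm M u)\<^sup>2 + (L2norm M v)\<^sup>2 + 2 * (LINT x|M. cmod (u x) * cmod (v x))"
    using L2_integrable[OF u] L2_integrable[OF v] int by (simp add: L2norm_power2)
  also have "\<dots> \<le> (L2norm M u + L2norm M v)\<^sup>2"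
    using L2_Cauchy_Schwarz[OF u v] by (simp add: power2_sum)
  finally show ?thesis
    by (rule power2_le_imp_le) simp
qed

lemma L2norm_minus_commute: "L2norm M (\<lambda>x. u x - v x) = L2norm M (\<lambda>x. v x - u x)"
  by (simp add: L2norm_def norm_minus_commute)

lemma L2norm_triangle:
  assumes "u \<in> L2 M" "v \<in> L2 M" "w \<in> L2 M"
  shows "L2norm M (\<lambda>x. u x - w x) \<le> L2norm M (\<lambda>x. u x - v x) + L2norm M (\<lambda>x. v x - w x)"
  using L2norm_triangle_add[OF L2_diff[OF assms(1,2)] L2_diff[OF assms(2,3)]] by simp

lemma L2norm_diff_le:
  assumes "u \<in> L2 M" "v \<in> L2 M"
  shows "\<bar>L2norm M u - L2norm M v\<bar> \<le> L2norm M (\<lambda>x. u x - v x)"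
  using L2norm_triangle_add[OF L2_diff[OF assms] assms(2)]
    L2norm_triangle_add[OF L2_diff[OF assms(2,1)] assms(1)] L2norm_minus_commute[of M u v] by simp

lemma L2norm_eq_0_AE:
  assumes "u \<in> L2 M" "v \<in> L2 M" "L2norm M (\<lambda>x. u x - v x) = 0"
  shows "AE x in M. u x = v x"
proof -
  have "(LINT x|M. (cmod (u x - v x))\<^sup>2) = 0"
    using assms(3) L2norm_power2[of M "\<lambda>x. u x - v x"] by simp
  then have "AE x in M. (cmod (u x - v x))\<^sup>2 = 0"
    using integral_nonneg_eq_0_iff_AE[OF L2_integrable[OF L2_diff[OF assms(1,2)]]] by simp
  then show ?thesis by simp
qed

lemma L2_tendsto_iff_L2norm:
  assumes "\<forall>\<^sub>F i in F. u i \<in> L2 M" "g \<in> L2 M"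
  shows "L2_tendsto M u g F \<longleftrightarrow> ((\<lambda>i. L2norm M (\<lambda>x. u i x - g x)) \<longlongrightarrow> 0) F"
proof -
  have "L2_tendsto M u g F \<longleftrightarrow> ((\<lambda>i. ennreal ((L2norm M (\<lambda>x. u i x - g x))\<^sup>2)) \<longlongrightarrow> ennreal 0) F"
    unfolding L2_tendsto_def ennreal_0 using assms(1)
    by (intro tendsto_cong, elim eventually_mono) (simp add: nn_integral_L2 L2_diff assms(2))
  also have "\<dots> \<longleftrightarrow> ((\<lambda>i. (L2norm M (\<lambda>x. u i x - g x))\<^sup>2) \<longlongrightarrow> 0) F"
    by (rule tendsto_ennreal_iff) auto
  also have "\<dots> \<longleftrightarrow> ((\<lambda>i. L2norm M (\<lambda>x. u i x - g x)) \<longlongrightarrow> 0) F"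
    using tendsto_real_sqrt[of "\<lambda>i. (L2norm M (\<lambda>x. u i x - g x))\<^sup>2" 0 F]
      tendsto_power[of "\<lambda>i. L2norm M (\<lambda>x. u i x - g x)" 0 F 2] by auto
  finally show ?thesis .
qed

lemma L2_tendsto_unique:
  assumes u: "\<forall>\<^sub>F i in F. u i \<in> L2 M" and "g \<in> L2 M" "h \<in> L2 M" "F \<noteq> bot"
    and lim: "L2_tendsto M u g F" "L2_tendsto M u h F"
  shows "AE x in M. g x = h x"
proof (rule L2norm_eq_0_AE)
  have "((\<lambda>i. L2norm M (\<lambda>x. u i x - g x) + L2norm M (\<lambda>x. u i x - h x)) \<longlongrightarrow> 0 + 0) F"
    using assms by (intro tendsto_add) (simp_all add: L2_tendsto_iff_L2norm)
  moreover have "\<forall>\<^sub>F i in F. L2norm M (\<lambda>x. g x - h x) \<le>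
      L2norm M (\<lambda>x. u i x - g x) + L2norm M (\<lambda>x. u i x - h x)"
    using u
  proof eventually_elim
    case (elim i)
    show ?case
      using L2norm_triangle[OF assms(2) elim assms(3)] L2norm_minus_commute[of M g "u i"] by simp
  qed
  ultimately have "L2norm M (\<lambda>x. g x - h x) \<le> 0"
    using \<open>F \<noteq> bot\<close> by (intro tendsto_lowerbound[where F = F]) auto
  then show "L2norm M (\<lambda>x. g x - h x) = 0"
    using L2norm_nonneg[of M "\<lambda>x. g x - h x"] by linarith
qed (use assms in auto)

lemma L2_tendsto_L2norm:
  assumes "\<forall>\<^sub>F i in F. u i \<in> L2 M" "g \<in> L2 M" "L2_tendsto M u g F"
  shows "((\<lambda>i. L2norm M (u i)) \<longlongrightarrow> L2norm M g) F"
proof (rule Lim_null[THEN iffD2], rule Lim_null_comparison)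
  show "\<forall>\<^sub>F i in F. norm (L2norm M (u i) - L2norm M g) \<le> L2norm M (\<lambda>x. u i x - g x)"
    using assms(1) by eventually_elim (use L2norm_diff_le assms(2) in auto)
  show "((\<lambda>i. L2norm M (\<lambda>x. u i x - g x)) \<longlongrightarrow> 0) F"
    using assms by (simp add: L2_tendsto_iff_L2norm)
qed

lemma L2_dominated_convergence:
  fixes u :: "nat \<Rightarrow> 'a \<Rightarrow> complex"
  assumes [measurable]: "\<And>n. u n \<in> borel_measurable M" "g \<in> borel_measurable M"
    and w: "integrable M (\<lambda>x. (w x)\<^sup>2)"
    and bound: "\<And>n. AE x in M. cmod (u n x - g x) \<le> w x"
    and lim: "AE x in M. (\<lambda>n. u n x) \<longlonglongrightarrow> g x"
  shows "L2_tendsto M u g sequentially"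
proof -
  have int: "integrable M (\<lambda>x. (cmod (u n x - g x))\<^sup>2)" for n
  proof (rule Bochner_Integration.integrable_bound[OF w])
    show "AE x in M. norm ((cmod (u n x - g x))\<^sup>2) \<le> norm ((w x)\<^sup>2)"
      using bound[of n] by eventually_elim (auto intro!: power_mono)
  qed measurable
  have "(\<lambda>n. LINT x|M. (cmod (u n x - g x))\<^sup>2) \<longlonglongrightarrow> (LINT x|M. 0)"
  proof (rule integral_dominated_convergence[OF _ _ w])
    show "AE x in M. (\<lambda>n. (cmod (u n x - g x))\<^sup>2) \<longlonglongrightarrow> 0"
      using lim
    proof eventually_elim
      case (elim x)
      then have "(\<lambda>n. (cmod (u n x - g x))\<^sup>2) \<longlonglongrightarrow> (cmod (g x - g x))\<^sup>2"
        by (intro tendsto_intros)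
      then show ?case by simp
    qed
    show "AE x in M. norm ((cmod (u n x - g x))\<^sup>2) \<le> (w x)\<^sup>2" for n
      using bound[of n] by eventually_elim (auto intro!: power_mono)
  qed auto
  then have "(\<lambda>n. ennreal (LINT x|M. (cmod (u n x - g x))\<^sup>2)) \<longlonglongrightarrow> ennreal 0"
    by (intro tendsto_ennrealI) simp
  then show ?thesis
    using int by (simp add: L2_tendsto_def nn_integral_eq_integral)
qed

text \<open>Riesz--Fischer. For a subsequence whose successive differences \<open>a k\<close> have norm at most \<open>2\<^sup>-\<^sup>k\<close>, the series of
\<open>2\<^sup>k (a k)\<^sup>2\<close> has finite integral, hence converges almost everywhere. There \<open>a k\<close> decays geometrically, so the
subsequence converges pointwise, and Fatou's lemma shows that the limit is also the limit in \<open>L\<^sup>2\<close>.\<close>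

lemma L2_complete:
  fixes u :: "nat \<Rightarrow> 'a \<Rightarrow> complex"
  assumes u: "\<And>n. u n \<in> L2 M"
    and cauchy: "\<And>e. 0 < e \<Longrightarrow> \<exists>N. \<forall>m\<ge>N. \<forall>n\<ge>N. L2norm M (\<lambda>x. u m x - u n x) < e"
  obtains g where "g \<in> L2 M" "L2_tendsto M u g sequentially"
proof -
  note [measurable] = u
  have "\<forall>k. \<exists>N. \<forall>m\<ge>N. \<forall>n\<ge>N. L2norm M (\<lambda>x. u m x - u n x) < (1/2) ^ k"
    using cauchy by simp
  then obtain N where N: "\<And>k m n. m \<ge> N k \<Longrightarrow> n \<ge> N k \<Longrightarrow> L2norm M (\<lambda>x. u m x - u n x) < (1/2) ^ k"
    by metis
  define r where "r k = k + (\<Sum>i\<le>k. N i)" for k :: nat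
  have rN: "N k \<le> r k" for k
    unfolding r_def by (rule trans_le_add2) (rule member_le_sum, auto)
  have r_ge: "k \<le> r k" for k by (simp add: r_def)
  have rN': "N k \<le> r (Suc k)" for k
    using rN[of k] by (simp add: r_def)
  define a where "a k x = cmod (u (r (Suc k)) x - u (r k) x)" for k x
  have [measurable]: "a k \<in> borel_measurable M" for k
    unfolding a_def by measurable
  have a_le: "(\<integral>\<^sup>+x. ennreal ((a k x)\<^sup>2) \<partial>M) \<le> ennreal ((1/4) ^ k)" for k
  proof -
    have "(L2norm M (\<lambda>x. u (r (Suc k)) x - u (r k) x))\<^sup>2 \<le> ((1/2) ^ k)\<^sup>2"
      using N[OF rN' rN, of k] by (intro power_mono) auto
    also have "\<dots> = (1/4) ^ k"
      by (simp add: power2_eq_square flip: power_mult_distrib)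
    finally show ?thesis
      unfolding a_def by (subst nn_integral_L2) (auto intro: L2_diff u ennreal_leI)
  qed
  (* The factor 2^k is small enough for the integral to stay finite and large enough to force decay of a k. *)
  have "(\<integral>\<^sup>+x. (\<Sum>k. ennreal (2 ^ k * (a k x)\<^sup>2)) \<partial>M) = (\<Sum>k. \<integral>\<^sup>+x. ennreal (2 ^ k * (a k x)\<^sup>2) \<partial>M)"
    by (rule nn_integral_suminf) measurable
  also have "\<dots> \<le> (\<Sum>k. ennreal ((1/2) ^ k))"
  proof (rule suminf_le)
    fix k :: nat
    have "(\<integral>\<^sup>+x. ennreal (2 ^ k * (a k x)\<^sup>2) \<partial>M) = ennreal (2 ^ k) * (\<integral>\<^sup>+x. ennreal ((a k x)\<^sup>2) \<partial>M)"
      by (simp add: ennreal_mult nn_integral_cmult)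
    also have "\<dots> \<le> ennreal (2 ^ k) * ennreal ((1/4) ^ k)"
      by (intro mult_left_mono a_le) auto
    also have "\<dots> = ennreal ((1/2) ^ k)"
      by (simp flip: ennreal_mult power_mult_distrib)
    finally show "(\<integral>\<^sup>+x. ennreal (2 ^ k * (a k x)\<^sup>2) \<partial>M) \<le> ennreal ((1/2) ^ k)" .
  qed auto
  also have "\<dots> = ennreal (\<Sum>k. (1/2) ^ k)"
    by (rule suminf_ennreal2) (auto intro: summable_geometric)
  also have "\<dots> < \<infinity>" by simp
  finally have "AE x in M. (\<Sum>k. ennreal (2 ^ k * (a k x)\<^sup>2)) \<noteq> \<infinity>"
    by (intro nn_integral_PInf_AE) auto
  then have lim: "AE x in M. convergent (\<lambda>k. u (r k) x)"
  proof eventually_elim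
    case (elim x)
    then have "summable (\<lambda>k. 2 ^ k * (a k x)\<^sup>2)"
      by (intro summable_suminf_not_top) auto
    then have "bounded (range (\<lambda>k. 2 ^ k * (a k x)\<^sup>2))"
      by (rule convergent_imp_bounded[OF summable_LIMSEQ_zero])
    then obtain C where "\<forall>y\<in>range (\<lambda>k. 2 ^ k * (a k x)\<^sup>2). \<bar>y\<bar> \<le> C"
      unfolding bounded_real by blast
    then have C: "2 ^ k * (a k x)\<^sup>2 \<le> C" for k by simp
    have "a k x \<le> sqrt C * (1 / sqrt 2) ^ k" for k
    proof -
      have "(a k x)\<^sup>2 \<le> C / 2 ^ k"
        using C[of k] by (simp add: field_simps)
      then have "a k x \<le> sqrt (C / 2 ^ k)" by (rule real_le_rsqrt)
      also have "\<dots> = sqrt C * (1 / sqrt 2) ^ k"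
        by (simp add: real_sqrt_divide real_sqrt_power power_one_over field_simps)
      finally show ?thesis .
    qed
    moreover have "summable (\<lambda>k. sqrt C * (1 / sqrt 2) ^ k)"
      by (intro summable_mult summable_geometric) simp
    ultimately have "summable (\<lambda>k. u (r (Suc k)) x - u (r k) x)"
      unfolding a_def by (rule summable_comparison_test'[where N = 0, rotated])
    then have "convergent (\<lambda>n. \<Sum>k<n. u (r (Suc k)) x - u (r k) x)"
      by (simp add: summable_iff_convergent)
    then have "convergent (\<lambda>n. u (r n) x - u (r 0) x)"
      unfolding sum_lessThan_telescope[of "\<lambda>k. u (r k) x"] .
    then have "convergent (\<lambda>n. (u (r n) x - u (r 0) x) + u (r 0) x)"
      by (intro convergent_add convergent_const)
    then show ?case by simp
  qed
  define g where "g x = lim (\<lambda>k. u (r k) x)" for x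
  have [measurable]: "g \<in> borel_measurable M"
    unfolding g_def by (intro borel_measurable_lim_metric) measurable
  have fatou: "(\<integral>\<^sup>+x. ennreal ((cmod (u n x - g x))\<^sup>2) \<partial>M) \<le> ennreal (e\<^sup>2)"
    if e: "0 < e" and K: "\<And>m. m \<ge> K \<Longrightarrow> L2norm M (\<lambda>x. u n x - u m x) < e" for n K e
  proof -
    have "(\<integral>\<^sup>+x. ennreal ((cmod (u n x - g x))\<^sup>2) \<partial>M) =
        (\<integral>\<^sup>+x. liminf (\<lambda>k. ennreal ((cmod (u n x - u (r k) x))\<^sup>2)) \<partial>M)"
    proof (intro nn_integral_cong_AE, use lim in eventually_elim)
      case (elim x)
      then have "(\<lambda>k. u (r k) x) \<longlonglongrightarrow> g x"
        by (simp add: g_def convergent_LIMSEQ_iff)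
      then have "(\<lambda>k. ennreal ((cmod (u n x - u (r k) x))\<^sup>2)) \<longlonglongrightarrow> ennreal ((cmod (u n x - g x))\<^sup>2)"
        by (intro tendsto_intros)
      from lim_imp_Liminf[OF _ this] show ?case by simp
    qed
    also have "\<dots> \<le> liminf (\<lambda>k. \<integral>\<^sup>+x. ennreal ((cmod (u n x - u (r k) x))\<^sup>2) \<partial>M)"
      by (intro nn_integral_liminf) measurable
    also have "\<dots> \<le> limsup (\<lambda>k. \<integral>\<^sup>+x. ennreal ((cmod (u n x - u (r k) x))\<^sup>2) \<partial>M)"
      by (intro Liminf_le_Limsup) simp
    also have "\<dots> \<le> ennreal (e\<^sup>2)"
    proof (rule Limsup_bounded, rule eventually_sequentiallyI[of K])
      fix k assume "K \<le> k"
      then have "L2norm M (\<lambda>x. u n x - u (r k) x) < e" using K r_ge[of k] by simp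
      then show "(\<integral>\<^sup>+x. ennreal ((cmod (u n x - u (r k) x))\<^sup>2) \<partial>M) \<le> ennreal (e\<^sup>2)"
        by (subst nn_integral_L2) (auto intro!: L2_diff u ennreal_leI power_mono)
    qed
    finally show ?thesis .
  qed
  have L2g: "g \<in> L2 M"
  proof -
    obtain K where "\<forall>m\<ge>K. \<forall>n\<ge>K. L2norm M (\<lambda>x. u m x - u n x) < 1"
      using cauchy[of 1] by auto
    then have "(\<lambda>x. u K x - g x) \<in> L2 M"
      using fatou[of 1 K K] by (simp add: L2_iff_nn_integral le_less_trans)
    from L2_diff[OF u[of K] this] show ?thesis by simp
  qed
  moreover have "L2_tendsto M u g sequentially"
  proof (subst L2_tendsto_iff_L2norm)
    show "(\<lambda>n. L2norm M (\<lambda>x. u n x - g x)) \<longlonglongrightarrow> 0"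
    proof (rule LIMSEQ_I)
      fix e :: real assume e: "0 < e"
      obtain K where K: "\<forall>m\<ge>K. \<forall>n\<ge>K. L2norm M (\<lambda>x. u m x - u n x) < e / 2"
        using cauchy[of "e / 2"] e by auto
      have "norm (L2norm M (\<lambda>x. u n x - g x) - 0) < e" if "n \<ge> K" for n
      proof -
        have "ennreal ((L2norm M (\<lambda>x. u n x - g x))\<^sup>2) \<le> ennreal ((e / 2)\<^sup>2)"
          using fatou[of "e / 2" K n] K e that by (simp add: nn_integral_L2 L2_diff u L2g)
        then have "L2norm M (\<lambda>x. u n x - g x) \<le> e / 2"
          using e by (auto intro: power2_le_imp_le)
        then show ?thesis using e by simp
      qed
      then show "\<exists>K. \<forall>n\<ge>K. norm (L2norm M (\<lambda>x. u n x - g x) - 0) < e" by blast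
    qed
  qed (use u L2g in auto)
  ultimately show ?thesis by (rule that)
qed

section \<open>The Fourier transform of integrable functions\<close>

lemma fourier_L1_measurable [measurable]:
  assumes [measurable]: "\<phi> \<in> borel_measurable lborel"
  shows "fourier_L1 \<phi> \<in> borel_measurable lborel"
  unfolding fourier_L1_def[abs_def] by measurable

lemma integrable_fourier_kernel:
  assumes "integrable lborel \<phi>"
  shows "integrable lborel (\<lambda>x. \<phi> x * exp (- (\<i> * complex_of_real x * complex_of_real \<xi>)))"
proof (rule Bochner_Integration.integrable_bound[OF assms])
  have [measurable]: "\<phi> \<in> borel_measurable lborel" using assms by simp
  show "(\<lambda>x. \<phi> x * exp (- (\<i> * complex_of_real x * complex_of_real \<xi>))) \<in> borel_measurable lborel"
    by measurable
qed (simp add: norm_mult)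

lemma fourier_L1_diff:
  assumes "integrable lborel \<phi>" "integrable lborel \<eta>"
  shows "fourier_L1 (\<lambda>x. \<phi> x - \<eta> x) \<xi> = fourier_L1 \<phi> \<xi> - fourier_L1 \<eta> \<xi>"
  unfolding fourier_L1_def left_diff_distrib
  by (subst Bochner_Integration.integral_diff[OF integrable_fourier_kernel[OF assms(1)]
        integrable_fourier_kernel[OF assms(2)]]) (rule right_diff_distrib)

lemma fourier_L1_norm_le:
  assumes "integrable lborel \<phi>"
  shows "cmod (fourier_L1 \<phi> \<xi>) \<le> (LINT x|lborel. cmod (\<phi> x)) / sqrt (2 * pi)"
proof -
  have "cmod (LINT x|lborel. \<phi> x * exp (- (\<i> * complex_of_real x * complex_of_real \<xi>))) \<le>
      (LINT x|lborel. cmod (\<phi> x * exp (- (\<i> * complex_of_real x * complex_of_real \<xi>))))"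
    by (rule integral_norm_bound)
  then show ?thesis
    by (simp add: fourier_L1_def norm_mult norm_divide divide_right_mono)
qed

lemma integral_norm_bound_ennreal_any:
  fixes f :: "'a \<Rightarrow> complex"
  shows "ennreal (norm (integral\<^sup>L M f)) \<le> (\<integral>\<^sup>+x. ennreal (norm (f x)) \<partial>M)"
  by (cases "integrable M f") (simp_all add: integral_norm_bound_ennreal not_integrable_integral_eq)

lemma lborel_integral_uminus:
  fixes f :: "real \<Rightarrow> complex"
  shows "(LINT x|lborel. f (- x)) = (LINT x|lborel. f x)"
  using lborel_integral_real_affine[of "-1" f 0] by simp

lemma fourier_L1_reflect: "fourier_L1 (\<lambda>x. \<phi> (- x)) \<xi> = fourier_L1 \<phi> (- \<xi>)"
  unfolding fourier_L1_def
  by (subst lborel_integral_uminus[symmetric]) simp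

text \<open>Complex conjugates of Fourier transforms are again Fourier transforms. This makes \<open>\<bar>\<F>\<phi>\<bar>\<^sup>2\<close> a product
of two transforms, to which the multiplication formula applies.\<close>

lemma fourier_L1_cnj_reflect: "fourier_L1 (\<lambda>x. cnj (\<phi> (- x))) \<xi> = cnj (fourier_L1 \<phi> \<xi>)"
proof -
  have "(LINT x|lborel. cnj (\<phi> (- x)) * exp (- (\<i> * complex_of_real x * complex_of_real \<xi>))) =
      (LINT x|lborel. cnj (\<phi> x * exp (- (\<i> * complex_of_real x * complex_of_real \<xi>))))"
    by (subst lborel_integral_uminus[symmetric]) (simp add: exp_cnj)
  also have "\<dots> = cnj (LINT x|lborel. \<phi> x * exp (- (\<i> * complex_of_real x * complex_of_real \<xi>)))"
    by (rule Bochner_Integration.integral_cnj)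
  finally show ?thesis
    by (simp add: fourier_L1_def)
qed

text \<open>The Fourier kernel is symmetric in its two arguments, so this is Fubini's theorem.\<close>

lemma fourier_L1_mult_formula:
  assumes \<phi>: "integrable lborel \<phi>" and \<eta>: "integrable lborel \<eta>"
  shows "(LINT \<xi>|lborel. fourier_L1 \<phi> \<xi> * \<eta> \<xi>) = (LINT x|lborel. \<phi> x * fourier_L1 \<eta> x)"
proof -
  have [measurable]: "\<phi> \<in> borel_measurable borel" "\<eta> \<in> borel_measurable borel"
    using \<phi> \<eta> by simp_all
  let ?e = "\<lambda>x \<xi>. exp (- (\<i> * complex_of_real x * complex_of_real \<xi>))"
  have int: "integrable (lborel \<Otimes>\<^sub>M lborel) (\<lambda>(x, \<xi>). \<phi> x * \<eta> \<xi> * ?e x \<xi>)"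
  proof (rule lborel_pair.Fubini_integrable)
    show "(\<lambda>(x, \<xi>). \<phi> x * \<eta> \<xi> * ?e x \<xi>) \<in> borel_measurable (lborel \<Otimes>\<^sub>M lborel)"
      by measurable
    show "integrable lborel (\<lambda>x. LINT \<xi>|lborel. norm (case (x, \<xi>) of (x, \<xi>) \<Rightarrow> \<phi> x * \<eta> \<xi> * ?e x \<xi>))"
      using \<phi> \<eta> by (simp add: norm_mult integrable_norm)
    show "AE x in lborel. integrable lborel (\<lambda>\<xi>. case (x, \<xi>) of (x, \<xi>) \<Rightarrow> \<phi> x * \<eta> \<xi> * ?e x \<xi>)"
    proof (rule AE_I2)
      fix x
      have "integrable lborel (\<lambda>\<xi>. \<phi> x * (\<eta> \<xi> * ?e \<xi> x))"
        using integrable_fourier_kernel[OF \<eta>, of x] by simp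
      then show "integrable lborel (\<lambda>\<xi>. case (x, \<xi>) of (x, \<xi>) \<Rightarrow> \<phi> x * \<eta> \<xi> * ?e x \<xi>)"
        by (simp add: mult_ac)
    qed
  qed
  have "(LINT \<xi>|lborel. LINT x|lborel. \<phi> x * \<eta> \<xi> * ?e x \<xi>) = (LINT x|lborel. LINT \<xi>|lborel. \<phi> x * \<eta> \<xi> * ?e x \<xi>)"
    using lborel_pair.Fubini_integral[OF int] by simp
  moreover have "(LINT x|lborel. \<phi> x * \<eta> \<xi> * ?e x \<xi>) = \<eta> \<xi> * (LINT x|lborel. \<phi> x * ?e x \<xi>)" for \<xi>
    by (subst integral_mult_right_zero[symmetric]) (simp add: mult_ac)
  moreover have "(LINT \<xi>|lborel. \<phi> x * \<eta> \<xi> * ?e x \<xi>) = \<phi> x * (LINT \<xi>|lborel. \<eta> \<xi> * ?e \<xi> x)" for x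
    by (subst integral_mult_right_zero[symmetric]) (simp add: mult_ac)
  ultimately have "(LINT \<xi>|lborel. \<eta> \<xi> * (LINT x|lborel. \<phi> x * ?e x \<xi>)) =
      (LINT x|lborel. \<phi> x * (LINT \<xi>|lborel. \<eta> \<xi> * ?e \<xi> x))"
    by simp
  then have "complex_of_real (1 / sqrt (2 * pi)) * (LINT \<xi>|lborel. \<eta> \<xi> * (LINT x|lborel. \<phi> x * ?e x \<xi>)) =
      complex_of_real (1 / sqrt (2 * pi)) * (LINT x|lborel. \<phi> x * (LINT \<xi>|lborel. \<eta> \<xi> * ?e \<xi> x))"
    by (rule arg_cong)
  then show ?thesis
    unfolding fourier_L1_def
    by (subst (asm) (1 2) integral_mult_right_zero[symmetric]) (simp add: mult_ac)
qed

text \<open>The value at \<open>\<epsilon> \<xi>\<close> of the characteristic function of the standard normal distribution; it tends to \<open>1\<close>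
as \<open>\<epsilon>\<close> tends to \<open>0\<close>.\<close>

definition gauss_weight :: "real \<Rightarrow> real \<Rightarrow> real" where
  "gauss_weight \<epsilon> \<xi> = exp (- (\<epsilon> * \<xi>)\<^sup>2 / 2)"

lemma gauss_weight_eq: "gauss_weight \<epsilon> \<xi> = sqrt (2 * pi) * std_normal_density (\<epsilon> * \<xi>)"
  by (simp add: gauss_weight_def std_normal_density_def)

lemma gauss_weight_measurable [measurable]: "gauss_weight \<epsilon> \<in> borel_measurable borel"
  unfolding gauss_weight_def[abs_def] by measurable

lemma gauss_weight_pos: "0 < gauss_weight \<epsilon> \<xi>" and gauss_weight_le_1: "gauss_weight \<epsilon> \<xi> \<le> 1"
  by (simp_all add: gauss_weight_def)

lemma integrable_gauss_weight:
  assumes "0 < \<epsilon>" shows "integrable lborel (gauss_weight \<epsilon>)"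
proof -
  have "integrable lborel (\<lambda>x. std_normal_density (0 + \<epsilon> * x))"
    using assms by (intro lborel_integrable_real_affine) auto
  then have "integrable lborel (\<lambda>x. sqrt (2 * pi) * std_normal_density (0 + \<epsilon> * x))"
    by (rule integrable_mult_right)
  then show ?thesis
    by (simp only: gauss_weight_eq[abs_def] add_0)
qed

text \<open>The Gaussian is its own Fourier transform up to scaling, and the modulation by \<open>e\<^bsup>-i\<xi>x\<^esup>\<close> translates the
transform. The characteristic function of the normal distribution supplies the value of the integral.\<close>

lemma fourier_L1_gauss_weight:
  assumes "0 < \<epsilon>"
  shows "fourier_L1 (\<lambda>\<xi>. complex_of_real (gauss_weight \<epsilon> \<xi>) * exp (- (\<i> * complex_of_real \<xi> * complex_of_real x))) y
    = complex_of_real (sqrt (2 * pi) / \<epsilon> * std_normal_density ((x + y) / \<epsilon>))"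
proof -
  have "complex_of_real (exp (- t\<^sup>2 / 2)) = (LINT u|lborel. complex_of_real (std_normal_density u) * exp (\<i> * complex_of_real (t * u)))" for t
  proof -
    have "complex_of_real (exp (- t\<^sup>2 / 2)) = char std_normal_distribution t"
      by (simp add: char_std_normal_distribution)
    also have "\<dots> = (LINT u|lborel. std_normal_density u *\<^sub>R iexp (t * u))"
      unfolding char_def by (subst integral_density) auto
    finally show ?thesis by (simp add: scaleR_conv_of_real)
  qed
  from this[of "- (x + y) / \<epsilon>"]
  have "complex_of_real (exp (- ((x + y) / \<epsilon>)\<^sup>2 / 2)) =
      (LINT u|lborel. complex_of_real (std_normal_density u) * exp (\<i> * complex_of_real (- (x + y) / \<epsilon> * u)))"
    by (simp only: minus_divide_left[symmetric] power2_minus)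
  also have "\<dots> = \<epsilon> *\<^sub>R (LINT u|lborel. complex_of_real (std_normal_density (\<epsilon> * u)) * exp (\<i> * complex_of_real (- (x + y) / \<epsilon> * (\<epsilon> * u))))"
    using assms by (subst lborel_integral_real_affine[of \<epsilon> _ 0]) auto
  also have "(\<lambda>u. complex_of_real (std_normal_density (\<epsilon> * u)) * exp (\<i> * complex_of_real (- (x + y) / \<epsilon> * (\<epsilon> * u)))) =
      (\<lambda>u. complex_of_real (1 / sqrt (2 * pi)) * (complex_of_real (gauss_weight \<epsilon> u) * exp (- (\<i> * complex_of_real u * complex_of_real x)) *
        exp (- (\<i> * complex_of_real u * complex_of_real y))))"
  proof
    fix u
    have "- (x + y) / \<epsilon> * (\<epsilon> * u) = - (u * x) + - (u * y)"
      using assms by (simp add: field_simps)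
    then show "complex_of_real (std_normal_density (\<epsilon> * u)) * exp (\<i> * complex_of_real (- (x + y) / \<epsilon> * (\<epsilon> * u))) =
      complex_of_real (1 / sqrt (2 * pi)) * (complex_of_real (gauss_weight \<epsilon> u) * exp (- (\<i> * complex_of_real u * complex_of_real x)) *
        exp (- (\<i> * complex_of_real u * complex_of_real y)))"
      by (simp only: gauss_weight_eq of_real_add of_real_minus of_real_mult distrib_left exp_add)
        (simp add: mult_ac)
  qed
  also have "\<epsilon> *\<^sub>R (LINT u|lborel. complex_of_real (1 / sqrt (2 * pi)) * (complex_of_real (gauss_weight \<epsilon> u) * exp (- (\<i> * complex_of_real u * complex_of_real x)) *
        exp (- (\<i> * complex_of_real u * complex_of_real y)))) = complex_of_real \<epsilon> *
      fourier_L1 (\<lambda>\<xi>. complex_of_real (gauss_weight \<epsilon> \<xi>) * exp (- (\<i> * complex_of_real \<xi> * complex_of_real x))) y"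
    unfolding fourier_L1_def by (simp only: integral_mult_right_zero scaleR_conv_of_real)
  finally show ?thesis
    using assms by (simp add: std_normal_density_def field_simps)
qed

text \<open>The right-hand side is the autocorrelation of \<open>\<phi>\<close>, averaged over shifts \<open>\<epsilon> s\<close> with \<open>s\<close> normally distributed.
It arises by applying the multiplication formula twice: once to move the transform from \<open>\<phi>\<close> to the damped
factor \<open>\<F>\<eta>\<close>, the conjugate of \<open>\<F>\<phi>\<close>, and once to move it from \<open>\<eta>\<close> to the Gaussian.\<close>

lemma fourier_L1_gauss_identity:
  assumes \<epsilon>: "0 < \<epsilon>" and \<phi>: "integrable lborel \<phi>"
  shows "complex_of_real (LINT \<xi>|lborel. gauss_weight \<epsilon> \<xi> * (cmod (fourier_L1 \<phi> \<xi>))\<^sup>2) =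
    (LINT x|lborel. \<phi> x * (LINT s|lborel. complex_of_real (std_normal_density s) * cnj (\<phi> (x - \<epsilon> * s))))"
proof -
  have [measurable]: "\<phi> \<in> borel_measurable borel"
    using \<phi> by simp
  define \<eta> where "\<eta> y = cnj (\<phi> (- y))" for y
  have \<eta>: "integrable lborel \<eta>"
  proof (rule Bochner_Integration.integrable_bound)
    show "integrable lborel (\<lambda>x. \<phi> (- x))"
      using lborel_integrable_real_affine[OF \<phi>, of "-1" 0] by simp
  qed (auto simp: \<eta>_def[abs_def])
  have F\<eta>: "fourier_L1 \<eta> \<xi> = cnj (fourier_L1 \<phi> \<xi>)" for \<xi>
    unfolding \<eta>_def by (rule fourier_L1_cnj_reflect)
  let ?w = "\<lambda>\<xi>. complex_of_real (gauss_weight \<epsilon> \<xi>)"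
  have w: "integrable lborel ?w"
    using integrable_gauss_weight[OF \<epsilon>] by simp
  have [measurable]: "fourier_L1 \<eta> \<in> borel_measurable borel" "\<eta> \<in> borel_measurable borel"
    using fourier_L1_measurable[of \<eta>] \<eta> by auto
  have h: "integrable lborel (\<lambda>\<xi>. ?w \<xi> * fourier_L1 \<eta> \<xi>)"
  proof (rule Bochner_Integration.integrable_bound)
    let ?C = "(LINT x|lborel. cmod (\<eta> x)) / sqrt (2 * pi)"
    show "integrable lborel (\<lambda>\<xi>. ?C * gauss_weight \<epsilon> \<xi>)"
      using integrable_gauss_weight[OF \<epsilon>] by simp
    show "AE \<xi> in lborel. norm (?w \<xi> * fourier_L1 \<eta> \<xi>) \<le> norm (?C * gauss_weight \<epsilon> \<xi>)"
    proof (rule AE_I2)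
      fix \<xi>
      have "cmod (fourier_L1 \<eta> \<xi>) \<le> \<bar>?C\<bar>" using fourier_L1_norm_le[OF \<eta>, of \<xi>] by linarith
      then have "cmod (fourier_L1 \<eta> \<xi>) * \<bar>gauss_weight \<epsilon> \<xi>\<bar> \<le> \<bar>?C\<bar> * \<bar>gauss_weight \<epsilon> \<xi>\<bar>"
        by (rule mult_right_mono) simp
      then show "norm (?w \<xi> * fourier_L1 \<eta> \<xi>) \<le> norm (?C * gauss_weight \<epsilon> \<xi>)"
        by (simp add: norm_mult abs_mult mult.commute)
    qed
  qed measurable
  have inner: "fourier_L1 (\<lambda>\<xi>. ?w \<xi> * fourier_L1 \<eta> \<xi>) x =
      (LINT s|lborel. complex_of_real (std_normal_density s) * cnj (\<phi> (x - \<epsilon> * s)))" for x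
  proof -
    let ?v = "\<lambda>\<xi>. ?w \<xi> * exp (- (\<i> * complex_of_real \<xi> * complex_of_real x))"
    have "(LINT \<xi>|lborel. ?w \<xi> * fourier_L1 \<eta> \<xi> * exp (- (\<i> * complex_of_real \<xi> * complex_of_real x))) =
        (LINT \<xi>|lborel. fourier_L1 \<eta> \<xi> * ?v \<xi>)"
      by (simp add: mult_ac)
    also have "\<dots> = (LINT y|lborel. \<eta> y * fourier_L1 ?v y)"
      by (rule fourier_L1_mult_formula[OF \<eta> integrable_fourier_kernel[OF w]])
    also have "\<dots> = (LINT y|lborel. \<eta> y * complex_of_real (sqrt (2 * pi) / \<epsilon> * std_normal_density ((x + y) / \<epsilon>)))"
      by (simp only: fourier_L1_gauss_weight[OF \<epsilon>])
    also have "\<dots> = \<epsilon> *\<^sub>R (LINT s|lborel. \<eta> (- x + \<epsilon> * s) *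
        complex_of_real (sqrt (2 * pi) / \<epsilon> * std_normal_density ((x + (- x + \<epsilon> * s)) / \<epsilon>)))"
      using \<epsilon> by (subst lborel_integral_real_affine[of \<epsilon> _ "-x"]) auto
    also have "\<dots> = (LINT s|lborel. \<epsilon> *\<^sub>R (\<eta> (- x + \<epsilon> * s) *
        complex_of_real (sqrt (2 * pi) / \<epsilon> * std_normal_density ((x + (- x + \<epsilon> * s)) / \<epsilon>))))"
      by (rule integral_scaleR_right[symmetric])
    also have "\<dots> = (LINT s|lborel. complex_of_real (sqrt (2 * pi)) * (complex_of_real (std_normal_density s) * cnj (\<phi> (x - \<epsilon> * s))))"
      using \<epsilon> by (intro Bochner_Integration.integral_cong) (auto simp: \<eta>_def scaleR_conv_of_real field_simps)
    finally show ?thesis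
      by (simp add: fourier_L1_def)
  qed
  have "complex_of_real (LINT \<xi>|lborel. gauss_weight \<epsilon> \<xi> * (cmod (fourier_L1 \<phi> \<xi>))\<^sup>2) =
      (LINT \<xi>|lborel. fourier_L1 \<phi> \<xi> * (?w \<xi> * fourier_L1 \<eta> \<xi>))"
    unfolding integral_complex_of_real[symmetric] F\<eta>
    by (intro Bochner_Integration.integral_cong) (simp_all only: of_real_mult complex_norm_square mult_ac)
  also have "\<dots> = (LINT x|lborel. \<phi> x * fourier_L1 (\<lambda>\<xi>. ?w \<xi> * fourier_L1 \<eta> \<xi>) x)"
    by (rule fourier_L1_mult_formula[OF \<phi> h])
  finally show ?thesis unfolding inner .
qed

lemma gauss_weight_tendsto: "(\<lambda>n. gauss_weight (1 / real (Suc n)) \<xi>) \<longlonglongrightarrow> 1"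
proof -
  have "(\<lambda>n. exp (- (1 / real (Suc n) * \<xi>)\<^sup>2 / 2)) \<longlonglongrightarrow> exp (- (0 * \<xi>)\<^sup>2 / 2)"
    by (intro tendsto_intros LIMSEQ_Suc[OF lim_1_over_n]) auto
  then show ?thesis by (simp add: gauss_weight_def)
qed

lemma integrable_gauss_fourier:
  assumes "0 < \<epsilon>" "integrable lborel \<phi>"
  shows "integrable lborel (\<lambda>\<xi>. gauss_weight \<epsilon> \<xi> * (cmod (fourier_L1 \<phi> \<xi>))\<^sup>2)"
proof (rule Bochner_Integration.integrable_bound)
  have [measurable]: "fourier_L1 \<phi> \<in> borel_measurable lborel"
    using fourier_L1_measurable assms(2) by auto
  let ?C = "(LINT x|lborel. cmod (\<phi> x)) / sqrt (2 * pi)"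
  show "integrable lborel (\<lambda>\<xi>. ?C\<^sup>2 * gauss_weight \<epsilon> \<xi>)"
    using integrable_gauss_weight[OF assms(1)] by simp
  show "(\<lambda>\<xi>. gauss_weight \<epsilon> \<xi> * (cmod (fourier_L1 \<phi> \<xi>))\<^sup>2) \<in> borel_measurable lborel"
    by measurable
  have "(cmod (fourier_L1 \<phi> \<xi>))\<^sup>2 \<le> ?C\<^sup>2" for \<xi>
    by (intro power_mono fourier_L1_norm_le assms) simp
  then have "gauss_weight \<epsilon> \<xi> * (cmod (fourier_L1 \<phi> \<xi>))\<^sup>2 \<le> gauss_weight \<epsilon> \<xi> * ?C\<^sup>2" for \<xi>
    by (rule mult_left_mono) (simp add: less_imp_le gauss_weight_pos)
  then show "AE \<xi> in lborel. norm (gauss_weight \<epsilon> \<xi> * (cmod (fourier_L1 \<phi> \<xi>))\<^sup>2) \<le> norm (?C\<^sup>2 * gauss_weight \<epsilon> \<xi>)"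
    using gauss_weight_pos[of \<epsilon>] by (intro AE_I2) (simp add: abs_mult mult.commute abs_of_pos)
qed

text \<open>By the Cauchy--Schwarz inequality every shifted autocorrelation is at most \<open>\<parallel>\<phi>\<parallel>\<^sup>2\<close>, hence so is their
average in \<open>fourier_L1_gauss_identity\<close>; Fatou's lemma removes the damping.\<close>

lemma fourier_L1_contraction:
  assumes \<phi>: "integrable lborel \<phi>" "\<phi> \<in> L2 lborel"
  shows "fourier_L1 \<phi> \<in> L2 lborel" and "L2norm lborel (fourier_L1 \<phi>) \<le> L2norm lborel \<phi>"
proof -
  have [measurable]: "\<phi> \<in> borel_measurable borel" "fourier_L1 \<phi> \<in> borel_measurable borel"
    using \<phi>(1) fourier_L1_measurable[of \<phi>] by auto
  have le: "(\<integral>\<^sup>+\<xi>. ennreal (gauss_weight \<epsilon> \<xi> * (cmod (fourier_L1 \<phi> \<xi>))\<^sup>2) \<partial>lborel) \<le> ennreal ((L2norm lborel \<phi>)\<^sup>2)"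
    if \<epsilon>: "0 < \<epsilon>" for \<epsilon>
  proof -
    let ?J = "LINT \<xi>|lborel. gauss_weight \<epsilon> \<xi> * (cmod (fourier_L1 \<phi> \<xi>))\<^sup>2"
    have shift: "(\<integral>\<^sup>+x. ennreal (cmod (\<phi> x)) * ennreal (cmod (\<phi> (x - \<epsilon> * s))) \<partial>lborel) \<le> ennreal ((L2norm lborel \<phi>)\<^sup>2)" for s
    proof (rule ennreal_power2_le_imp_le)
      have tr: "(\<integral>\<^sup>+x. ennreal ((cmod (\<phi> (x - \<epsilon> * s)))\<^sup>2) \<partial>lborel) = (\<integral>\<^sup>+x. ennreal ((cmod (\<phi> x))\<^sup>2) \<partial>lborel)"
        using nn_integral_real_affine[of "\<lambda>x. ennreal ((cmod (\<phi> x))\<^sup>2)" 1 "- (\<epsilon> * s)"] by (simp add: algebra_simps)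
      have "(\<integral>\<^sup>+x. ennreal (cmod (\<phi> x)) * ennreal (cmod (\<phi> (x - \<epsilon> * s))) \<partial>lborel)\<^sup>2 \<le>
          (\<integral>\<^sup>+x. (ennreal (cmod (\<phi> x)))\<^sup>2 \<partial>lborel) * (\<integral>\<^sup>+x. (ennreal (cmod (\<phi> (x - \<epsilon> * s))))\<^sup>2 \<partial>lborel)"
        by (rule Cauchy_Schwarz_nn_integral) measurable
      also have "\<dots> = (ennreal ((L2norm lborel \<phi>)\<^sup>2))\<^sup>2"
        by (simp add: ennreal_power tr nn_integral_L2[OF \<phi>(2)])
          (simp add: ennreal_mult[symmetric] flip: power_mult power_add)
      finally show "(\<integral>\<^sup>+x. ennreal (cmod (\<phi> x)) * ennreal (cmod (\<phi> (x - \<epsilon> * s))) \<partial>lborel)\<^sup>2 \<le> (ennreal ((L2norm lborel \<phi>)\<^sup>2))\<^sup>2" .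
    qed simp
    have J: "0 \<le> ?J" by (intro Bochner_Integration.integral_nonneg) (simp add: less_imp_le gauss_weight_pos)
    have "(\<integral>\<^sup>+\<xi>. ennreal (gauss_weight \<epsilon> \<xi> * (cmod (fourier_L1 \<phi> \<xi>))\<^sup>2) \<partial>lborel) = ennreal ?J"
      by (intro nn_integral_eq_integral integrable_gauss_fourier \<epsilon> \<phi>) (simp add: less_imp_le gauss_weight_pos)
    also have "\<dots> = ennreal (norm (complex_of_real ?J))"
      using J by simp
    also have "complex_of_real ?J = (LINT x|lborel. \<phi> x * (LINT s|lborel. complex_of_real (std_normal_density s) * cnj (\<phi> (x - \<epsilon> * s))))"
      by (rule fourier_L1_gauss_identity[OF \<epsilon> \<phi>(1)])
    also have "ennreal (norm \<dots>) \<le> (\<integral>\<^sup>+x. ennreal (norm (\<phi> x * (LINT s|lborel. complex_of_real (std_normal_density s) * cnj (\<phi> (x - \<epsilon> * s))))) \<partial>lborel)"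
      by (rule integral_norm_bound_ennreal_any)
    also have "\<dots> \<le> (\<integral>\<^sup>+x. (\<integral>\<^sup>+s. ennreal (std_normal_density s) * (ennreal (cmod (\<phi> x)) * ennreal (cmod (\<phi> (x - \<epsilon> * s)))) \<partial>lborel) \<partial>lborel)"
    proof (rule nn_integral_mono)
      fix x
      have "ennreal (norm (\<phi> x * (LINT s|lborel. complex_of_real (std_normal_density s) * cnj (\<phi> (x - \<epsilon> * s)))))
        \<le> ennreal (cmod (\<phi> x)) * (\<integral>\<^sup>+s. ennreal (norm (complex_of_real (std_normal_density s) * cnj (\<phi> (x - \<epsilon> * s)))) \<partial>lborel)"
        by (simp only: norm_mult[of "\<phi> x"] ennreal_mult norm_ge_zero)
          (intro mult_left_mono integral_norm_bound_ennreal_any, simp)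
      also have "\<dots> = (\<integral>\<^sup>+s. ennreal (std_normal_density s) * (ennreal (cmod (\<phi> x)) * ennreal (cmod (\<phi> (x - \<epsilon> * s)))) \<partial>lborel)"
        by (subst nn_integral_cmult[symmetric]) (auto simp: norm_mult ennreal_mult mult_ac)
      finally show "ennreal (norm (\<phi> x * (LINT s|lborel. complex_of_real (std_normal_density s) * cnj (\<phi> (x - \<epsilon> * s)))))
        \<le> (\<integral>\<^sup>+s. ennreal (std_normal_density s) * (ennreal (cmod (\<phi> x)) * ennreal (cmod (\<phi> (x - \<epsilon> * s)))) \<partial>lborel)" .
    qed
    also have "\<dots> = (\<integral>\<^sup>+s. (\<integral>\<^sup>+x. ennreal (std_normal_density s) * (ennreal (cmod (\<phi> x)) * ennreal (cmod (\<phi> (x - \<epsilon> * s)))) \<partial>lborel) \<partial>lborel)"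
      by (rule lborel_pair.Fubini') measurable
    also have "\<dots> = (\<integral>\<^sup>+s. ennreal (std_normal_density s) * (\<integral>\<^sup>+x. ennreal (cmod (\<phi> x)) * ennreal (cmod (\<phi> (x - \<epsilon> * s))) \<partial>lborel) \<partial>lborel)"
      by (intro nn_integral_cong nn_integral_cmult) measurable
    also have "\<dots> \<le> (\<integral>\<^sup>+s. ennreal (std_normal_density s) * ennreal ((L2norm lborel \<phi>)\<^sup>2) \<partial>lborel)"
      by (intro nn_integral_mono mult_left_mono shift) simp
    also have "\<dots> = (\<integral>\<^sup>+s. ennreal (std_normal_density s) \<partial>lborel) * ennreal ((L2norm lborel \<phi>)\<^sup>2)"
      by (rule nn_integral_multc) simp
    also have "(\<integral>\<^sup>+s. ennreal (std_normal_density s) \<partial>lborel) = 1"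
      by (subst nn_integral_eq_integral) auto
    finally show ?thesis by simp
  qed
  have "(\<integral>\<^sup>+\<xi>. ennreal ((cmod (fourier_L1 \<phi> \<xi>))\<^sup>2) \<partial>lborel) =
      (\<integral>\<^sup>+\<xi>. liminf (\<lambda>n. ennreal (gauss_weight (1 / real (Suc n)) \<xi> * (cmod (fourier_L1 \<phi> \<xi>))\<^sup>2)) \<partial>lborel)"
  proof (rule nn_integral_cong)
    fix \<xi>
    have "(\<lambda>n. ennreal (gauss_weight (1 / real (Suc n)) \<xi> * (cmod (fourier_L1 \<phi> \<xi>))\<^sup>2)) \<longlonglongrightarrow> ennreal (1 * (cmod (fourier_L1 \<phi> \<xi>))\<^sup>2)"
      by (intro tendsto_intros gauss_weight_tendsto)
    from lim_imp_Liminf[OF _ this]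
    show "ennreal ((cmod (fourier_L1 \<phi> \<xi>))\<^sup>2) = liminf (\<lambda>n. ennreal (gauss_weight (1 / real (Suc n)) \<xi> * (cmod (fourier_L1 \<phi> \<xi>))\<^sup>2))"
      by simp
  qed
  also have "\<dots> \<le> liminf (\<lambda>n. \<integral>\<^sup>+\<xi>. ennreal (gauss_weight (1 / real (Suc n)) \<xi> * (cmod (fourier_L1 \<phi> \<xi>))\<^sup>2) \<partial>lborel)"
    by (rule nn_integral_liminf) measurable
  also have "\<dots> \<le> limsup (\<lambda>n. \<integral>\<^sup>+\<xi>. ennreal (gauss_weight (1 / real (Suc n)) \<xi> * (cmod (fourier_L1 \<phi> \<xi>))\<^sup>2) \<partial>lborel)"
    by (intro Liminf_le_Limsup) simp
  also have "\<dots> \<le> ennreal ((L2norm lborel \<phi>)\<^sup>2)"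
    by (intro Limsup_bounded always_eventually allI le) simp
  finally have *: "(\<integral>\<^sup>+\<xi>. ennreal ((cmod (fourier_L1 \<phi> \<xi>))\<^sup>2) \<partial>lborel) \<le> ennreal ((L2norm lborel \<phi>)\<^sup>2)" .
  have "(\<integral>\<^sup>+\<xi>. ennreal ((cmod (fourier_L1 \<phi> \<xi>))\<^sup>2) \<partial>lborel) < \<infinity>"
    by (rule le_less_trans[OF *]) simp
  then show **: "fourier_L1 \<phi> \<in> L2 lborel"
    by (simp add: L2_iff_nn_integral)
  show "L2norm lborel (fourier_L1 \<phi>) \<le> L2norm lborel \<phi>"
    using * unfolding nn_integral_L2[OF **] by (auto intro: power2_le_imp_le)
qed

section \<open>Plancherel's theorem\<close>

text \<open>For continuous \<open>\<phi>\<close> the averaged autocorrelation tends to its value at shift \<open>0\<close>, which is \<open>\<parallel>\<phi>\<parallel>\<^sup>2\<close>, while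
the damped integral tends to \<open>\<parallel>\<F>\<phi>\<parallel>\<^sup>2\<close>; boundedness and integrability of \<open>\<phi>\<close> give the dominating functions.\<close>

lemma fourier_L1_isometry_continuous:
  assumes \<phi>: "integrable lborel \<phi>" "\<phi> \<in> L2 lborel"
    and cont: "continuous_on UNIV \<phi>" and bdd: "\<And>x. cmod (\<phi> x) \<le> B"
  shows "L2norm lborel (fourier_L1 \<phi>) = L2norm lborel \<phi>"
proof -
  have [measurable]: "\<phi> \<in> borel_measurable borel" "fourier_L1 \<phi> \<in> borel_measurable borel"
    using \<phi>(1) fourier_L1_measurable[of \<phi>] by auto
  have isCont: "isCont \<phi> x" for x
    using cont by (simp add: continuous_on_eq_continuous_at)
  have B: "0 \<le> B" using order_trans[OF norm_ge_zero bdd[of 0]] .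
  define \<epsilon> where "\<epsilon> n = 1 / real (Suc n)" for n
  have \<epsilon>: "0 < \<epsilon> n" for n by (simp add: \<epsilon>_def)
  have \<epsilon>0: "\<epsilon> \<longlonglongrightarrow> 0"
    unfolding \<epsilon>_def by (rule LIMSEQ_Suc[OF lim_1_over_n])
  let ?K = "\<lambda>n x. LINT s|lborel. complex_of_real (std_normal_density s) * cnj (\<phi> (x - \<epsilon> n * s))"
  have K_lim: "(\<lambda>n. ?K n x) \<longlonglongrightarrow> cnj (\<phi> x)" for x
  proof -
    have "(\<lambda>n. ?K n x) \<longlonglongrightarrow> (LINT s|lborel. complex_of_real (std_normal_density s) * cnj (\<phi> x))"
    proof (rule integral_dominated_convergence[where w = "\<lambda>s. std_normal_density s * B"])
      show "integrable lborel (\<lambda>s. std_normal_density s * B)" by simp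
      show "AE s in lborel. (\<lambda>n. complex_of_real (std_normal_density s) * cnj (\<phi> (x - \<epsilon> n * s)))
          \<longlonglongrightarrow> complex_of_real (std_normal_density s) * cnj (\<phi> x)"
      proof (intro AE_I2 tendsto_intros)
        fix s
        have "(\<lambda>n. x - \<epsilon> n * s) \<longlonglongrightarrow> x - 0 * s" by (intro tendsto_intros \<epsilon>0)
        then show "(\<lambda>n. \<phi> (x - \<epsilon> n * s)) \<longlonglongrightarrow> \<phi> x"
          using isCont_tendsto_compose[OF isCont[of x]] by simp
      qed
      show "AE s in lborel. norm (complex_of_real (std_normal_density s) * cnj (\<phi> (x - \<epsilon> n * s))) \<le> std_normal_density s * B" for n
        by (intro AE_I2) (simp add: norm_mult mult_left_mono bdd)
    qed measurable
    also have "(LINT s|lborel. complex_of_real (std_normal_density s) * cnj (\<phi> x)) = cnj (\<phi> x)"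
      by simp
    finally show ?thesis .
  qed
  have K_bdd: "cmod (?K n x) \<le> B" for n x
  proof -
    have "cmod (?K n x) \<le> (LINT s|lborel. cmod (complex_of_real (std_normal_density s) * cnj (\<phi> (x - \<epsilon> n * s))))"
      by (rule integral_norm_bound)
    also have "\<dots> \<le> (LINT s|lborel. std_normal_density s * B)"
      by (rule integral_mono') (simp_all add: norm_mult mult_left_mono bdd B)
    finally show ?thesis by simp
  qed
  have "(\<lambda>n. LINT x|lborel. \<phi> x * ?K n x) \<longlonglongrightarrow> (LINT x|lborel. \<phi> x * cnj (\<phi> x))"
  proof (rule integral_dominated_convergence[where w = "\<lambda>x. cmod (\<phi> x) * B"])
    show "integrable lborel (\<lambda>x. cmod (\<phi> x) * B)" using \<phi>(1) by simp
    show "AE x in lborel. (\<lambda>n. \<phi> x * ?K n x) \<longlonglongrightarrow> \<phi> x * cnj (\<phi> x)"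
      by (intro AE_I2 tendsto_intros K_lim)
    show "AE x in lborel. norm (\<phi> x * ?K n x) \<le> cmod (\<phi> x) * B" for n
      by (intro AE_I2) (simp only: norm_mult mult_left_mono K_bdd norm_ge_zero)
  qed measurable
  also have "(\<lambda>n. LINT x|lborel. \<phi> x * ?K n x) =
      (\<lambda>n. complex_of_real (LINT \<xi>|lborel. gauss_weight (\<epsilon> n) \<xi> * (cmod (fourier_L1 \<phi> \<xi>))\<^sup>2))"
    using fourier_L1_gauss_identity[OF \<epsilon> \<phi>(1)] by simp
  also have "(LINT x|lborel. \<phi> x * cnj (\<phi> x)) = complex_of_real ((L2norm lborel \<phi>)\<^sup>2)"
    unfolding L2norm_power2 integral_complex_of_real[symmetric]
    by (simp only: complex_norm_square)
  finally have lim1: "(\<lambda>n. LINT \<xi>|lborel. gauss_weight (\<epsilon> n) \<xi> * (cmod (fourier_L1 \<phi> \<xi>))\<^sup>2) \<longlonglongrightarrow> (L2norm lborel \<phi>)\<^sup>2"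
    by (simp only: tendsto_of_real_iff)
  have "(\<lambda>n. LINT \<xi>|lborel. gauss_weight (\<epsilon> n) \<xi> * (cmod (fourier_L1 \<phi> \<xi>))\<^sup>2) \<longlonglongrightarrow> (LINT \<xi>|lborel. (cmod (fourier_L1 \<phi> \<xi>))\<^sup>2)"
  proof (rule integral_dominated_convergence[where w = "\<lambda>\<xi>. (cmod (fourier_L1 \<phi> \<xi>))\<^sup>2"])
    show "integrable lborel (\<lambda>\<xi>. (cmod (fourier_L1 \<phi> \<xi>))\<^sup>2)"
      by (rule L2_integrable[OF fourier_L1_contraction(1)[OF \<phi>]])
    show "AE \<xi> in lborel. (\<lambda>n. gauss_weight (\<epsilon> n) \<xi> * (cmod (fourier_L1 \<phi> \<xi>))\<^sup>2) \<longlonglongrightarrow> (cmod (fourier_L1 \<phi> \<xi>))\<^sup>2"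
    proof (rule AE_I2)
      fix \<xi>
      have "(\<lambda>n. gauss_weight (\<epsilon> n) \<xi> * (cmod (fourier_L1 \<phi> \<xi>))\<^sup>2) \<longlonglongrightarrow> 1 * (cmod (fourier_L1 \<phi> \<xi>))\<^sup>2"
        unfolding \<epsilon>_def by (intro tendsto_intros gauss_weight_tendsto)
      then show "(\<lambda>n. gauss_weight (\<epsilon> n) \<xi> * (cmod (fourier_L1 \<phi> \<xi>))\<^sup>2) \<longlonglongrightarrow> (cmod (fourier_L1 \<phi> \<xi>))\<^sup>2"
        by simp
    qed
    show "AE \<xi> in lborel. norm (gauss_weight (\<epsilon> n) \<xi> * (cmod (fourier_L1 \<phi> \<xi>))\<^sup>2) \<le> (cmod (fourier_L1 \<phi> \<xi>))\<^sup>2" for n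
      using gauss_weight_pos[of "\<epsilon> n"] gauss_weight_le_1[of "\<epsilon> n"]
      by (intro AE_I2) (simp add: abs_mult mult_left_le_one_le less_imp_le abs_of_pos)
  qed measurable
  from LIMSEQ_unique[OF this lim1] show ?thesis
    by (simp add: L2norm_power2[symmetric])
qed

lemma L2_tendsto_cutoff:
  assumes \<psi>: "\<psi> \<in> L2 M" and A: "\<And>n. A n \<in> sets M" and ev: "\<And>x. x \<in> space M \<Longrightarrow> \<forall>\<^sub>F n in sequentially. x \<in> A n"
  shows "L2_tendsto M (\<lambda>n x. indicator (A n) x *\<^sub>R \<psi> x) \<psi> sequentially"
proof (rule L2_dominated_convergence[where w = "\<lambda>x. cmod (\<psi> x)"])
  show "integrable M (\<lambda>x. (cmod (\<psi> x))\<^sup>2)" by (rule L2_integrable[OF \<psi>])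
  show "AE x in M. cmod (indicator (A n) x *\<^sub>R \<psi> x - \<psi> x) \<le> cmod (\<psi> x)" for n
    by (auto simp: indicator_def)
  show "AE x in M. (\<lambda>n. indicator (A n) x *\<^sub>R \<psi> x) \<longlonglongrightarrow> \<psi> x"
  proof (rule AE_I2)
    fix x assume "x \<in> space M"
    from ev[OF this] have "\<forall>\<^sub>F n in sequentially. indicator (A n) x *\<^sub>R \<psi> x = \<psi> x"
      by eventually_elim simp
    then show "(\<lambda>n. indicator (A n) x *\<^sub>R \<psi> x) \<longlonglongrightarrow> \<psi> x"
      by (rule tendsto_eventually)
  qed
qed (use L2_measurable[OF L2_indicator[OF \<psi> A]] L2_measurable[OF \<psi>] in auto)

lemma indicator_L2:
  assumes A: "A \<in> sets M" "emeasure M A < \<infinity>"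
  shows "(\<lambda>x. complex_of_real (indicator A x)) \<in> L2 M"
proof -
  have "integrable M (indicator A :: _ \<Rightarrow> real)"
    using A by (simp add: integrable_indicator_iff)
  then have "integrable M (\<lambda>x. (cmod (complex_of_real (indicator A x)))\<^sup>2)"
    by (rule Bochner_Integration.integrable_cong[THEN iffD1, rotated 2]) (auto simp: indicator_def)
  then show ?thesis using A by (simp add: L2_def)
qed

lemma integrable_L2_cutoff:
  assumes \<psi>: "\<psi> \<in> L2 M" and A: "A \<in> sets M" "emeasure M A < \<infinity>"
  shows "integrable M (\<lambda>x. indicator A x *\<^sub>R \<psi> x)"
  using integrable_L2_mult[OF indicator_L2[OF A] \<psi>] by (simp add: scaleR_conv_of_real)

text \<open>Lebesgue measurable functions are almost everywhere limits of continuous ones. Projecting these onto the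
disc of radius \<open>B\<close> and multiplying by a continuous cutoff equal to \<open>1\<close> on \<open>[-R, R]\<close> preserves the limit and
provides a common bound, so that the convergence also holds in \<open>L\<^sup>2\<close>.\<close>

lemma continuous_approx_bounded:
  fixes \<psi> :: "real \<Rightarrow> complex"
  assumes meas: "\<psi> \<in> borel_measurable borel" and B: "\<And>x. cmod (\<psi> x) \<le> B" and supp: "\<And>x. R < \<bar>x\<bar> \<Longrightarrow> \<psi> x = 0"
  obtains h where "\<And>n. continuous_on UNIV (h n)" "\<And>n x. cmod (h n x) \<le> B"
    "\<And>n. integrable lborel (h n)" "\<And>n. h n \<in> L2 lborel" "L2_tendsto lborel h \<psi> sequentially"
proof -
  have B0: "0 \<le> B" using order_trans[OF norm_ge_zero B[of 0]] .
  have "\<psi> measurable_on UNIV"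
    using measurable_completion[of \<psi> lborel borel] meas
    by (simp add: measurable_on_iff_borel_measurable lebesgue_on_UNIV_eq)
  then obtain N g where N: "negligible N" and g: "\<And>n. continuous_on UNIV (g n)"
    and lim: "\<And>x. x \<notin> N \<Longrightarrow> (\<lambda>n. g n x) \<longlonglongrightarrow> \<psi> x"
    unfolding measurable_on_def by auto
  define \<kappa> where "\<kappa> x = max 0 (min 1 (R + 1 - \<bar>x\<bar>))" for x :: real
  have \<kappa>: "0 \<le> \<kappa> x" "\<kappa> x \<le> 1" "\<kappa> x *\<^sub>R \<psi> x = \<psi> x" for x
    using supp[of x] by (auto simp: \<kappa>_def max_def min_def)
  have \<kappa>_cont: "continuous_on UNIV \<kappa>"
    unfolding \<kappa>_def by (intro continuous_intros)
  define p where "p = closest_point (cball (0::complex) B)"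
  have p_cont: "continuous_on UNIV p"
    unfolding p_def using B0 by (intro continuous_on_closest_point) auto
  have p_bdd: "cmod (p z) \<le> B" for z
    using closest_point_in_set[of "cball (0::complex) B" z] B0 by (simp add: p_def)
  have p_id: "p z = z" if "cmod z \<le> B" for z
    using that by (simp add: p_def closest_point_self)
  define h where "h n x = \<kappa> x *\<^sub>R p (g n x)" for n x
  have h_cont: "continuous_on UNIV (h n)" for n
    unfolding h_def
    by (intro continuous_intros \<kappa>_cont continuous_on_compose2[OF p_cont g]) auto
  have h_bdd: "cmod (h n x) \<le> B" for n x
    using mult_mono[OF \<kappa>(2)[of x] p_bdd[of "g n x"]] \<kappa>(1)[of x] by (simp add: h_def)
  have h_supp: "h n x = 0" if "R + 1 < \<bar>x\<bar>" for n x
    using that by (simp add: h_def \<kappa>_def)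
  have h_meas [measurable]: "h n \<in> borel_measurable borel" for n
    by (rule borel_measurable_continuous_onI[OF h_cont])
  note [measurable] = meas
  let ?I = "{- (R + 1)..R + 1}"
  have int_ind: "integrable lborel (\<lambda>x. indicator ?I x * C)" for C :: real
    by (simp add: integrable_indicator_iff emeasure_lborel_Icc_eq)
  have h_int: "integrable lborel (h n)" for n
  proof (rule Bochner_Integration.integrable_bound[OF int_ind[of B]])
    show "AE x in lborel. norm (h n x) \<le> norm (indicator ?I x * B)"
      using h_bdd[of n] h_supp[of _ n] B0 by (intro AE_I2) (auto simp: indicator_def)
  qed simp
  have h_int2: "integrable lborel (\<lambda>x. (cmod (h n x))\<^sup>2)" for n
  proof (rule Bochner_Integration.integrable_bound[OF int_ind[of "B\<^sup>2"]])
    show "AE x in lborel. norm ((cmod (h n x))\<^sup>2) \<le> norm (indicator ?I x * B\<^sup>2)"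
      using power_mono[OF h_bdd[of n], of _ 2] h_supp[of _ n] B0 by (intro AE_I2) (auto simp: indicator_def)
  qed simp
  have "L2_tendsto lborel h \<psi> sequentially"
  proof (rule L2_dominated_convergence[where w = "\<lambda>x. indicator ?I x * (2 * B)"])
    have "(\<lambda>x. (indicator ?I x * (2 * B))\<^sup>2) = (\<lambda>x. indicator ?I x * (2 * B)\<^sup>2)"
      by (auto simp: indicator_def)
    then show "integrable lborel (\<lambda>x. (indicator ?I x * (2 * B))\<^sup>2)"
      using int_ind[of "(2 * B)\<^sup>2"] by simp
    show "AE x in lborel. cmod (h n x - \<psi> x) \<le> indicator ?I x * (2 * B)" for n
    proof (rule AE_I2)
      fix x
      show "cmod (h n x - \<psi> x) \<le> indicator ?I x * (2 * B)"
      proof (cases "x \<in> ?I")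
        case True
        then show ?thesis
          using norm_triangle_ineq4[of "h n x" "\<psi> x"] h_bdd[of n x] B[of x] by simp
      next
        case False
        then have "R + 1 < \<bar>x\<bar>" "R < \<bar>x\<bar>" by auto
        then show ?thesis using h_supp[of x n] supp[of x] B0 by simp
      qed
    qed
    have "AE x in lebesgue. x \<notin> N"
      using N by (intro AE_not_in) (simp add: negligible_iff_null_sets)
    then have "AE x in lborel. x \<notin> N"
      by (simp add: AE_completion_iff)
    then show "AE x in lborel. (\<lambda>n. h n x) \<longlonglongrightarrow> \<psi> x"
    proof eventually_elim
      case (elim x)
      have "isCont p (\<psi> x)" using p_cont by (simp add: continuous_on_eq_continuous_at)
      from isCont_tendsto_compose[OF this lim[OF elim]]
      have "(\<lambda>n. h n x) \<longlonglongrightarrow> \<kappa> x *\<^sub>R p (\<psi> x)"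
        unfolding h_def by (intro tendsto_intros)
      then show ?case by (simp add: p_id B \<kappa>)
    qed
  qed simp_all
  with h_cont h_bdd h_int h_int2 show ?thesis
    by (intro that[of h]) (simp_all add: L2_def)
qed

text \<open>Truncating \<open>\<psi>\<close> where it or its argument is large changes it little in \<open>L\<^sup>2\<close> and leaves a bounded function of
bounded support.\<close>

lemma continuous_dense_L2:
  fixes \<psi> :: "real \<Rightarrow> complex"
  assumes \<psi>: "\<psi> \<in> L2 lborel" and e: "0 < e"
  shows "\<exists>h. continuous_on UNIV h \<and> (\<exists>B. \<forall>x. cmod (h x) \<le> B) \<and> integrable lborel h \<and> h \<in> L2 lborel \<and>
    L2norm lborel (\<lambda>x. h x - \<psi> x) < e"
proof -
  have [measurable]: "\<psi> \<in> borel_measurable borel" using L2_measurable[OF \<psi>] by simp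
  define A where "A n = {x. \<bar>x\<bar> \<le> real n \<and> cmod (\<psi> x) \<le> real n}" for n
  have A [measurable]: "A n \<in> sets borel" for n unfolding A_def by measurable
  let ?t = "\<lambda>n x. indicator (A n) x *\<^sub>R \<psi> x"
  have t: "?t n \<in> L2 lborel" for n by (intro L2_indicator \<psi>) simp
  have "L2_tendsto lborel ?t \<psi> sequentially"
  proof (rule L2_tendsto_cutoff[OF \<psi>])
    fix x
    show "\<forall>\<^sub>F n in sequentially. x \<in> A n"
    proof (rule eventually_sequentiallyI)
      fix n assume "nat \<lceil>max \<bar>x\<bar> (cmod (\<psi> x))\<rceil> \<le> n"
      then show "x \<in> A n" unfolding A_def by (simp add: nat_le_iff ceiling_le_iff)
    qed
  qed simp
  then have "(\<lambda>n. L2norm lborel (\<lambda>x. ?t n x - \<psi> x)) \<longlonglongrightarrow> 0"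
    by (simp add: L2_tendsto_iff_L2norm t \<psi>)
  from order_tendstoD(2)[OF this, of "e / 2"] e
  obtain n where n: "L2norm lborel (\<lambda>x. ?t n x - \<psi> x) < e / 2"
    by (auto simp: eventually_sequentially)
  obtain h where h: "\<And>k. continuous_on UNIV (h k)" "\<And>k x. cmod (h k x) \<le> real n"
    "\<And>k. integrable lborel (h k)" "\<And>k. h k \<in> L2 lborel" "L2_tendsto lborel h (?t n) sequentially"
  proof (rule continuous_approx_bounded[of "?t n" "real n" "real n"])
    show "?t n \<in> borel_measurable borel" by measurable
  qed (auto simp: A_def indicator_def)
  have "(\<lambda>k. L2norm lborel (\<lambda>x. h k x - ?t n x)) \<longlonglongrightarrow> 0"
    using h(5) by (simp add: L2_tendsto_iff_L2norm t h(4))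
  from order_tendstoD(2)[OF this, of "e / 2"] e
  obtain k where k: "L2norm lborel (\<lambda>x. h k x - ?t n x) < e / 2"
    by (auto simp: eventually_sequentially)
  have "L2norm lborel (\<lambda>x. h k x - \<psi> x) < e"
    using L2norm_triangle[OF h(4)[of k] t[of n] \<psi>] n k by simp
  with h show ?thesis by blast
qed

text \<open>Both sides are continuous in \<open>\<phi>\<close> for the \<open>L\<^sup>2\<close> norm, the left one because the transform is a contraction, and
they agree on a dense set of continuous functions.\<close>

theorem Plancherel_L1:
  assumes \<phi>: "integrable lborel \<phi>" "\<phi> \<in> L2 lborel"
  shows "L2norm lborel (fourier_L1 \<phi>) = L2norm lborel \<phi>"
proof -
  have "\<bar>L2norm lborel (fourier_L1 \<phi>) - L2norm lborel \<phi>\<bar> \<le> e" if e: "0 < e" for e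
  proof -
    have "0 < e / 2" using e by simp
    obtain h B where h: "continuous_on UNIV h" "\<And>x. cmod (h x) \<le> B" "integrable lborel h" "h \<in> L2 lborel"
      and le: "L2norm lborel (\<lambda>x. h x - \<phi> x) < e / 2"
      using continuous_dense_L2[OF \<phi>(2) \<open>0 < e / 2\<close>] by blast
    have iso: "L2norm lborel (fourier_L1 h) = L2norm lborel h"
      by (rule fourier_L1_isometry_continuous[OF h(3,4,1,2)])
    have "L2norm lborel (\<lambda>\<xi>. fourier_L1 h \<xi> - fourier_L1 \<phi> \<xi>) = L2norm lborel (fourier_L1 (\<lambda>x. h x - \<phi> x))"
      by (simp add: fourier_L1_diff[OF h(3) \<phi>(1), abs_def])
    also have "\<dots> \<le> L2norm lborel (\<lambda>x. h x - \<phi> x)"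
      using h \<phi> by (intro fourier_L1_contraction L2_diff) auto
    finally have "\<bar>L2norm lborel (fourier_L1 h) - L2norm lborel (fourier_L1 \<phi>)\<bar> < e / 2"
      using L2norm_diff_le[OF fourier_L1_contraction(1)[OF h(3,4)] fourier_L1_contraction(1)[OF \<phi>]] le
      by linarith
    moreover have "\<bar>L2norm lborel h - L2norm lborel \<phi>\<bar> < e / 2"
      using L2norm_diff_le[OF h(4) \<phi>(2)] le by linarith
    ultimately show ?thesis using iso by linarith
  qed
  from field_le_epsilon[of "\<bar>L2norm lborel (fourier_L1 \<phi>) - L2norm lborel \<phi>\<bar>" 0] this
  show ?thesis by simp
qed

section \<open>The Fourier transform on square-integrable functions\<close>

lemma is_fourier_L2D:
  assumes "is_fourier_L2 \<psi> g" shows "\<psi> \<in> L2 lborel" "g \<in> L2 lborel"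
  using assms by (auto simp: is_fourier_L2_def)

lemma is_fourier_L2_L1:
  assumes "integrable lborel \<phi>" "\<phi> \<in> L2 lborel"
  shows "is_fourier_L2 \<phi> (fourier_L1 \<phi>)"
  unfolding is_fourier_L2_def
proof (intro conjI exI[of _ "\<lambda>_. \<phi>"] allI)
  show "L2_tendsto lborel (\<lambda>n. \<phi>) \<phi> sequentially" "L2_tendsto lborel (\<lambda>n. fourier_L1 \<phi>) (fourier_L1 \<phi>) sequentially"
    by (simp_all add: L2_tendsto_def)
qed (use assms fourier_L1_contraction in auto)

lemma L2_tendsto_diff:
  assumes "\<And>n. u n \<in> L2 M" "g \<in> L2 M" "\<And>n. v n \<in> L2 M" "h \<in> L2 M"
    and "L2_tendsto M u g F" "L2_tendsto M v h F"
  shows "L2_tendsto M (\<lambda>n x. u n x - v n x) (\<lambda>x. g x - h x) F"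
proof (subst L2_tendsto_iff_L2norm)
  show "((\<lambda>i. L2norm M (\<lambda>x. u i x - v i x - (g x - h x))) \<longlongrightarrow> 0) F"
  proof (rule Lim_null_comparison)
    show "((\<lambda>i. L2norm M (\<lambda>x. u i x - g x) + L2norm M (\<lambda>x. h x - v i x)) \<longlongrightarrow> 0) F"
      using tendsto_add[of "\<lambda>i. L2norm M (\<lambda>x. u i x - g x)" 0 F "\<lambda>i. L2norm M (\<lambda>x. v i x - h x)" 0] assms
      by (simp add: L2_tendsto_iff_L2norm L2norm_minus_commute[of M h])
    have "L2norm M (\<lambda>x. u i x - v i x - (g x - h x)) \<le> L2norm M (\<lambda>x. u i x - g x) + L2norm M (\<lambda>x. h x - v i x)" for i
      using L2norm_triangle_add[OF L2_diff[OF assms(1)[of i] assms(2)] L2_diff[OF assms(4) assms(3)[of i]]]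
      by (simp add: algebra_simps)
    then show "\<forall>\<^sub>F i in F. norm (L2norm M (\<lambda>x. u i x - v i x - (g x - h x))) \<le>
        L2norm M (\<lambda>x. u i x - g x) + L2norm M (\<lambda>x. h x - v i x)"
      by simp
  qed
qed (simp_all add: L2_diff assms)

lemma is_fourier_L2_diff:
  assumes "is_fourier_L2 \<psi> g" "is_fourier_L2 \<psi>' g'"
  shows "is_fourier_L2 (\<lambda>x. \<psi> x - \<psi>' x) (\<lambda>x. g x - g' x)"
proof -
  obtain \<phi> where \<phi>: "\<And>n. integrable lborel (\<phi> n)" "\<And>n::nat. \<phi> n \<in> L2 lborel"
    "L2_tendsto lborel \<phi> \<psi> sequentially" "L2_tendsto lborel (\<lambda>n. fourier_L1 (\<phi> n)) g sequentially"
    using assms(1) unfolding is_fourier_L2_def by blast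
  obtain \<phi>' where \<phi>': "\<And>n. integrable lborel (\<phi>' n)" "\<And>n::nat. \<phi>' n \<in> L2 lborel"
    "L2_tendsto lborel \<phi>' \<psi>' sequentially" "L2_tendsto lborel (\<lambda>n. fourier_L1 (\<phi>' n)) g' sequentially"
    using assms(2) unfolding is_fourier_L2_def by blast
  note L2 = is_fourier_L2D[OF assms(1)] is_fourier_L2D[OF assms(2)]
  have eq: "fourier_L1 (\<lambda>x. \<phi> n x - \<phi>' n x) = (\<lambda>\<xi>. fourier_L1 (\<phi> n) \<xi> - fourier_L1 (\<phi>' n) \<xi>)" for n
    using fourier_L1_diff[OF \<phi>(1) \<phi>'(1)] by blast
  show ?thesis
    unfolding is_fourier_L2_def
  proof (intro conjI exI[of _ "\<lambda>n x. \<phi> n x - \<phi>' n x"] allI L2_tendsto_diff)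
    show "L2_tendsto lborel (\<lambda>n. fourier_L1 (\<lambda>x. \<phi> n x - \<phi>' n x)) (\<lambda>x. g x - g' x) sequentially"
      unfolding eq by (intro L2_tendsto_diff fourier_L1_contraction \<phi> \<phi>' L2)
  qed (use \<phi> \<phi>' L2 in \<open>auto intro: L2_diff\<close>)
qed

theorem Plancherel_L2:
  assumes "is_fourier_L2 \<psi> g"
  shows "L2norm lborel g = L2norm lborel \<psi>"
proof -
  obtain \<phi> where \<phi>: "\<And>n. integrable lborel (\<phi> n)" "\<And>n::nat. \<phi> n \<in> L2 lborel"
    "L2_tendsto lborel \<phi> \<psi> sequentially" "L2_tendsto lborel (\<lambda>n. fourier_L1 (\<phi> n)) g sequentially"
    using assms unfolding is_fourier_L2_def by blast
  note L2 = is_fourier_L2D[OF assms]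
  have "(\<lambda>n. L2norm lborel (\<phi> n)) \<longlonglongrightarrow> L2norm lborel \<psi>"
    by (rule L2_tendsto_L2norm) (use \<phi> L2 in auto)
  moreover have "(\<lambda>n. L2norm lborel (fourier_L1 (\<phi> n))) \<longlonglongrightarrow> L2norm lborel g"
    by (rule L2_tendsto_L2norm) (use \<phi> L2 fourier_L1_contraction in auto)
  ultimately show ?thesis
    using \<phi> by (auto simp: Plancherel_L1 intro: LIMSEQ_unique)
qed

lemma is_fourier_L2_unique:
  assumes "is_fourier_L2 \<psi> g" "is_fourier_L2 \<psi> h"
  shows "AE \<xi> in lborel. g \<xi> = h \<xi>"
proof (rule L2norm_eq_0_AE)
  show "L2norm lborel (\<lambda>x. g x - h x) = 0"
    using Plancherel_L2[OF is_fourier_L2_diff[OF assms]] by (simp add: L2norm_def)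
qed (use assms[THEN is_fourier_L2D(2)] in auto)

lemma L2_tendsto_cong_AE:
  assumes [measurable]: "g \<in> borel_measurable M" "h \<in> borel_measurable M" "\<And>i. u i \<in> borel_measurable M"
    and eq: "AE x in M. g x = h x"
  shows "L2_tendsto M u g F \<longleftrightarrow> L2_tendsto M u h F"
proof -
  have "(\<integral>\<^sup>+ x. ennreal ((cmod (u i x - g x))\<^sup>2) \<partial>M) = (\<integral>\<^sup>+ x. ennreal ((cmod (u i x - h x))\<^sup>2) \<partial>M)" for i
  proof (rule nn_integral_cong_AE)
    show "AE x in M. ennreal ((cmod (u i x - g x))\<^sup>2) = ennreal ((cmod (u i x - h x))\<^sup>2)"
      using eq by eventually_elim simp
  qed
  then show ?thesis by (simp add: L2_tendsto_def)
qed

lemma is_fourier_L2_cong_AE: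
  assumes "is_fourier_L2 \<psi> g" and meas: "\<psi>' \<in> borel_measurable lborel" "g' \<in> borel_measurable lborel"
    and eq: "AE x in lborel. \<psi> x = \<psi>' x" "AE x in lborel. g x = g' x"
  shows "is_fourier_L2 \<psi>' g'"
proof -
  obtain \<phi> where \<phi>: "\<And>n. integrable lborel (\<phi> n)" "\<And>n::nat. \<phi> n \<in> L2 lborel"
    "L2_tendsto lborel \<phi> \<psi> sequentially" "L2_tendsto lborel (\<lambda>n. fourier_L1 (\<phi> n)) g sequentially"
    using assms(1) unfolding is_fourier_L2_def by blast
  note L2 = is_fourier_L2D[OF assms(1)]
  have F: "fourier_L1 (\<phi> n) \<in> borel_measurable lborel" for n
    by (intro fourier_L1_measurable L2_measurable \<phi>)
  have "L2_tendsto lborel \<phi> \<psi>' sequentially" "L2_tendsto lborel (\<lambda>n. fourier_L1 (\<phi> n)) g' sequentially"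
    using \<phi>(3,4) L2_tendsto_cong_AE[where u = \<phi>, OF L2_measurable[OF L2(1)] meas(1) L2_measurable[OF \<phi>(2)] eq(1)]
      L2_tendsto_cong_AE[where u = "\<lambda>n. fourier_L1 (\<phi> n)", OF L2_measurable[OF L2(2)] meas(2) F eq(2)] by simp_all
  with \<phi> show ?thesis
    using L2_cong_AE[OF L2(1) meas(1) eq(1)] L2_cong_AE[OF L2(2) meas(2) eq(2)]
    unfolding is_fourier_L2_def by blast
qed

lemma
  fixes \<psi> :: "real \<Rightarrow> complex"
  assumes \<psi>: "\<psi> \<in> L2 lborel"
  shows integrable_L2_interval: "integrable lborel (\<lambda>x. indicator {- R..R} x *\<^sub>R \<psi> x)"
    and L2_interval: "(\<lambda>x. indicator {- R..R} x *\<^sub>R \<psi> x) \<in> L2 lborel"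
    and L2_tendsto_interval: "filterlim r at_top sequentially \<Longrightarrow> L2_tendsto lborel (\<lambda>n x. indicator {- r n..r n} x *\<^sub>R \<psi> x) \<psi> sequentially"
proof -
  show "integrable lborel (\<lambda>x. indicator {- R..R} x *\<^sub>R \<psi> x)"
    by (intro integrable_L2_cutoff \<psi>) (auto simp: emeasure_lborel_Icc_eq)
  show "(\<lambda>x. indicator {- R..R} x *\<^sub>R \<psi> x) \<in> L2 lborel"
    by (intro L2_indicator \<psi>) simp
  show "L2_tendsto lborel (\<lambda>n x. indicator {- r n..r n} x *\<^sub>R \<psi> x) \<psi> sequentially"
    if r: "filterlim r at_top sequentially"
  proof (rule L2_tendsto_cutoff[OF \<psi>])
    fix x :: real
    have "\<forall>\<^sub>F n in sequentially. \<bar>x\<bar> \<le> r n"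
      using r by (simp add: filterlim_at_top)
    then show "\<forall>\<^sub>F n in sequentially. x \<in> {- r n..r n}"
      by eventually_elim auto
  qed simp
qed

text \<open>The truncations of \<open>\<psi>\<close> to \<open>[-n, n]\<close> lie in \<open>L\<^sup>1 \<inter> L\<^sup>2\<close> and converge to \<open>\<psi>\<close>; by the isometry their transforms
form a Cauchy sequence.\<close>

lemma is_fourier_L2_exists:
  assumes \<psi>: "\<psi> \<in> L2 lborel" shows "\<exists>g. is_fourier_L2 \<psi> g"
proof -
  let ?t = "\<lambda>n x. indicator {- real n..real n} x *\<^sub>R \<psi> x"
  have t: "integrable lborel (?t n)" "?t n \<in> L2 lborel" "L2_tendsto lborel ?t \<psi> sequentially" for n
    using integrable_L2_interval[OF \<psi>] L2_interval[OF \<psi>]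
      L2_tendsto_interval[OF \<psi> filterlim_real_sequentially] by auto
  have Ft: "fourier_L1 (?t n) \<in> L2 lborel" for n by (rule fourier_L1_contraction(1)[OF t(1,2)])
  have lim: "(\<lambda>n. L2norm lborel (\<lambda>x. ?t n x - \<psi> x)) \<longlonglongrightarrow> 0"
    using t \<psi> by (simp add: L2_tendsto_iff_L2norm)
  obtain g where g: "g \<in> L2 lborel" "L2_tendsto lborel (\<lambda>n. fourier_L1 (?t n)) g sequentially"
  proof (rule L2_complete[OF Ft])
    fix e :: real assume e: "0 < e"
    from order_tendstoD(2)[OF lim, of "e / 2"] e
    obtain N where N: "\<And>n. N \<le> n \<Longrightarrow> L2norm lborel (\<lambda>x. ?t n x - \<psi> x) < e / 2"
      by (auto simp: eventually_sequentially)
    have "L2norm lborel (\<lambda>\<xi>. fourier_L1 (?t m) \<xi> - fourier_L1 (?t n) \<xi>) < e" if "m \<ge> N" "n \<ge> N" for m n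
    proof -
      have "L2norm lborel (\<lambda>\<xi>. fourier_L1 (?t m) \<xi> - fourier_L1 (?t n) \<xi>) = L2norm lborel (\<lambda>x. ?t m x - ?t n x)"
        using Plancherel_L2[OF is_fourier_L2_diff[OF is_fourier_L2_L1[OF t(1,2)] is_fourier_L2_L1[OF t(1,2)]]] .
      also have "\<dots> \<le> L2norm lborel (\<lambda>x. ?t m x - \<psi> x) + L2norm lborel (\<lambda>x. ?t n x - \<psi> x)"
        using L2norm_triangle[OF t(2)[of m] \<psi> t(2)[of n]] by (simp add: L2norm_minus_commute[of lborel \<psi>])
      also have "\<dots> < e" using N[OF that(1)] N[OF that(2)] by simp
      finally show ?thesis .
    qed
    then show "\<exists>N. \<forall>m\<ge>N. \<forall>n\<ge>N. L2norm lborel (\<lambda>x. fourier_L1 (?t m) x - fourier_L1 (?t n) x) < e" by blast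
  qed
  have "is_fourier_L2 \<psi> g"
    unfolding is_fourier_L2_def by (intro conjI exI[of _ ?t] allI \<psi> g t)
  then show ?thesis by blast
qed

text \<open>The graph of the Fourier transform is closed: \<open>\<psi>\<close> has some transform \<open>h\<close>, and by the isometry the \<open>v n\<close>
converge to \<open>h\<close> as well as to \<open>g\<close>.\<close>

lemma is_fourier_L2_limit:
  assumes F: "\<And>n::nat. is_fourier_L2 (u n) (v n)" and "\<psi> \<in> L2 lborel" "g \<in> L2 lborel"
    and lim: "L2_tendsto lborel u \<psi> sequentially" "L2_tendsto lborel v g sequentially"
  shows "is_fourier_L2 \<psi> g"
proof -
  obtain h where h: "is_fourier_L2 \<psi> h" using is_fourier_L2_exists[OF assms(2)] by blast
  note L2 = is_fourier_L2D[OF h] is_fourier_L2D[OF F]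
  have "L2norm lborel (\<lambda>x. v n x - h x) = L2norm lborel (\<lambda>x. u n x - \<psi> x)" for n
    by (rule Plancherel_L2[OF is_fourier_L2_diff[OF F h]])
  then have "L2_tendsto lborel v h sequentially"
    using lim(1) L2 assms(2) by (simp add: L2_tendsto_iff_L2norm)
  then have "AE x in lborel. h x = g x"
    using L2 assms(3) lim(2) by (intro L2_tendsto_unique[of v]) auto
  then show ?thesis
    using is_fourier_L2_cong_AE[OF h L2_measurable[OF assms(2)] L2_measurable[OF assms(3)]] by simp
qed

lemma is_fourier_L2_fourier_L2:
  assumes "\<psi> \<in> L2 lborel" shows "is_fourier_L2 \<psi> (fourier_L2 \<psi>)"
  unfolding fourier_L2_def using is_fourier_L2_exists[OF assms] by (rule someI_ex)

lemma fourier_L2_eqI: "is_fourier_L2 \<psi> g \<Longrightarrow> AE \<xi> in lborel. g \<xi> = fourier_L2 \<psi> \<xi>"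
  by (rule is_fourier_L2_unique[OF _ is_fourier_L2_fourier_L2]) (auto dest: is_fourier_L2D)

lemma nn_integral_lborel_uminus:
  fixes f :: "real \<Rightarrow> ennreal"
  assumes [measurable]: "f \<in> borel_measurable borel"
  shows "(\<integral>\<^sup>+x. f (- x) \<partial>lborel) = (\<integral>\<^sup>+x. f x \<partial>lborel)"
  using nn_integral_real_affine[OF assms, of "-1" 0] by simp

lemma L2_reflect:
  fixes g :: "real \<Rightarrow> complex"
  assumes "g \<in> L2 lborel" shows "(\<lambda>x. g (- x)) \<in> L2 lborel"
proof -
  have [measurable]: "g \<in> borel_measurable borel" using L2_measurable[OF assms] by simp
  show ?thesis
    using assms nn_integral_lborel_uminus[of "\<lambda>x. ennreal ((cmod (g x))\<^sup>2)"] by (simp add: L2_iff_nn_integral)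
qed

lemma L2_tendsto_reflect:
  fixes g :: "real \<Rightarrow> complex"
  assumes "\<And>i. u i \<in> borel_measurable lborel" "g \<in> borel_measurable lborel" "L2_tendsto lborel u g F"
  shows "L2_tendsto lborel (\<lambda>i x. u i (- x)) (\<lambda>x. g (- x)) F"
proof -
  have [measurable]: "u i \<in> borel_measurable borel" "g \<in> borel_measurable borel" for i
    using assms(1)[of i] assms(2) by simp_all
  show ?thesis
    using assms(3) nn_integral_lborel_uminus[where f = "\<lambda>x. ennreal ((cmod (u i x - g x))\<^sup>2)" for i]
    by (simp add: L2_tendsto_def)
qed

lemma is_fourier_L2_reflect:
  assumes "is_fourier_L2 \<psi> g" shows "is_fourier_L2 (\<lambda>x. \<psi> (- x)) (\<lambda>\<xi>. g (- \<xi>))"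
proof -
  obtain \<phi> where \<phi>: "\<And>n. integrable lborel (\<phi> n)" "\<And>n::nat. \<phi> n \<in> L2 lborel"
    "L2_tendsto lborel \<phi> \<psi> sequentially" "L2_tendsto lborel (\<lambda>n. fourier_L1 (\<phi> n)) g sequentially"
    using assms(1) unfolding is_fourier_L2_def by blast
  note L2 = is_fourier_L2D[OF assms(1)]
  have eq: "fourier_L1 (\<lambda>x. \<phi> n (- x)) = (\<lambda>\<xi>. fourier_L1 (\<phi> n) (- \<xi>))" for n
    using fourier_L1_reflect by blast
  show ?thesis
    unfolding is_fourier_L2_def
  proof (intro conjI exI[of _ "\<lambda>n x. \<phi> n (- x)"] allI L2_tendsto_reflect L2_reflect L2)
    show "L2_tendsto lborel (\<lambda>n. fourier_L1 (\<lambda>x. \<phi> n (- x))) (\<lambda>x. g (- x)) sequentially"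
      unfolding eq using \<phi> L2 by (intro L2_tendsto_reflect fourier_L1_measurable L2_measurable)
    show "integrable lborel (\<lambda>x. \<phi> n (- x))" for n
      using lborel_integrable_real_affine[OF \<phi>(1), of "-1" n 0] by simp
  qed (use \<phi> L2[THEN L2_measurable] L2_measurable[OF \<phi>(2)] in auto)
qed

text \<open>With the truncations \<open>c n\<close> of \<open>G = \<F>\<psi>\<close> to \<open>[-n, n]\<close>, expand \<open>\<parallel>\<F>(c n) - \<psi>(-\<cdot>)\<parallel>\<^sup>2\<close>. The multiplication
formula moves the transform in the cross term from \<open>c n\<close> to \<open>\<psi>\<close>, and turns it into \<open>\<integral> c n \<cdot> cnj G = \<parallel>c n\<parallel>\<^sup>2\<close>.
What remains is \<open>\<parallel>\<psi>\<parallel>\<^sup>2 - \<parallel>c n\<parallel>\<^sup>2\<close>, which tends to \<open>\<parallel>\<psi>\<parallel>\<^sup>2 - \<parallel>G\<parallel>\<^sup>2 = 0\<close>.\<close>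

lemma Fourier_inversion_L1:
  assumes \<psi>: "integrable lborel \<psi>" "\<psi> \<in> L2 lborel"
  shows "is_fourier_L2 (fourier_L1 \<psi>) (\<lambda>x. \<psi> (- x))"
proof -
  define G where "G = fourier_L1 \<psi>"
  have G: "G \<in> L2 lborel" unfolding G_def by (rule fourier_L1_contraction(1)[OF \<psi>])
  define c where "c n x = indicator {- real n..real n} x *\<^sub>R G x" for n x
  have c: "integrable lborel (c n)" "c n \<in> L2 lborel" "L2_tendsto lborel c G sequentially" for n
    unfolding c_def using integrable_L2_interval[OF G] L2_interval[OF G]
      L2_tendsto_interval[OF G filterlim_real_sequentially] by auto
  have refl: "(\<lambda>x. \<psi> (- x)) \<in> L2 lborel" by (rule L2_reflect[OF \<psi>(2)])
  define \<eta> where "\<eta> x = cnj (\<psi> (- x))" for x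
  have \<eta>: "integrable lborel \<eta>"
    unfolding \<eta>_def using lborel_integrable_real_affine[OF \<psi>(1), of "-1" 0] by simp
  have \<eta>2: "\<eta> \<in> L2 lborel" unfolding \<eta>_def by (rule L2_cnj[OF refl])
  have "(L2norm lborel (\<lambda>x. fourier_L1 (c n) x - \<psi> (- x)))\<^sup>2 = (L2norm lborel \<psi>)\<^sup>2 - (L2norm lborel (c n))\<^sup>2" for n
  proof -
    have Fc: "fourier_L1 (c n) \<in> L2 lborel" by (rule fourier_L1_contraction(1)[OF c(1,2)])
    (* |a - b|^2 = |a|^2 + |b|^2 - a cnj b - cnj (a cnj b), with eta = cnj b *)
    have pt: "complex_of_real ((cmod (fourier_L1 (c n) x - \<psi> (- x)))\<^sup>2) =
        complex_of_real ((cmod (fourier_L1 (c n) x))\<^sup>2) + complex_of_real ((cmod (\<psi> (- x)))\<^sup>2)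
        - fourier_L1 (c n) x * \<eta> x - cnj (fourier_L1 (c n) x * \<eta> x)" for x
      unfolding complex_norm_square \<eta>_def by (simp add: algebra_simps)
    have cross: "(LINT x|lborel. fourier_L1 (c n) x * \<eta> x) = complex_of_real ((L2norm lborel (c n))\<^sup>2)"
    proof -
      have "(LINT x|lborel. fourier_L1 (c n) x * \<eta> x) = (LINT x|lborel. c n x * fourier_L1 \<eta> x)"
        by (rule fourier_L1_mult_formula[OF c(1) \<eta>])
      also have "\<dots> = (LINT x|lborel. complex_of_real ((cmod (c n x))\<^sup>2))"
        unfolding \<eta>_def fourier_L1_cnj_reflect complex_norm_square
        by (intro Bochner_Integration.integral_cong) (auto simp: c_def G_def indicator_def)
      finally show ?thesis by (simp only: L2norm_power2 integral_complex_of_real)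
    qed
    have int: "integrable lborel (\<lambda>x. complex_of_real ((cmod (fourier_L1 (c n) x))\<^sup>2))"
      "integrable lborel (\<lambda>x. complex_of_real ((cmod (\<psi> (- x)))\<^sup>2))"
      "integrable lborel (\<lambda>x. fourier_L1 (c n) x * \<eta> x)"
      "integrable lborel (\<lambda>x. cnj (fourier_L1 (c n) x * \<eta> x))"
      by (rule integrable_of_real L2_integrable[OF Fc] L2_integrable[OF refl]
          integrable_L2_mult[OF Fc \<eta>2] integrable_cnj)+
    have "complex_of_real ((L2norm lborel (\<lambda>x. fourier_L1 (c n) x - \<psi> (- x)))\<^sup>2) =
        (LINT x|lborel. complex_of_real ((cmod (fourier_L1 (c n) x))\<^sup>2) + complex_of_real ((cmod (\<psi> (- x)))\<^sup>2)
        - fourier_L1 (c n) x * \<eta> x - cnj (fourier_L1 (c n) x * \<eta> x))"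
      unfolding L2norm_power2 integral_complex_of_real[symmetric] pt ..
    also have "\<dots> = (LINT x|lborel. complex_of_real ((cmod (fourier_L1 (c n) x))\<^sup>2)) +
        (LINT x|lborel. complex_of_real ((cmod (\<psi> (- x)))\<^sup>2)) - (LINT x|lborel. fourier_L1 (c n) x * \<eta> x)
        - (LINT x|lborel. cnj (fourier_L1 (c n) x * \<eta> x))"
      using int by (simp del: of_real_power complex_cnj_mult Bochner_Integration.integral_cnj integral_complex_of_real)
    also have "\<dots> = complex_of_real ((L2norm lborel (fourier_L1 (c n)))\<^sup>2) + complex_of_real ((L2norm lborel \<psi>)\<^sup>2)
       - complex_of_real ((L2norm lborel (c n))\<^sup>2) - complex_of_real ((L2norm lborel (c n))\<^sup>2)"
    proof -
      have "(LINT x|lborel. complex_of_real ((cmod (\<psi> (- x)))\<^sup>2)) = complex_of_real ((L2norm lborel \<psi>)\<^sup>2)"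
        using lborel_integral_uminus[of "\<lambda>x. complex_of_real ((cmod (\<psi> x))\<^sup>2)"]
        by (simp only: L2norm_power2 integral_complex_of_real)
      moreover have "(LINT x|lborel. cnj (fourier_L1 (c n) x * \<eta> x)) = complex_of_real ((L2norm lborel (c n))\<^sup>2)"
        unfolding Bochner_Integration.integral_cnj cross by simp
      ultimately show ?thesis
        unfolding cross by (simp only: L2norm_power2 integral_complex_of_real)
    qed
    also have "\<dots> = complex_of_real ((L2norm lborel \<psi>)\<^sup>2 - (L2norm lborel (c n))\<^sup>2)"
      by (simp add: Plancherel_L1[OF c(1,2)])
    finally show ?thesis by (simp only: of_real_eq_iff)
  qed
  then have "(\<lambda>n. L2norm lborel (\<lambda>x. fourier_L1 (c n) x - \<psi> (- x))) = (\<lambda>n. sqrt ((L2norm lborel \<psi>)\<^sup>2 - (L2norm lborel (c n))\<^sup>2))"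
    by (intro ext) (metis L2norm_nonneg real_sqrt_abs abs_of_nonneg)
  also have "\<dots> \<longlonglongrightarrow> sqrt ((L2norm lborel \<psi>)\<^sup>2 - (L2norm lborel G)\<^sup>2)"
    by (intro tendsto_intros L2_tendsto_L2norm c G always_eventually allI)
  also have "sqrt ((L2norm lborel \<psi>)\<^sup>2 - (L2norm lborel G)\<^sup>2) = 0"
    unfolding G_def by (simp add: Plancherel_L1[OF \<psi>])
  finally have "L2_tendsto lborel (\<lambda>n. fourier_L1 (c n)) (\<lambda>x. \<psi> (- x)) sequentially"
    using refl fourier_L1_contraction(1)[OF c(1,2)] by (simp add: L2_tendsto_iff_L2norm)
  then show ?thesis
    unfolding is_fourier_L2_def G_def[symmetric] by (intro conjI exI[of _ c] allI G refl c)
qed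

theorem Fourier_inversion_L2:
  assumes "is_fourier_L2 \<psi> g" shows "is_fourier_L2 g (\<lambda>x. \<psi> (- x))"
proof -
  obtain \<phi> where \<phi>: "\<And>n. integrable lborel (\<phi> n)" "\<And>n::nat. \<phi> n \<in> L2 lborel"
    "L2_tendsto lborel \<phi> \<psi> sequentially" "L2_tendsto lborel (\<lambda>n. fourier_L1 (\<phi> n)) g sequentially"
    using assms(1) unfolding is_fourier_L2_def by blast
  note L2 = is_fourier_L2D[OF assms(1)]
  show ?thesis
  proof (rule is_fourier_L2_limit[where u = "\<lambda>n. fourier_L1 (\<phi> n)" and v = "\<lambda>n x. \<phi> n (- x)"])
    show "is_fourier_L2 (fourier_L1 (\<phi> n)) (\<lambda>x. \<phi> n (- x))" for n
      by (rule Fourier_inversion_L1[OF \<phi>(1,2)])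
    show "L2_tendsto lborel (\<lambda>n x. \<phi> n (- x)) (\<lambda>x. \<psi> (- x)) sequentially"
      by (intro L2_tendsto_reflect L2_measurable \<phi> L2)
  qed (use \<phi> L2 L2_reflect in auto)
qed

lemma inverse_Fourier_exists:
  assumes "g \<in> L2 lborel" shows "\<exists>\<psi>. is_fourier_L2 \<psi> g"
proof -
  obtain h where "is_fourier_L2 g h" using is_fourier_L2_exists[OF assms] by blast
  from is_fourier_L2_reflect[OF Fourier_inversion_L2[OF this]]
  show ?thesis by auto
qed

section \<open>Hardy functions on vertical strips\<close>

lemma L2_tendsto_AE_subseq:
  assumes u: "\<And>n. u n \<in> L2 M" and g: "g \<in> L2 M" and lim: "L2_tendsto M u g sequentially"
  shows "\<exists>r::nat\<Rightarrow>nat. strict_mono r \<and> (AE x in M. (\<lambda>n. u (r n) x) \<longlonglongrightarrow> g x)"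
proof -
  have "(\<lambda>n. (L2norm M (\<lambda>x. u n x - g x))\<^sup>2) \<longlonglongrightarrow> 0\<^sup>2"
    using lim by (intro tendsto_power) (simp add: L2_tendsto_iff_L2norm u g)
  then have "(\<lambda>n. LINT x|M. norm ((cmod (u n x - g x))\<^sup>2)) \<longlonglongrightarrow> 0"
    by (simp add: L2norm_power2)
  from tendsto_L1_AE_subseq[OF L2_integrable[OF L2_diff[OF u g]] this]
  obtain r where r: "strict_mono r" and AE: "AE x in M. (\<lambda>n. (cmod (u (r n) x - g x))\<^sup>2) \<longlonglongrightarrow> 0"
    by auto
  from AE have "AE x in M. (\<lambda>n. u (r n) x) \<longlonglongrightarrow> g x"
  proof eventually_elim
    case (elim x)
    then have "(\<lambda>n. sqrt ((cmod (u (r n) x - g x))\<^sup>2)) \<longlonglongrightarrow> sqrt 0"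
      by (rule tendsto_real_sqrt)
    then have "(\<lambda>n. u (r n) x - g x) \<longlonglongrightarrow> 0"
      by (simp add: tendsto_norm_zero_iff)
    then show ?case by (simp add: Lim_null[symmetric])
  qed
  with r show ?thesis by blast
qed

lemma strip_eq_interval: "strip b = Re -` {0<..<b}"
  by (auto simp: strip_def)

lemma open_strip: "open (strip b)"
  unfolding strip_eq_interval by (intro open_vimage) (auto intro: continuous_intros)

lemma convex_strip: "convex (strip b)"
proof -
  have "strip b = {z. inner 1 z > 0} \<inter> {z. inner 1 z < b}"
    by (auto simp: strip_def inner_complex_def)
  then show ?thesis
    by (simp only: convex_Int convex_halfspace_gt convex_halfspace_lt)
qed

lemma Complex_has_vector_derivative:
  "((\<lambda>x. Complex x y) has_vector_derivative 1) F" "((\<lambda>y. Complex x y) has_vector_derivative \<i>) F'"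
proof -
  have eq: "(\<lambda>x. Complex x y) = (\<lambda>x. of_real x + \<i> * of_real y)" "(\<lambda>y. Complex x y) = (\<lambda>y. of_real x + \<i> * of_real y)"
    by (auto simp: complex_eq_iff)
  show "((\<lambda>x. Complex x y) has_vector_derivative 1) F" "((\<lambda>y. Complex x y) has_vector_derivative \<i>) F'"
    unfolding eq by (auto intro!: derivative_eq_intros)
qed

lemma continuous_on_Complex [continuous_intros]:
  assumes "continuous_on S u" "continuous_on S v"
  shows "continuous_on S (\<lambda>x. Complex (u x) (v x))"
proof -
  have "(\<lambda>x. Complex (u x) (v x)) = (\<lambda>x. of_real (u x) + \<i> * of_real (v x))"
    by (auto simp: complex_eq_iff)
  then show ?thesis using assms by (auto intro!: continuous_intros)
qed

lemma borel_measurable_Complex [measurable (raw)]: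
  assumes "u \<in> borel_measurable M" "v \<in> borel_measurable M"
  shows "(\<lambda>x. Complex (u x) (v x)) \<in> borel_measurable M"
proof -
  have "(\<lambda>x. Complex (u x) (v x)) = (\<lambda>x. of_real (u x) + \<i> * of_real (v x))"
    by (auto simp: complex_eq_iff)
  then show ?thesis using assms by simp
qed

text \<open>The function \<open>f(z) e\<^bsup>-z\<xi>\<^esup>\<close> has a primitive on the convex strip, so its integral over the boundary of a rectangle
vanishes. The left-hand side compares the two vertical sides, the right-hand side bounds the horizontal ones.\<close>

lemma rectangle_estimate:
  assumes f: "f holomorphic_on strip b" and x: "0 < x1" "x1 \<le> x2" "x2 < b" and R: "0 \<le> R"
  shows "cmod (exp (- complex_of_real (x2 * \<xi>)) * fourier_L1 (\<lambda>y. indicator {-R..R} y *\<^sub>R f (Complex x2 y)) \<xi> -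
      exp (- complex_of_real (x1 * \<xi>)) * fourier_L1 (\<lambda>y. indicator {-R..R} y *\<^sub>R f (Complex x1 y)) \<xi>)
    \<le> exp (x2 * \<bar>\<xi>\<bar>) / sqrt (2 * pi) * ((LINT x|lborel. cmod (indicator {x1..x2} x *\<^sub>R f (Complex x R))) +
        (LINT x|lborel. cmod (indicator {x1..x2} x *\<^sub>R f (Complex x (- R)))))"
proof -
  define h where "h z = f z * exp (- (z * complex_of_real \<xi>))" for z
  have h: "h holomorphic_on strip b"
    unfolding h_def by (intro holomorphic_intros f)
  obtain H where H: "\<And>z. z \<in> strip b \<Longrightarrow> (H has_field_derivative h z) (at z within strip b)"
    using holomorphic_convex_primitive'[OF convex_strip open_strip h] by blast
  have H': "(H has_field_derivative h z) (at z)" if "z \<in> strip b" for z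
    using H[OF that] by (simp add: at_within_open[OF that open_strip])
  have cont: "continuous_on (strip b) h"
    using h by (rule holomorphic_on_imp_continuous_on)
  have hor: "(LINT x|lborel. indicator {x1..x2} x *\<^sub>R h (Complex x y)) = H (Complex x2 y) - H (Complex x1 y)" for y
  proof (rule integral_FTC_Icc[OF x(2)])
    show "((\<lambda>x. H (Complex x y)) has_vector_derivative h (Complex t y)) (at t within {x1..x2})" if "x1 \<le> t" "t \<le> x2" for t
    proof -
      have "Complex t y \<in> strip b" using that x by (simp add: strip_def)
      from field_vector_diff_chain_at[OF Complex_has_vector_derivative(1) H'[OF this]]
      have "((\<lambda>x. H (Complex x y)) has_vector_derivative h (Complex t y)) (at t)"
        by (simp add: o_def)
      then show ?thesis by (rule has_vector_derivative_at_within)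
    qed
    show "continuous_on {x1..x2} (\<lambda>x. h (Complex x y))"
      using x by (intro continuous_on_compose2[OF cont] continuous_intros) (auto simp: strip_def)
  qed
  have ver: "\<i> * (exp (- complex_of_real (x * \<xi>)) * fourier_L1 (\<lambda>y. indicator {-R..R} y *\<^sub>R f (Complex x y)) \<xi>) =
      complex_of_real (1 / sqrt (2 * pi)) * (H (Complex x R) - H (Complex x (- R)))" if "0 < x" "x < b" for x
  proof -
    have "(LINT y|lborel. indicator {-R..R} y *\<^sub>R (\<i> * h (Complex x y))) = H (Complex x R) - H (Complex x (- R))"
    proof (rule integral_FTC_Icc)
      show "((\<lambda>y. H (Complex x y)) has_vector_derivative (\<i> * h (Complex x t))) (at t within {-R..R})" for t
      proof -
        have "Complex x t \<in> strip b" using that by (simp add: strip_def)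
        from field_vector_diff_chain_at[OF Complex_has_vector_derivative(2) H'[OF this]]
        have "((\<lambda>y. H (Complex x y)) has_vector_derivative (\<i> * h (Complex x t))) (at t)"
          by (simp add: o_def)
        then show ?thesis by (rule has_vector_derivative_at_within)
      qed
      show "continuous_on {-R..R} (\<lambda>y. \<i> * h (Complex x y))"
        using that by (intro continuous_intros continuous_on_compose2[OF cont]) (auto simp: strip_def)
    qed (use R in simp)
    moreover have "indicator {-R..R} y *\<^sub>R (\<i> * h (Complex x y)) =
        (\<i> * exp (- complex_of_real (x * \<xi>))) * (indicator {-R..R} y *\<^sub>R f (Complex x y) * exp (- (\<i> * complex_of_real y * complex_of_real \<xi>)))" for y
    proof -
      have "- (Complex x y * complex_of_real \<xi>) = - complex_of_real (x * \<xi>) + - (\<i> * complex_of_real y * complex_of_real \<xi>)"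
        by (simp add: complex_eq_iff)
      then show ?thesis by (simp only: h_def exp_add) (simp add: scaleR_conv_of_real mult_ac)
    qed
    ultimately have "H (Complex x R) - H (Complex x (- R)) = (\<i> * exp (- complex_of_real (x * \<xi>))) *
       (LINT y|lborel. indicator {-R..R} y *\<^sub>R f (Complex x y) * exp (- (\<i> * complex_of_real y * complex_of_real \<xi>)))"
      by (simp only: integral_mult_right_zero)
    then show ?thesis by (simp only: fourier_L1_def mult_ac)
  qed
  have hor_bound: "cmod (LINT x|lborel. indicator {x1..x2} x *\<^sub>R h (Complex x y)) \<le>
      exp (x2 * \<bar>\<xi>\<bar>) * (LINT x|lborel. cmod (indicator {x1..x2} x *\<^sub>R f (Complex x y)))" for y
  proof -
    have "cmod (LINT x|lborel. indicator {x1..x2} x *\<^sub>R h (Complex x y)) \<le>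
        (LINT x|lborel. cmod (indicator {x1..x2} x *\<^sub>R h (Complex x y)))"
      by (rule integral_norm_bound)
    also have "\<dots> \<le> (LINT x|lborel. exp (x2 * \<bar>\<xi>\<bar>) * cmod (indicator {x1..x2} x *\<^sub>R f (Complex x y)))"
    proof (rule integral_mono')
      have "continuous_on {x1..x2} (\<lambda>x. f (Complex x y))"
        using x by (intro continuous_on_compose2[OF holomorphic_on_imp_continuous_on[OF f]] continuous_intros) (auto simp: strip_def)
      then have "integrable lborel (\<lambda>x. indicator {x1..x2} x *\<^sub>R f (Complex x y))"
        by (intro borel_integrable_compact) auto
      then show "integrable lborel (\<lambda>x. exp (x2 * \<bar>\<xi>\<bar>) * cmod (indicator {x1..x2} x *\<^sub>R f (Complex x y)))"
        by (intro integrable_mult_right integrable_norm)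
      show "cmod (indicator {x1..x2} t *\<^sub>R h (Complex t y)) \<le> exp (x2 * \<bar>\<xi>\<bar>) * cmod (indicator {x1..x2} t *\<^sub>R f (Complex t y))" for t
      proof (cases "t \<in> {x1..x2}")
        case True
        have "- (t * \<xi>) \<le> t * \<bar>\<xi>\<bar>"
          using True x abs_ge_minus_self[of "t * \<xi>"] by (simp add: abs_mult)
        also have "\<dots> \<le> x2 * \<bar>\<xi>\<bar>" using True by (intro mult_right_mono) auto
        finally have "exp (- (t * \<xi>)) \<le> exp (x2 * \<bar>\<xi>\<bar>)" by simp
        from mult_left_mono[OF this norm_ge_zero[of "f (Complex t y)"]] show ?thesis
          using True by (simp add: h_def norm_mult mult.commute)
      qed simp
    qed simp
    finally show ?thesis by simp
  qed
  let ?A = "exp (- complex_of_real (x2 * \<xi>)) * fourier_L1 (\<lambda>y. indicator {-R..R} y *\<^sub>R f (Complex x2 y)) \<xi>"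
  let ?B = "exp (- complex_of_real (x1 * \<xi>)) * fourier_L1 (\<lambda>y. indicator {-R..R} y *\<^sub>R f (Complex x1 y)) \<xi>"
  let ?h = "\<lambda>y. LINT x|lborel. indicator {x1..x2} x *\<^sub>R h (Complex x y)"
  have "\<i> * (?A - ?B) = complex_of_real (1 / sqrt (2 * pi)) * (?h R - ?h (- R))"
    using ver[of x1] ver[of x2] x by (simp only: hor right_diff_distrib) (simp add: algebra_simps)
  then have "cmod (\<i> * (?A - ?B)) = cmod (complex_of_real (1 / sqrt (2 * pi)) * (?h R - ?h (- R)))"
    by (rule arg_cong)
  then have "cmod (?A - ?B) = 1 / sqrt (2 * pi) * cmod (?h R - ?h (- R))"
    by (simp add: norm_mult norm_divide)
  also have "\<dots> \<le> 1 / sqrt (2 * pi) * (cmod (?h R) + cmod (?h (- R)))"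
    by (intro mult_left_mono norm_triangle_ineq4) simp
  also have "\<dots> \<le> 1 / sqrt (2 * pi) * (exp (x2 * \<bar>\<xi>\<bar>) * (LINT x|lborel. cmod (indicator {x1..x2} x *\<^sub>R f (Complex x R))) +
      exp (x2 * \<bar>\<xi>\<bar>) * (LINT x|lborel. cmod (indicator {x1..x2} x *\<^sub>R f (Complex x (- R)))))"
    by (intro mult_left_mono add_mono hor_bound) simp
  finally show ?thesis by (simp add: field_simps)
qed

lemma Complex_line_L2:
  assumes f: "f \<in> H2_strip b" and x: "0 < x" "x < b"
  shows "(\<lambda>y. f (Complex x y)) \<in> L2 lborel"
proof -
  have hol: "f holomorphic_on strip b" and
    fin: "(SUP x\<in>{0<..<b}. \<integral>\<^sup>+ y. ennreal ((cmod (f (Complex x y)))\<^sup>2) \<partial>lborel) < \<infinity>"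
    using f by (auto simp: H2_strip_def)
  have "continuous_on UNIV (\<lambda>y. f (Complex x y))"
    using x by (intro continuous_on_compose2[OF holomorphic_on_imp_continuous_on[OF hol]] continuous_intros) (auto simp: strip_def)
  then have "(\<lambda>y. f (Complex x y)) \<in> borel_measurable lborel"
    by (simp add: borel_measurable_continuous_onI)
  moreover have "(\<integral>\<^sup>+ y. ennreal ((cmod (f (Complex x y)))\<^sup>2) \<partial>lborel) < \<infinity>"
    by (rule le_less_trans[OF SUP_upper fin]) (use x in auto)
  ultimately show ?thesis by (simp add: L2_iff_nn_integral)
qed

text \<open>An integrable function cannot stay above a positive constant on a half-line.\<close>

lemma small_heights:
  fixes J :: "real \<Rightarrow> ennreal"
  assumes [measurable]: "J \<in> borel_measurable borel" and fin: "(\<integral>\<^sup>+R. J R \<partial>lborel) < \<infinity>"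
  obtains R :: "nat \<Rightarrow> real" where "\<And>n. real n \<le> R n" "\<And>n. J (R n) \<le> ennreal (1 / real (Suc n))"
proof -
  have "\<exists>R\<ge>real n. J R \<le> ennreal (1 / real (Suc n))" for n
  proof (rule ccontr)
    assume neg: "\<not> (\<exists>R\<ge>real n. J R \<le> ennreal (1 / real (Suc n)))"
    have "emeasure lborel {real n..} = \<infinity>"
    proof -
      have "ennreal (real k) \<le> emeasure lborel {real n..}" for k :: nat
      proof -
        have "ennreal (real k) = emeasure lborel {real n..real n + real k}" by simp
        also have "\<dots> \<le> emeasure lborel {real n..}" by (intro emeasure_mono) auto
        finally show ?thesis .
      qed
      then show ?thesis
        using ennreal_Ex_less_of_nat[of "emeasure lborel {real n..}"]
        by (auto simp: ennreal_of_nat_eq_real_of_nat not_less[symmetric] top.not_eq_extremum[symmetric])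
    qed
    then have "(\<infinity>::ennreal) = ennreal (1 / real (Suc n)) * emeasure lborel {real n..}"
      by (simp add: ennreal_mult_eq_top_iff ennreal_mult_top)
    also have "\<dots> = (\<integral>\<^sup>+R. ennreal (1 / real (Suc n)) * indicator {real n..} R \<partial>lborel)"
      by (simp add: nn_integral_cmult)
    also have "\<dots> \<le> (\<integral>\<^sup>+R. J R \<partial>lborel)"
    proof (rule nn_integral_mono)
      show "ennreal (1 / real (Suc n)) * indicator {real n..} R \<le> J R" for R
      proof (cases "real n \<le> R")
        case True
        then have "\<not> J R \<le> ennreal (1 / real (Suc n))" using neg by blast
        then show ?thesis using True by (simp add: not_le less_imp_le)
      qed simp
    qed
    finally show False using fin by simp
  qed
  then have "\<forall>n. \<exists>R. real n \<le> R \<and> J R \<le> ennreal (1 / real (Suc n))" by blast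
  from choice[OF this] obtain R where "\<forall>n. real n \<le> R n \<and> J (R n) \<le> ennreal (1 / real (Suc n))" ..
  then show ?thesis by (intro that[of R]) auto
qed

text \<open>Let the height of the rectangle grow. By Tonelli's theorem \<open>\<bar>f\<bar>\<^sup>2\<close> is integrable over \<open>[x1, x2] \<times> \<real>\<close>, so
there are heights \<open>R n\<close> tending to infinity along which \<open>\<integral> \<bar>f(x \<plusminus> i R n)\<bar>\<^sup>2 dx\<close> tends to \<open>0\<close>, and with it the
contribution of the horizontal sides. The transforms of the truncated lines converge to \<open>g1\<close> and \<open>g2\<close>
in \<open>L\<^sup>2\<close>, hence almost everywhere along a subsequence.\<close>

lemma H2_strip_fourier_relation:
  assumes f: "f \<in> H2_strip b" and x: "0 < x1" "x1 \<le> x2" "x2 < b"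
    and g1: "is_fourier_L2 (\<lambda>y. f (Complex x1 y)) g1" and g2: "is_fourier_L2 (\<lambda>y. f (Complex x2 y)) g2"
  shows "AE \<xi> in lborel. exp (- complex_of_real (x1 * \<xi>)) * g1 \<xi> = exp (- complex_of_real (x2 * \<xi>)) * g2 \<xi>"
proof -
  have hol: "f holomorphic_on strip b" and
    fin: "(SUP x\<in>{0<..<b}. \<integral>\<^sup>+ y. ennreal ((cmod (f (Complex x y)))\<^sup>2) \<partial>lborel) < \<infinity>"
    using f by (auto simp: H2_strip_def)
  (* f is only known to be holomorphic on the strip; cutting it off there gives a function that is Borel
     measurable on the whole plane, as Tonelli's theorem requires. *)
  define f' where "f' z = indicator (strip b) z *\<^sub>R f z" for z
  have [measurable]: "f' \<in> borel_measurable borel"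
    unfolding f'_def
    by (intro borel_measurable_continuous_on_indicator holomorphic_on_imp_continuous_on[OF hol])
      (simp add: open_strip)
  let ?u = "\<lambda>R x. indicator {x1..x2} x *\<^sub>R f (Complex x R)"
  define I where "I R = (\<integral>\<^sup>+x. ennreal ((cmod (?u R x))\<^sup>2) \<partial>lborel)" for R
  have I_eq: "I R = (\<integral>\<^sup>+x. ennreal ((cmod (indicator {x1..x2} x *\<^sub>R f' (Complex x R)))\<^sup>2) \<partial>lborel)" for R
    unfolding I_def by (intro nn_integral_cong) (use x in \<open>auto simp: f'_def strip_def indicator_def\<close>)
  have I_meas [measurable]: "I \<in> borel_measurable borel"
    unfolding I_eq[abs_def] by measurable
  have u_L2: "?u R \<in> L2 lborel" for R
  proof -
    have "continuous_on {x1..x2} (\<lambda>x. f (Complex x R))"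
      using x by (intro continuous_on_compose2[OF holomorphic_on_imp_continuous_on[OF hol]] continuous_intros) (auto simp: strip_def)
    then have c: "continuous_on {x1..x2} (\<lambda>x. (cmod (f (Complex x R)))\<^sup>2)" "(\<lambda>x. ?u R x) \<in> borel_measurable borel"
      by (auto intro!: continuous_intros borel_measurable_continuous_on_indicator)
    have "integrable lborel (\<lambda>x. indicator {x1..x2} x *\<^sub>R (cmod (f (Complex x R)))\<^sup>2)"
      by (intro borel_integrable_compact c) auto
    then have "integrable lborel (\<lambda>x. (cmod (?u R x))\<^sup>2)"
      by (rule Bochner_Integration.integrable_cong[THEN iffD1, rotated 2]) (auto simp: indicator_def)
    then show ?thesis using c(2) by (simp add: L2_def)
  qed
  have I_L2: "I R = ennreal ((L2norm lborel (?u R))\<^sup>2)" for R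
    unfolding I_def by (rule nn_integral_L2[OF u_L2])
  have I_fin: "(\<integral>\<^sup>+R. I R \<partial>lborel) < \<infinity>"
  proof -
    let ?S = "SUP x\<in>{0<..<b}. \<integral>\<^sup>+ y. ennreal ((cmod (f (Complex x y)))\<^sup>2) \<partial>lborel"
    have "(\<integral>\<^sup>+R. I R \<partial>lborel) =
        (\<integral>\<^sup>+x. (\<integral>\<^sup>+R. ennreal ((cmod (indicator {x1..x2} x *\<^sub>R f' (Complex x R)))\<^sup>2) \<partial>lborel) \<partial>lborel)"
      unfolding I_eq by (rule lborel_pair.Fubini') measurable
    also have "\<dots> \<le> (\<integral>\<^sup>+x. ?S * indicator {x1..x2} x \<partial>lborel)"
    proof (rule nn_integral_mono)
      fix t
      show "(\<integral>\<^sup>+R. ennreal ((cmod (indicator {x1..x2} t *\<^sub>R f' (Complex t R)))\<^sup>2) \<partial>lborel) \<le> ?S * indicator {x1..x2} t"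
      proof (cases "t \<in> {x1..x2}")
        case True
        then have "t \<in> {0<..<b}" using x by auto
        then have "(\<integral>\<^sup>+ y. ennreal ((cmod (f (Complex t y)))\<^sup>2) \<partial>lborel) \<le> ?S"
          by (rule SUP_upper)
        with True \<open>t \<in> {0<..<b}\<close> show ?thesis by (simp add: f'_def strip_def)
      qed simp
    qed
    also have "\<dots> = ?S * ennreal (x2 - x1)"
      using x by (simp add: nn_integral_cmult_indicator)
    also have "\<dots> < \<infinity>" using fin by (simp add: ennreal_mult_less_top)
    finally show ?thesis .
  qed
  have "(\<integral>\<^sup>+R. I R + I (- R) \<partial>lborel) < \<infinity>"
    using I_fin by (simp add: nn_integral_add nn_integral_lborel_uminus)
  then obtain R where R: "\<And>n::nat. real n \<le> R n" "\<And>n. I (R n) + I (- R n) \<le> ennreal (1 / real (Suc n))"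
    using small_heights[of "\<lambda>R. I R + I (- R)"] by auto
  have R_top: "filterlim R at_top sequentially"
    by (rule filterlim_at_top_mono[OF filterlim_real_sequentially]) (simp add: R)
  have R_nonneg: "0 \<le> R n" for n using R(1)[of n] by linarith
  let ?e = "\<lambda>n::nat. sqrt (1 / real (Suc n))"
  have e_lim: "?e \<longlonglongrightarrow> 0"
    using tendsto_real_sqrt[OF LIMSEQ_Suc[OF lim_1_over_n[where 'a = real]]] by simp
  have uR: "L2norm lborel (?u (R n)) \<le> ?e n" "L2norm lborel (?u (- R n)) \<le> ?e n" for n
  proof -
    have "I (R n) \<le> ennreal (1 / real (Suc n))" "I (- R n) \<le> ennreal (1 / real (Suc n))"
      using R(2)[of n] by (auto intro: order_trans[rotated])
    then show "L2norm lborel (?u (R n)) \<le> ?e n" "L2norm lborel (?u (- R n)) \<le> ?e n"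
      unfolding I_L2 by (auto intro: real_le_rsqrt)
  qed
  define ind where "ind x = complex_of_real (indicator {x1..x2} x)" for x :: real
  have ind: "ind \<in> L2 lborel"
    unfolding ind_def by (rule indicator_L2) (auto simp: emeasure_lborel_Icc_eq)
  define K where "K = L2norm lborel ind"
  have u_L1: "(LINT x|lborel. cmod (?u R x)) \<le> L2norm lborel (?u R) * K" for R :: real
  proof -
    have "(LINT x|lborel. cmod (?u R x)) = (LINT x|lborel. cmod (?u R x) * cmod (ind x))"
      by (intro Bochner_Integration.integral_cong) (auto simp: ind_def indicator_def)
    also have "\<dots> \<le> L2norm lborel (?u R) * K"
      unfolding K_def by (rule L2_Cauchy_Schwarz[OF u_L2 ind])
    finally show ?thesis .
  qed
  define c where "c x n y = indicator {- R n..R n} y *\<^sub>R f (Complex x y)" for x n y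
  define D where "D n \<xi> = exp (- complex_of_real (x2 * \<xi>)) * fourier_L1 (c x2 n) \<xi> -
      exp (- complex_of_real (x1 * \<xi>)) * fourier_L1 (c x1 n) \<xi>" for n \<xi>
  have D_lim: "(\<lambda>n. D n \<xi>) \<longlonglongrightarrow> 0" for \<xi>
  proof (rule Lim_null_comparison)
    let ?C = "exp (x2 * \<bar>\<xi>\<bar>) / sqrt (2 * pi)"
    have "cmod (D n \<xi>) \<le> ?C * (?e n * K + ?e n * K)" for n
    proof -
      have "cmod (D n \<xi>) \<le> ?C * ((LINT x|lborel. cmod (?u (R n) x)) + (LINT x|lborel. cmod (?u (- R n) x)))"
        unfolding D_def c_def by (rule rectangle_estimate[OF hol x R_nonneg])
      also have "\<dots> \<le> ?C * (?e n * K + ?e n * K)"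
      proof (intro mult_left_mono add_mono)
        have K: "0 \<le> K" by (simp add: K_def)
        show "(LINT x|lborel. cmod (?u (R n) x)) \<le> ?e n * K"
          by (rule order_trans[OF u_L1 mult_right_mono[OF uR(1) K]])
        show "(LINT x|lborel. cmod (?u (- R n) x)) \<le> ?e n * K"
          by (rule order_trans[OF u_L1 mult_right_mono[OF uR(2) K]])
      qed simp
      finally show ?thesis .
    qed
    then show "\<forall>\<^sub>F n in sequentially. cmod (D n \<xi>) \<le> ?C * (?e n * K + ?e n * K)" by simp
    have "(\<lambda>n. ?C * (?e n * K + ?e n * K)) \<longlonglongrightarrow> ?C * (0 * K + 0 * K)"
      by (intro tendsto_intros e_lim)
    then show "(\<lambda>n. ?C * (?e n * K + ?e n * K)) \<longlonglongrightarrow> 0" by simp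
  qed
  have Fc: "fourier_L1 (c t n) \<in> L2 lborel" "L2_tendsto lborel (\<lambda>n. fourier_L1 (c t n)) g sequentially"
    if t: "0 < t" "t < b" and g: "is_fourier_L2 (\<lambda>y. f (Complex t y)) g" for t g n
  proof -
    have L2: "(\<lambda>y. f (Complex t y)) \<in> L2 lborel" by (rule Complex_line_L2[OF f t])
    have c: "integrable lborel (c t n)" "c t n \<in> L2 lborel" for n
      unfolding c_def by (rule integrable_L2_interval[OF L2] L2_interval[OF L2])+
    have F: "fourier_L1 (c t n) \<in> L2 lborel" for n
      by (rule fourier_L1_contraction(1)[OF c])
    show "fourier_L1 (c t n) \<in> L2 lborel" by (rule F)
    have "L2_tendsto lborel (c t) (\<lambda>y. f (Complex t y)) sequentially"
      unfolding c_def by (rule L2_tendsto_interval[OF L2 R_top])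
    then have "(\<lambda>n. L2norm lborel (\<lambda>y. c t n y - f (Complex t y))) \<longlonglongrightarrow> 0"
      by (simp add: L2_tendsto_iff_L2norm c L2)
    moreover have "L2norm lborel (\<lambda>y. c t n y - f (Complex t y)) = L2norm lborel (\<lambda>\<xi>. fourier_L1 (c t n) \<xi> - g \<xi>)" for n
      by (rule Plancherel_L2[OF is_fourier_L2_diff[OF is_fourier_L2_L1[OF c] g], symmetric])
    ultimately show "L2_tendsto lborel (\<lambda>n. fourier_L1 (c t n)) g sequentially"
      using F is_fourier_L2D(2)[OF g] by (simp add: L2_tendsto_iff_L2norm)
  qed
  have x1b: "x1 < b" and x20: "0 < x2" using x by auto
  obtain r where r: "strict_mono r" and lim1: "AE \<xi> in lborel. (\<lambda>n. fourier_L1 (c x1 (r n)) \<xi>) \<longlonglongrightarrow> g1 \<xi>"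
    using L2_tendsto_AE_subseq[OF Fc(1)[OF x(1) x1b g1] is_fourier_L2D(2)[OF g1] Fc(2)[OF x(1) x1b g1]] by blast
  have lim2': "L2_tendsto lborel (\<lambda>n. fourier_L1 (c x2 (r n))) g2 sequentially"
    using filterlim_compose[OF Fc(2)[OF x20 x(3) g2, unfolded L2_tendsto_def] filterlim_subseq[OF r]]
    unfolding L2_tendsto_def .
  obtain s where s: "strict_mono s" and lim2: "AE \<xi> in lborel. (\<lambda>n. fourier_L1 (c x2 (r (s n))) \<xi>) \<longlonglongrightarrow> g2 \<xi>"
    using L2_tendsto_AE_subseq[OF Fc(1)[OF x20 x(3) g2] is_fourier_L2D(2)[OF g2] lim2'] by blast
  show ?thesis
    using lim1 lim2
  proof eventually_elim
    case (elim \<xi>)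
    have "(\<lambda>n. fourier_L1 (c x1 (r (s n))) \<xi>) \<longlonglongrightarrow> g1 \<xi>"
      using LIMSEQ_subseq_LIMSEQ[OF elim(1) s] by (simp add: o_def)
    then have "(\<lambda>n. D (r (s n)) \<xi>) \<longlonglongrightarrow> exp (- complex_of_real (x2 * \<xi>)) * g2 \<xi> - exp (- complex_of_real (x1 * \<xi>)) * g1 \<xi>"
      unfolding D_def using elim(2) by (intro tendsto_intros)
    moreover have "(\<lambda>n. D (r (s n)) \<xi>) \<longlonglongrightarrow> 0"
      using LIMSEQ_subseq_LIMSEQ[OF LIMSEQ_subseq_LIMSEQ[OF D_lim[of \<xi>] r] s] by (simp add: o_def)
    ultimately have "exp (- complex_of_real (x2 * \<xi>)) * g2 \<xi> - exp (- complex_of_real (x1 * \<xi>)) * g1 \<xi> = 0"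
      by (rule LIMSEQ_unique)
    then show ?case by simp
  qed
qed

text \<open>The common value of \<open>e\<^bsup>-x\<xi>\<^esup> \<F>(f(x + i\<cdot>))(\<xi>)\<close> on all lines, read off at \<open>x = 1\<close>, is \<open>g\<close>. It is square-integrable by
Fatou's lemma for \<open>x\<close> tending to \<open>0\<close>, because the \<open>L\<^sup>2\<close> norms of \<open>f\<close> on the lines \<open>Re z = x < 1\<close> are bounded.\<close>

theorem H2_strip_fourier_representation:
  assumes f: "\<And>b. 0 < b \<Longrightarrow> f \<in> H2_strip b"
  obtains g where "g \<in> L2 lborel"
    "\<And>x. 0 < x \<Longrightarrow> is_fourier_L2 (\<lambda>y. f (Complex x y)) (\<lambda>\<xi>. exp (complex_of_real (x * \<xi>)) * g \<xi>)"
proof -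
  let ?f = "\<lambda>x y. f (Complex x y)"
  have L2: "?f x \<in> L2 lborel" if "0 < x" for x
    using that by (intro Complex_line_L2[OF f, of "x + 1"]) auto
  define G where "G x = fourier_L2 (?f x)" for x
  have G: "is_fourier_L2 (?f x) (G x)" if "0 < x" for x
    unfolding G_def by (rule is_fourier_L2_fourier_L2[OF L2[OF that]])
  have [measurable]: "G 1 \<in> borel_measurable borel"
    using L2_measurable[OF is_fourier_L2D(2)[OF G[of 1]]] by simp
  define g where "g \<xi> = exp (- complex_of_real \<xi>) * G 1 \<xi>" for \<xi>
  have [measurable]: "g \<in> borel_measurable borel" unfolding g_def by measurable
  have rel: "is_fourier_L2 (?f x) (\<lambda>\<xi>. exp (complex_of_real (x * \<xi>)) * g \<xi>)" if x: "0 < x" for x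
  proof (rule is_fourier_L2_cong_AE[OF G[OF x]])
    have "AE \<xi> in lborel. exp (- complex_of_real (x * \<xi>)) * G x \<xi> = g \<xi>"
    proof (cases "x \<le> 1")
      case True
      show ?thesis
        using H2_strip_fourier_relation[OF f[of 2] x True _ G[OF x] G[of 1]] by (simp add: g_def)
    next
      case False
      then show ?thesis
        using H2_strip_fourier_relation[OF f[of "x + 1"] _ _ _ G[of 1] G[OF x]] x by (simp add: g_def eq_commute)
    qed
    then show "AE \<xi> in lborel. G x \<xi> = exp (complex_of_real (x * \<xi>)) * g \<xi>"
    proof eventually_elim
      case (elim \<xi>)
      show ?case
        unfolding elim[symmetric] mult.assoc[symmetric] exp_add[symmetric] by simp
    qed
    show "?f x \<in> borel_measurable lborel" by (rule L2_measurable[OF L2[OF x]])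
  qed measurable
  have "g \<in> L2 lborel"
  proof -
    let ?S = "SUP x\<in>{0<..<1}. \<integral>\<^sup>+ y. ennreal ((cmod (?f x y))\<^sup>2) \<partial>lborel"
    define t where "t n = 1 / real (Suc (Suc n))" for n
    have t: "0 < t n" "t n < 1" for n by (auto simp: t_def)
    have t_lim: "t \<longlonglongrightarrow> 0"
      unfolding t_def by (intro LIMSEQ_Suc[OF LIMSEQ_Suc[OF lim_1_over_n]])
    have "(\<integral>\<^sup>+\<xi>. ennreal ((cmod (g \<xi>))\<^sup>2) \<partial>lborel) =
        (\<integral>\<^sup>+\<xi>. liminf (\<lambda>n. ennreal ((cmod (exp (complex_of_real (t n * \<xi>)) * g \<xi>))\<^sup>2)) \<partial>lborel)"
    proof (rule nn_integral_cong)
      fix \<xi>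
      have "(\<lambda>n. ennreal ((cmod (exp (complex_of_real (t n * \<xi>)) * g \<xi>))\<^sup>2)) \<longlonglongrightarrow> ennreal ((cmod (exp (complex_of_real (0 * \<xi>)) * g \<xi>))\<^sup>2)"
        by (intro tendsto_intros t_lim)
      from lim_imp_Liminf[OF _ this]
      show "ennreal ((cmod (g \<xi>))\<^sup>2) = liminf (\<lambda>n. ennreal ((cmod (exp (complex_of_real (t n * \<xi>)) * g \<xi>))\<^sup>2))"
        by simp
    qed
    also have "\<dots> \<le> liminf (\<lambda>n. \<integral>\<^sup>+\<xi>. ennreal ((cmod (exp (complex_of_real (t n * \<xi>)) * g \<xi>))\<^sup>2) \<partial>lborel)"
      by (rule nn_integral_liminf) measurable
    also have "\<dots> \<le> limsup (\<lambda>n. \<integral>\<^sup>+\<xi>. ennreal ((cmod (exp (complex_of_real (t n * \<xi>)) * g \<xi>))\<^sup>2) \<partial>lborel)"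
      by (intro Liminf_le_Limsup) simp
    also have "\<dots> \<le> ?S"
    proof (intro Limsup_bounded always_eventually allI)
      fix n
      have "(\<integral>\<^sup>+\<xi>. ennreal ((cmod (exp (complex_of_real (t n * \<xi>)) * g \<xi>))\<^sup>2) \<partial>lborel) = (\<integral>\<^sup>+y. ennreal ((cmod (?f (t n) y))\<^sup>2) \<partial>lborel)"
        using Plancherel_L2[OF rel[OF t(1)]] is_fourier_L2D[OF rel[OF t(1)]] by (simp add: nn_integral_L2)
      also have "\<dots> \<le> ?S" using t[of n] by (intro SUP_upper) auto
      finally show "(\<integral>\<^sup>+\<xi>. ennreal ((cmod (exp (complex_of_real (t n * \<xi>)) * g \<xi>))\<^sup>2) \<partial>lborel) \<le> ?S" .
    qed
    also have "?S < \<infinity>" using f[of 1] by (simp add: H2_strip_def)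
    finally show ?thesis by (simp add: L2_iff_nn_integral)
  qed
  from that[OF this rel] show ?thesis .
qed

text \<open>The boundary value has to be the inverse transform \<open>f0\<close> of \<open>g\<close>, since \<open>\<parallel>f(x + i\<cdot>) - f0\<parallel>\<close> equals the norm of
\<open>(e\<^bsup>x\<xi>\<^esup> - 1) g(\<xi>)\<close>, which tends to \<open>0\<close> by dominated convergence.\<close>

lemma boundary_value_fourier:
  assumes g: "g \<in> L2 lborel"
    and rel: "\<And>x. 0 < x \<Longrightarrow> is_fourier_L2 (\<lambda>y. f (Complex x y)) (\<lambda>\<xi>. exp (complex_of_real (x * \<xi>)) * g \<xi>)"
  shows "is_fourier_L2 (boundary_value f) g"
proof -
  let ?f = "\<lambda>x y. f (Complex x y)" and ?g = "\<lambda>x \<xi>. exp (complex_of_real (x * \<xi>)) * g \<xi>"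
  have [measurable]: "g \<in> borel_measurable borel" using L2_measurable[OF g] by simp
  obtain f0 where f0: "is_fourier_L2 f0 g" using inverse_Fourier_exists[OF g] by blast
  have ev: "\<forall>\<^sub>F x in at_right 0. ?f x \<in> L2 lborel"
    using is_fourier_L2D(1)[OF rel] by (auto simp: eventually_at_filter)
  have g_lim: "((\<lambda>x. L2norm lborel (\<lambda>\<xi>. ?g x \<xi> - g \<xi>)) \<longlongrightarrow> 0) (at_right 0)"
    unfolding tendsto_at_iff_sequentially o_def
  proof (intro allI impI)
    fix X :: "nat \<Rightarrow> real" assume X: "\<forall>i. X i \<in> {0<..} - {0}" and X0: "X \<longlonglongrightarrow> 0"
    have X_pos: "0 < X n" for n using X by auto
    obtain B where B: "\<And>n. X n \<le> B"
      using convergent_imp_bounded[OF X0] unfolding bounded_real by (auto intro: order_trans[OF abs_ge_self])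
    have B0: "0 < B" using less_le_trans[OF X_pos B[of 0]] .
    define w where "w \<xi> = complex_of_real (2 * cmod (g \<xi>)) + complex_of_real (cmod (?g B \<xi>))" for \<xi>
    have "w \<in> L2 lborel"
      unfolding w_def
    proof (rule L2_add)
      show "(\<lambda>\<xi>. complex_of_real (2 * cmod (g \<xi>))) \<in> L2 lborel"
        by (rule L2I_bound[OF g, where C = 2]) auto
      show "(\<lambda>\<xi>. complex_of_real (cmod (?g B \<xi>))) \<in> L2 lborel"
        by (rule L2I_bound[OF is_fourier_L2D(2)[OF rel[OF B0]], where C = 1]) auto
    qed
    have "L2_tendsto lborel (\<lambda>n. ?g (X n)) g sequentially"
    proof (rule L2_dominated_convergence[where w = "\<lambda>\<xi>. cmod (w \<xi>)"])
      show "integrable lborel (\<lambda>\<xi>. (cmod (w \<xi>))\<^sup>2)" by (rule L2_integrable) fact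
      show "AE \<xi> in lborel. cmod (?g (X n) \<xi> - g \<xi>) \<le> cmod (w \<xi>)" for n
      proof (rule AE_I2)
        fix \<xi>
        (* a bound that is independent of n for both signs of xi *)
        have "exp (X n * \<xi>) \<le> 1 + exp (B * \<xi>)"
        proof (cases "0 \<le> \<xi>")
          case True
          then have "exp (X n * \<xi>) \<le> exp (B * \<xi>)" using B[of n] by (simp add: mult_right_mono)
          then show ?thesis by linarith
        next
          case False
          then have "exp (X n * \<xi>) \<le> 1" using X_pos[of n] by (simp add: mult_nonneg_nonpos)
          then show ?thesis using exp_gt_zero[of "B * \<xi>"] by linarith
        qed
        then have "exp (X n * \<xi>) * cmod (g \<xi>) \<le> (1 + exp (B * \<xi>)) * cmod (g \<xi>)"
          by (rule mult_right_mono) simp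
        moreover have "cmod (?g (X n) \<xi> - g \<xi>) \<le> exp (X n * \<xi>) * cmod (g \<xi>) + cmod (g \<xi>)"
          using norm_triangle_ineq4[of "?g (X n) \<xi>" "g \<xi>"] by (simp add: norm_mult)
        moreover have "cmod (w \<xi>) = 2 * cmod (g \<xi>) + exp (B * \<xi>) * cmod (g \<xi>)"
          unfolding w_def of_real_add[symmetric] norm_of_real by (simp add: norm_mult)
        ultimately show "cmod (?g (X n) \<xi> - g \<xi>) \<le> cmod (w \<xi>)"
          by (simp add: algebra_simps)
      qed
      show "AE \<xi> in lborel. (\<lambda>n. ?g (X n) \<xi>) \<longlonglongrightarrow> g \<xi>"
      proof (rule AE_I2)
        fix \<xi>
        have "(\<lambda>n. ?g (X n) \<xi>) \<longlonglongrightarrow> ?g 0 \<xi>" by (intro tendsto_intros X0)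
        then show "(\<lambda>n. ?g (X n) \<xi>) \<longlonglongrightarrow> g \<xi>" by simp
      qed
    qed measurable
    then show "(\<lambda>n. L2norm lborel (\<lambda>\<xi>. ?g (X n) \<xi> - g \<xi>)) \<longlonglongrightarrow> 0"
      using is_fourier_L2D(2)[OF rel[OF X_pos]] g by (simp add: L2_tendsto_iff_L2norm)
  qed
  have "((\<lambda>x. L2norm lborel (\<lambda>y. ?f x y - f0 y)) \<longlongrightarrow> 0) (at_right 0)"
  proof (rule Lim_transform_eventually[OF g_lim])
    have "L2norm lborel (\<lambda>\<xi>. ?g x \<xi> - g \<xi>) = L2norm lborel (\<lambda>y. ?f x y - f0 y)" if "0 < x" for x
      by (rule Plancherel_L2[OF is_fourier_L2_diff[OF rel[OF that] f0]])
    then show "\<forall>\<^sub>F x in at_right 0. L2norm lborel (\<lambda>\<xi>. ?g x \<xi> - g \<xi>) = L2norm lborel (\<lambda>y. ?f x y - f0 y)"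
      by (auto simp: eventually_at_filter)
  qed
  then have "L2_tendsto lborel ?f f0 (at_right 0)"
    using ev is_fourier_L2D(1)[OF f0] by (simp add: L2_tendsto_iff_L2norm)
  then have f0': "is_boundary_value f f0"
    using is_fourier_L2D(1)[OF f0] by (simp add: is_boundary_value_def)
  then have bv: "is_boundary_value f (boundary_value f)"
    unfolding boundary_value_def by (rule someI[of "is_boundary_value f"])
  have "AE y in lborel. f0 y = boundary_value f y"
    using f0' bv ev unfolding is_boundary_value_def
    by (intro L2_tendsto_unique[where F = "at_right 0" and u = ?f]) auto
  then show ?thesis
    using is_fourier_L2_cong_AE[OF f0 _ L2_measurable[OF g]] bv
    by (auto simp: is_boundary_value_def dest: L2_measurable)
qed

section \<open>The norm as a sum over vertical lines\<close>

lemma Complex_measurable_omega: "Complex (real n / 2) \<in> measurable borel omega"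
proof -
  have "(\<lambda>y. Complex (real n / 2) y) \<in> measurable borel (restrict_space borel {z. 0 \<le> Re z})"
    by (intro measurable_restrict_space2 borel_measurable_continuous_onI continuous_intros) auto
  then show ?thesis
    by (simp cong: measurable_cong_sets add: sets_omega)
qed

text \<open>The measure is the image, under \<open>(n, y) \<mapsto> n/2 + iy\<close>, of a weighted counting measure times Lebesgue measure.\<close>

lemma nn_integral_omega:
  assumes h: "h \<in> borel_measurable omega"
  shows "(\<integral>\<^sup>+z. h z \<partial>omega) = (\<Sum>n. ennreal (2 ^ n / fact n) * (\<integral>\<^sup>+y. h (Complex (real n / 2) y) \<partial>lborel))"
proof -
  let ?P = "density (count_space UNIV) (\<lambda>n. ennreal (2 ^ n / fact n)) \<Otimes>\<^sub>M (lborel :: real measure)"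
  let ?T = "\<lambda>p. Complex (real (fst p) / 2) (snd p)"
  have T: "?T \<in> measurable ?P omega"
  proof -
    have "(\<lambda>p. Complex (real (fst p) / 2) (snd p)) \<in> measurable (count_space UNIV \<Otimes>\<^sub>M lborel) omega"
      by (rule measurable_pair_measure_countable1) (simp_all add: Complex_measurable_omega)
    then show ?thesis
      by (simp cong: measurable_cong_sets sets_pair_measure_cong)
  qed
  have "omega = distr ?P omega ?T"
  proof (rule measure_eqI)
    fix A assume A: "A \<in> sets omega"
    then have A': "A \<in> sets borel" "A \<subseteq> {z. 0 \<le> Re z}"
      by (auto simp: sets_omega sets_restrict_space_iff)
    have P: "?T -` A \<inter> space ?P \<in> sets ?P" using T A by (rule measurable_sets)
    have "emeasure (distr ?P omega ?T) A = emeasure ?P (?T -` A \<inter> space ?P)"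
      by (rule emeasure_distr[OF T A])
    also have "\<dots> = (\<integral>\<^sup>+n. emeasure lborel (Pair n -` (?T -` A \<inter> space ?P)) \<partial>density (count_space UNIV) (\<lambda>n. ennreal (2 ^ n / fact n)))"
      by (rule lborel.emeasure_pair_measure_alt[OF P])
    also have "\<dots> = (\<Sum>n. ennreal (2 ^ n / fact n) * emeasure lborel (Pair n -` (?T -` A \<inter> space ?P)))"
      by (simp add: nn_integral_density nn_integral_count_space_nat)
    also have "\<dots> = emeasure omega A"
      unfolding emeasure_omega[OF A'] by (simp add: space_pair_measure vimage_def)
    finally show "emeasure omega A = emeasure (distr ?P omega ?T) A" ..
  qed simp
  then have "(\<integral>\<^sup>+z. h z \<partial>omega) = (\<integral>\<^sup>+z. h z \<partial>distr ?P omega ?T)" by simp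
  also have "\<dots> = (\<integral>\<^sup>+p. h (?T p) \<partial>?P)"
    by (rule nn_integral_distr[OF T]) (use h in simp)
  also have "\<dots> = (\<integral>\<^sup>+n. \<integral>\<^sup>+y. h (?T (n, y)) \<partial>lborel \<partial>density (count_space UNIV) (\<lambda>n. ennreal (2 ^ n / fact n)))"
    by (rule lborel.nn_integral_fst[symmetric]) (rule measurable_compose[OF T h])
  also have "\<dots> = (\<Sum>n. ennreal (2 ^ n / fact n) * (\<integral>\<^sup>+y. h (Complex (real n / 2) y) \<partial>lborel))"
    by (simp add: nn_integral_density nn_integral_count_space_nat)
  finally show ?thesis .
qed

text \<open>The exponential series of \<open>2e\<^sup>\<xi>\<close>: the masses \<open>2\<^sup>n/n!\<close> on the lines \<open>Re z = n/2\<close> produce the weight of the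
transformed space.\<close>

lemma exp_exp_sum:
  "(\<Sum>n. ennreal (2 ^ n / fact n * (exp (real n / 2 * \<xi>))\<^sup>2)) = ennreal (exp (2 * exp \<xi>))"
proof -
  have eq: "2 ^ n / fact n * (exp (real n / 2 * \<xi>))\<^sup>2 = (2 * exp \<xi>) ^ n /\<^sub>R fact n" for n
  proof -
    have "(exp (real n / 2 * \<xi>))\<^sup>2 = exp (real n * \<xi>)"
      using exp_double[of "real n / 2 * \<xi>"] by simp
    also have "\<dots> = exp \<xi> ^ n" by (rule exp_of_nat_mult)
    finally show ?thesis
      by (simp only: power_mult_distrib real_scaleR_def divide_inverse mult_ac)
  qed
  have "(\<lambda>n. (2 * exp \<xi>) ^ n /\<^sub>R fact n) sums exp (2 * exp \<xi>)" by (rule exp_converges)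
  then show ?thesis
    unfolding eq by (intro suminf_ennreal_eq) auto
qed

lemma weighted_sum:
  assumes g: "g \<in> borel_measurable lborel"
  shows "(\<Sum>n. ennreal (2 ^ n / fact n) * (\<integral>\<^sup>+\<xi>. ennreal ((cmod (exp (complex_of_real (real n / 2 * \<xi>)) * g \<xi>))\<^sup>2) \<partial>lborel)) =
    (\<integral>\<^sup>+\<xi>. ennreal ((cmod (g \<xi>))\<^sup>2) \<partial>weighted_lborel)"
proof -
  have [measurable]: "g \<in> borel_measurable borel" using g by simp
  have "(\<Sum>n. ennreal (2 ^ n / fact n) * (\<integral>\<^sup>+\<xi>. ennreal ((cmod (exp (complex_of_real (real n / 2 * \<xi>)) * g \<xi>))\<^sup>2) \<partial>lborel)) =
      (\<Sum>n. \<integral>\<^sup>+\<xi>. ennreal (2 ^ n / fact n * (exp (real n / 2 * \<xi>))\<^sup>2) * ennreal ((cmod (g \<xi>))\<^sup>2) \<partial>lborel)"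
    by (subst nn_integral_cmult[symmetric])
      (auto simp: norm_mult power_mult_distrib ennreal_mult[symmetric] mult_ac)
  also have "\<dots> = (\<integral>\<^sup>+\<xi>. (\<Sum>n. ennreal (2 ^ n / fact n * (exp (real n / 2 * \<xi>))\<^sup>2) * ennreal ((cmod (g \<xi>))\<^sup>2)) \<partial>lborel)"
    by (rule nn_integral_suminf[symmetric]) measurable
  also have "\<dots> = (\<integral>\<^sup>+\<xi>. ennreal (exp (2 * exp \<xi>)) * ennreal ((cmod (g \<xi>))\<^sup>2) \<partial>lborel)"
    by (simp only: ennreal_suminf_multc exp_exp_sum)
  also have "\<dots> = (\<integral>\<^sup>+\<xi>. ennreal ((cmod (g \<xi>))\<^sup>2) \<partial>weighted_lborel)"
    unfolding weighted_lborel_def by (rule nn_integral_density[symmetric]) measurable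
  finally show ?thesis .
qed

context
  fixes f :: "complex \<Rightarrow> complex" and g :: "real \<Rightarrow> complex"
  assumes g: "g \<in> L2 lborel"
    and rel: "\<And>x. 0 < x \<Longrightarrow> is_fourier_L2 (\<lambda>y. f (Complex x y)) (\<lambda>\<xi>. exp (complex_of_real (x * \<xi>)) * g \<xi>)"
begin

lemma extend_to_boundary_fourier:
  "is_fourier_L2 (\<lambda>y. extend_to_boundary f (Complex (real n / 2) y)) (\<lambda>\<xi>. exp (complex_of_real (real n / 2 * \<xi>)) * g \<xi>)"
proof (cases "n = 0")
  case True
  then show ?thesis using boundary_value_fourier[OF g rel] by (simp add: extend_to_boundary_def)
next
  case False
  then show ?thesis using rel[of "real n / 2"] by (simp add: extend_to_boundary_def)
qed

lemma extend_to_boundary_sum: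
  "(\<Sum>n. ennreal (2 ^ n / fact n) * (\<integral>\<^sup>+y. ennreal ((cmod (extend_to_boundary f (Complex (real n / 2) y)))\<^sup>2) \<partial>lborel)) =
    (\<integral>\<^sup>+\<xi>. ennreal ((cmod (g \<xi>))\<^sup>2) \<partial>weighted_lborel)"
proof -
  have "(\<integral>\<^sup>+y. ennreal ((cmod (extend_to_boundary f (Complex (real n / 2) y)))\<^sup>2) \<partial>lborel) =
      (\<integral>\<^sup>+\<xi>. ennreal ((cmod (exp (complex_of_real (real n / 2 * \<xi>)) * g \<xi>))\<^sup>2) \<partial>lborel)" for n
    using Plancherel_L2[OF extend_to_boundary_fourier[of n]] is_fourier_L2D[OF extend_to_boundary_fourier[of n]]
    by (simp only: nn_integral_L2)
  then show ?thesis
    using weighted_sum[OF L2_measurable[OF g]] by (simp only:)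
qed

text \<open>The boundary value has transform \<open>g\<close> and the norm is the weighted norm of \<open>g\<close>; finiteness of the latter
justifies passing from sums in \<open>[0, \<infinity>]\<close> to the real series that defines the norm.\<close>

lemma M2_omega_norm_eq:
  assumes fin: "(\<integral>\<^sup>+\<xi>. ennreal ((cmod (g \<xi>))\<^sup>2) \<partial>weighted_lborel) < \<infinity>"
  shows "g \<in> L2 weighted_lborel" "fourier_L2 (boundary_value f) \<in> L2 weighted_lborel"
    "M2_omega_norm f = L2norm weighted_lborel (fourier_L2 (boundary_value f))"
    "AE \<xi> in lborel. g \<xi> = fourier_L2 (boundary_value f) \<xi>"
proof -
  note bv = boundary_value_fourier[OF g rel]
  show AE: "AE \<xi> in lborel. g \<xi> = fourier_L2 (boundary_value f) \<xi>"
    by (rule fourier_L2_eqI[OF bv])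
  have meas: "g \<in> borel_measurable weighted_lborel" "fourier_L2 (boundary_value f) \<in> borel_measurable weighted_lborel"
    using L2_measurable[OF g] L2_measurable[OF is_fourier_L2D(2)[OF is_fourier_L2_fourier_L2[OF is_fourier_L2D(1)[OF bv]]]]
    by (simp_all add: weighted_lborel_def)
  have AE_w: "AE \<xi> in weighted_lborel. g \<xi> = fourier_L2 (boundary_value f) \<xi>"
    unfolding weighted_lborel_def using AE by (subst AE_density) (auto elim: eventually_mono)
  show g_w: "g \<in> L2 weighted_lborel"
    using fin meas by (simp add: L2_iff_nn_integral)
  then show "fourier_L2 (boundary_value f) \<in> L2 weighted_lborel"
    by (rule L2_cong_AE[OF _ meas(2) AE_w])
  define a where "a n = 2 ^ n / fact n * (LINT y|lborel. (cmod (extend_to_boundary f (Complex (real n / 2) y)))\<^sup>2)" for n :: nat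
  have a_nonneg: "0 \<le> a n" for n unfolding a_def by simp
  have "ennreal (a n) = ennreal (2 ^ n / fact n) * (\<integral>\<^sup>+y. ennreal ((cmod (extend_to_boundary f (Complex (real n / 2) y)))\<^sup>2) \<partial>lborel)" for n
    unfolding a_def nn_integral_L2[OF is_fourier_L2D(1)[OF extend_to_boundary_fourier]] L2norm_power2
    by (rule ennreal_mult) auto
  then have sum: "(\<Sum>n. ennreal (a n)) = ennreal ((L2norm weighted_lborel g)\<^sup>2)"
    using extend_to_boundary_sum nn_integral_L2[OF g_w] by (simp only:)
  then have "summable a"
    by (intro summable_suminf_not_top a_nonneg) simp
  then have "ennreal (suminf a) = ennreal ((L2norm weighted_lborel g)\<^sup>2)"
    using sum suminf_ennreal2[OF a_nonneg] by simp
  then have "suminf a = (L2norm weighted_lborel g)\<^sup>2"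
    using suminf_nonneg[OF \<open>summable a\<close> a_nonneg] by simp
  then have "M2_omega_norm f = L2norm weighted_lborel g"
    unfolding M2_omega_norm_def a_def by simp
  also have "\<dots> = L2norm weighted_lborel (fourier_L2 (boundary_value f))"
    by (rule L2norm_cong_AE[OF meas AE_w])
  finally show "M2_omega_norm f = L2norm weighted_lborel (fourier_L2 (boundary_value f))" .
qed

text \<open>On the closed half-plane the extension is glued from a continuous function on the open half-plane and a Borel
function on the imaginary axis, so it is Borel measurable.\<close>

lemma extend_to_boundary_L2:
  assumes f: "f holomorphic_on right_half_plane"
    and fin: "(\<integral>\<^sup>+\<xi>. ennreal ((cmod (g \<xi>))\<^sup>2) \<partial>weighted_lborel) < \<infinity>"
  shows "extend_to_boundary f \<in> L2 omega"
proof -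
  have [measurable]: "boundary_value f \<in> borel_measurable borel"
    using L2_measurable[OF is_fourier_L2D(1)[OF boundary_value_fourier[OF g rel]]] by simp
  have "open right_half_plane"
    unfolding right_half_plane_def by (intro open_Collect_less continuous_intros)
  then have [measurable]: "(\<lambda>z. indicator right_half_plane z *\<^sub>R f z) \<in> borel_measurable borel"
    by (intro borel_measurable_continuous_on_indicator holomorphic_on_imp_continuous_on[OF f]) simp
  have "(\<lambda>z. if Re z = 0 then boundary_value f (Im z) else indicator right_half_plane z *\<^sub>R f z) \<in> borel_measurable borel"
    by measurable
  then have "(\<lambda>z. if Re z = 0 then boundary_value f (Im z) else indicator right_half_plane z *\<^sub>R f z)
      \<in> borel_measurable (restrict_space borel {z. 0 \<le> Re z})"
    by (rule measurable_restrict_space1)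
  also have "?this \<longleftrightarrow> extend_to_boundary f \<in> borel_measurable (restrict_space borel {z. 0 \<le> Re z})"
    by (intro measurable_cong) (auto simp: extend_to_boundary_def right_half_plane_def space_restrict_space)
  finally have [measurable]: "extend_to_boundary f \<in> borel_measurable omega"
    by (simp cong: measurable_cong_sets add: sets_omega)
  then show ?thesis
    using fin by (simp add: L2_iff_nn_integral nn_integral_omega extend_to_boundary_sum)
qed

end

section \<open>The Laplace representation\<close>

lemma integrable_exp_neg_abs:
  assumes "0 < c" shows "integrable lborel (\<lambda>x::real. exp (- c * \<bar>x\<bar>))"
proof -
  interpret prob_space "density lborel (exponential_density c)"
    using assms by (rule prob_space_exponential_density)
  have "integrable (density lborel (exponential_density c)) (\<lambda>x. 1 :: real)" by simp
  then have e: "integrable lborel (exponential_density c)"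
    by (subst (asm) integrable_density) (use assms in \<open>auto simp: exponential_density_nonneg\<close>)
  have "integrable lborel (\<lambda>x. (exponential_density c x + exponential_density c (0 + - 1 * x)) / c)"
    using e by (intro integrable_divide Bochner_Integration.integrable_add lborel_integrable_real_affine) auto
  then show ?thesis
  proof (rule Bochner_Integration.integrable_bound)
    show "AE x in lborel. norm (exp (- c * \<bar>x\<bar>)) \<le> norm ((exponential_density c x + exponential_density c (0 + - 1 * x)) / c)"
      using assms by (intro AE_I2) (auto simp: exponential_density_def field_simps)
  qed measurable
qed

context
  fixes \<psi> :: "real \<Rightarrow> complex"
  assumes \<psi>: "\<psi> \<in> L2 weighted_lborel"
begin

lemma weighted_measurable [measurable]: "\<psi> \<in> borel_measurable borel"
  using L2_measurable[OF \<psi>] by (simp add: weighted_lborel_def)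

lemma weighted_finite: "(\<integral>\<^sup>+\<xi>. ennreal ((cmod (\<psi> \<xi>))\<^sup>2) \<partial>weighted_lborel) < \<infinity>"
  using \<psi> by (simp add: L2_iff_nn_integral)

lemma weighted_exp_exp_L2: "(\<lambda>\<xi>. complex_of_real (exp (exp \<xi>)) * \<psi> \<xi>) \<in> L2 lborel"
proof -
  have "(\<integral>\<^sup>+\<xi>. ennreal ((cmod (complex_of_real (exp (exp \<xi>)) * \<psi> \<xi>))\<^sup>2) \<partial>lborel) =
      (\<integral>\<^sup>+\<xi>. ennreal (exp (2 * exp \<xi>)) * ennreal ((cmod (\<psi> \<xi>))\<^sup>2) \<partial>lborel)"
    by (intro nn_integral_cong)
      (simp add: norm_mult power_mult_distrib ennreal_mult[symmetric] exp_double)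
  also have "\<dots> = (\<integral>\<^sup>+\<xi>. ennreal ((cmod (\<psi> \<xi>))\<^sup>2) \<partial>weighted_lborel)"
    unfolding weighted_lborel_def by (rule nn_integral_density[symmetric]) measurable
  finally show ?thesis using weighted_finite by (simp add: L2_iff_nn_integral)
qed

lemma exp_mult_le:
  fixes x \<xi> :: real
  assumes "0 \<le> x" shows "exp (x * \<xi>) \<le> exp (x\<^sup>2 / 2) * exp (exp \<xi>)"
proof -
  (* Young's inequality and exp xi >= xi^2 / 2 for xi >= 0 *)
  have "x * \<xi> \<le> x\<^sup>2 / 2 + exp \<xi>"
  proof (cases "0 \<le> \<xi>")
    case True
    have "x * \<xi> \<le> x\<^sup>2 / 2 + \<xi>\<^sup>2 / 2" using sum_squares_bound[of x \<xi>] by simp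
    also have "\<xi>\<^sup>2 / 2 \<le> exp \<xi>" using exp_lower_Taylor_quadratic[OF True] True by simp
    finally show ?thesis by simp
  next
    case False
    then have "x * \<xi> \<le> 0" using assms by (simp add: mult_nonneg_nonpos)
    then show ?thesis by (simp add: add_nonneg_nonneg order_trans)
  qed
  then show ?thesis by (simp flip: exp_add)
qed

text \<open>Square-integrability of \<open>e\<^bsup>x\<xi>\<^esup> \<psi>(\<xi>)\<close> follows from that of \<open>e\<^bsup>exp \<xi>\<^esup> \<psi>(\<xi>)\<close>, with a bound that is uniform
for bounded \<open>x\<close>; this uniformity gives membership in the Hardy spaces of the strips.\<close>

lemma exp_mult_weighted_L2:
  assumes "0 \<le> x"
  shows "(\<lambda>\<xi>. exp (complex_of_real (x * \<xi>)) * \<psi> \<xi>) \<in> L2 lborel"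
    and "L2norm lborel (\<lambda>\<xi>. exp (complex_of_real (x * \<xi>)) * \<psi> \<xi>) \<le>
      exp (x\<^sup>2 / 2) * L2norm lborel (\<lambda>\<xi>. complex_of_real (exp (exp \<xi>)) * \<psi> \<xi>)"
proof -
  let ?\<Psi> = "\<lambda>\<xi>. complex_of_real (exp (exp \<xi>)) * \<psi> \<xi>" and ?u = "\<lambda>\<xi>. exp (complex_of_real (x * \<xi>)) * \<psi> \<xi>"
  have le: "cmod (?u \<xi>) \<le> exp (x\<^sup>2 / 2) * cmod (?\<Psi> \<xi>)" for \<xi>
    using mult_right_mono[OF exp_mult_le[OF assms, of \<xi>] norm_ge_zero[of "\<psi> \<xi>"]]
    by (simp add: norm_mult mult.assoc)
  show u: "?u \<in> L2 lborel"
    by (rule L2I_bound[OF weighted_exp_exp_L2, where C = "exp (x\<^sup>2 / 2)"]) (use le in auto)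
  have "(L2norm lborel ?u)\<^sup>2 \<le> (LINT \<xi>|lborel. (exp (x\<^sup>2 / 2))\<^sup>2 * (cmod (?\<Psi> \<xi>))\<^sup>2)"
    unfolding L2norm_power2
  proof (rule integral_mono)
    show "(cmod (?u \<xi>))\<^sup>2 \<le> (exp (x\<^sup>2 / 2))\<^sup>2 * (cmod (?\<Psi> \<xi>))\<^sup>2" for \<xi>
      unfolding power_mult_distrib[symmetric] by (rule power_mono[OF le]) simp
  qed (intro L2_integrable[OF u] integrable_mult_right L2_integrable[OF weighted_exp_exp_L2])+
  also have "\<dots> = (exp (x\<^sup>2 / 2) * L2norm lborel ?\<Psi>)\<^sup>2"
    by (simp only: integral_mult_right_zero L2norm_power2 power_mult_distrib)
  finally show "L2norm lborel ?u \<le> exp (x\<^sup>2 / 2) * L2norm lborel ?\<Psi>"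
    by (rule power2_le_imp_le) simp
qed

text \<open>At distance \<open>x/2\<close> on both sides of \<open>x\<close> the exponents are still nonnegative, so \<open>e\<^bsup>x\<xi>\<^esup> \<psi>(\<xi>)\<close> is bounded by
\<open>e\<^bsup>-x\<bar>\<xi>\<bar>/2\<^esup>\<close> times the moduli of two square-integrable functions.\<close>

lemma exp_mult_weighted_integrable:
  assumes "0 < x"
  shows "integrable lborel (\<lambda>\<xi>. exp (complex_of_real (x * \<xi>)) * \<psi> \<xi>)"
proof -
  define d where "d = x / 2"
  have d: "0 < d" "0 \<le> x - d" "0 \<le> x + d" using assms by (auto simp: d_def)
  let ?k = "\<lambda>\<xi>. complex_of_real (exp (- d * \<bar>\<xi>\<bar>))"
  have k: "?k \<in> L2 lborel"
  proof -
    have "(cmod (?k \<xi>))\<^sup>2 = exp (- (2 * d) * \<bar>\<xi>\<bar>)" for \<xi>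
      by (simp add: power2_eq_square flip: exp_add)
    then show ?thesis
      using integrable_exp_neg_abs[of "2 * d"] d by (simp add: L2_def)
  qed
  have "integrable lborel (\<lambda>\<xi>. cmod (?k \<xi> * (exp (complex_of_real ((x - d) * \<xi>)) * \<psi> \<xi>)) + cmod (?k \<xi> * (exp (complex_of_real ((x + d) * \<xi>)) * \<psi> \<xi>)))"
    using d by (intro Bochner_Integration.integrable_add integrable_norm integrable_L2_mult[OF k] exp_mult_weighted_L2)
  then show ?thesis
  proof (rule Bochner_Integration.integrable_bound)
    have "exp (x * \<xi>) \<le> exp (- d * \<bar>\<xi>\<bar>) * exp ((x - d) * \<xi>) + exp (- d * \<bar>\<xi>\<bar>) * exp ((x + d) * \<xi>)" for \<xi>
      by (cases "0 \<le> \<xi>") (simp_all add: algebra_simps flip: exp_add)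
    from mult_right_mono[OF this norm_ge_zero]
    show "AE \<xi> in lborel. norm (exp (complex_of_real (x * \<xi>)) * \<psi> \<xi>) \<le>
        norm (cmod (?k \<xi> * (exp (complex_of_real ((x - d) * \<xi>)) * \<psi> \<xi>)) + cmod (?k \<xi> * (exp (complex_of_real ((x + d) * \<xi>)) * \<psi> \<xi>)))"
      by (intro AE_I2) (simp add: norm_mult algebra_simps)
  qed measurable
qed

lemma laplace_integrable:
  assumes "z \<in> right_half_plane"
  shows "integrable lborel (\<lambda>\<xi>. \<psi> \<xi> * exp (z * complex_of_real \<xi>))"
proof (rule Bochner_Integration.integrable_bound[OF exp_mult_weighted_integrable])
  show "0 < Re z" using assms by (simp add: right_half_plane_def)
qed (simp_all add: norm_mult mult.commute)

text \<open>The mean value inequality on the disc of radius \<open>\<bar>w\<bar>\<close>, where the derivative of \<open>exp\<close> is at most \<open>e\<^bsup>\<bar>w\<bar>\<^esup>\<close>.\<close>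

lemma exp_minus_1_bound: "cmod (exp w - 1) \<le> cmod w * exp (cmod w)"
proof -
  have "cmod (exp w - exp 0) \<le> exp (cmod w) * cmod (w - 0)"
  proof (rule field_differentiable_bound[where S = "cball 0 (cmod w)" and f' = exp])
    show "cmod (exp z) \<le> exp (cmod w)" if "z \<in> cball 0 (cmod w)" for z
      using that complex_Re_le_cmod[of z] by simp
  qed (auto intro: DERIV_subset DERIV_exp)
  then show ?thesis by (simp add: mult.commute)
qed

text \<open>Differentiation under the integral sign. The difference quotients of \<open>e\<^bsup>z\<xi>\<^esup>\<close> with steps of size at most
\<open>d = Re z / 4\<close> are bounded by \<open>(e\<^bsup>(x + 2d)\<xi>\<^esup> + e\<^bsup>(x - 2d)\<xi>\<^esup>) / d\<close> with \<open>x = Re z\<close>, which remains integrable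
against \<open>\<psi>\<close> because \<open>x - 2d > 0\<close>.\<close>

lemma laplace_holomorphic:
  "(\<lambda>z. LINT \<xi>|lborel. \<psi> \<xi> * exp (z * complex_of_real \<xi>)) holomorphic_on right_half_plane"
proof (rule holomorphic_onI)
  fix z assume z: "z \<in> right_half_plane"
  let ?L = "\<lambda>z. LINT \<xi>|lborel. \<psi> \<xi> * exp (z * complex_of_real \<xi>)"
  define x where "x = Re z"
  define d where "d = x / 4"
  have x: "0 < x" using z by (simp add: x_def right_half_plane_def)
  then have d: "0 < d" "0 < x + 2 * d" "0 < x - 2 * d" by (auto simp: d_def)
  define w where "w \<xi> = (cmod (exp (complex_of_real ((x + 2 * d) * \<xi>)) * \<psi> \<xi>) + cmod (exp (complex_of_real ((x - 2 * d) * \<xi>)) * \<psi> \<xi>)) / d" for \<xi>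
  have w: "integrable lborel w"
    unfolding w_def
    by (intro integrable_divide Bochner_Integration.integrable_add integrable_norm exp_mult_weighted_integrable d)
  have bound: "cmod (\<psi> \<xi> * exp (z * complex_of_real \<xi>) * ((exp (h * complex_of_real \<xi>) - 1) / h)) \<le> w \<xi>"
    if h: "h \<noteq> 0" "cmod h \<le> d" for h \<xi>
  proof -
    have "cmod ((exp (h * complex_of_real \<xi>) - 1) / h) \<le> \<bar>\<xi>\<bar> * exp (cmod h * \<bar>\<xi>\<bar>)"
      using exp_minus_1_bound[of "h * complex_of_real \<xi>"] h(1) by (simp add: norm_divide norm_mult field_simps)
    also have "\<dots> \<le> exp (d * \<bar>\<xi>\<bar>) / d * exp (d * \<bar>\<xi>\<bar>)"
    proof (rule mult_mono)
      have "d * \<bar>\<xi>\<bar> \<le> exp (d * \<bar>\<xi>\<bar>)" using exp_ge_add_one_self[of "d * \<bar>\<xi>\<bar>"] by linarith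
      then show "\<bar>\<xi>\<bar> \<le> exp (d * \<bar>\<xi>\<bar>) / d" using d by (simp add: field_simps)
      show "exp (cmod h * \<bar>\<xi>\<bar>) \<le> exp (d * \<bar>\<xi>\<bar>)" using h by (simp add: mult_right_mono)
    qed (use d in auto)
    also have "\<dots> = exp (2 * d * \<bar>\<xi>\<bar>) / d" by (simp flip: exp_add)
    also have "\<dots> \<le> (exp (2 * d * \<xi>) + exp (- (2 * d * \<xi>))) / d"
      using d by (intro divide_right_mono) (auto simp: abs_if)
    finally have "cmod (\<psi> \<xi> * exp (z * complex_of_real \<xi>)) * cmod ((exp (h * complex_of_real \<xi>) - 1) / h) \<le>
        cmod (\<psi> \<xi> * exp (z * complex_of_real \<xi>)) * ((exp (2 * d * \<xi>) + exp (- (2 * d * \<xi>))) / d)"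
      by (rule mult_left_mono) simp
    also have "\<dots> = w \<xi>"
    proof -
      have "exp ((x + 2 * d) * \<xi>) = exp (x * \<xi>) * exp (2 * d * \<xi>)" "exp ((x - 2 * d) * \<xi>) = exp (x * \<xi>) * exp (- (2 * d * \<xi>))"
        by (simp_all add: algebra_simps flip: exp_add)
      then show ?thesis
        unfolding w_def norm_mult norm_exp_eq_Re by (simp add: x_def[symmetric] algebra_simps)
    qed
    finally show ?thesis by (simp only: norm_mult)
  qed
  have "((\<lambda>h. (?L (z + h) - ?L z) / h) \<longlongrightarrow> (LINT \<xi>|lborel. \<psi> \<xi> * exp (z * complex_of_real \<xi>) * complex_of_real \<xi>)) (at 0)"
    unfolding tendsto_at_iff_sequentially o_def
  proof (intro allI impI)
    fix X :: "nat \<Rightarrow> complex" assume X: "\<forall>i. X i \<in> UNIV - {0}" and X0: "X \<longlonglongrightarrow> 0"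
    obtain N where N: "\<And>n. N \<le> n \<Longrightarrow> cmod (X n) < d"
      using LIMSEQ_D[OF X0 d(1)] by auto
    obtain N' where N': "\<And>n. N' \<le> n \<Longrightarrow> cmod (X n) < x"
      using LIMSEQ_D[OF X0 x] by auto
    define Y where "Y n = X (n + (N + N'))" for n
    have Y: "Y n \<noteq> 0" "cmod (Y n) \<le> d" "cmod (Y n) < x" for n
      using X N[of "n + (N + N')"] N'[of "n + (N + N')"] by (auto simp: Y_def intro: less_imp_le)
    have Y0: "Y \<longlonglongrightarrow> 0" unfolding Y_def by (rule LIMSEQ_ignore_initial_segment[OF X0])
    have eq: "(?L (z + Y n) - ?L z) / Y n =
        (LINT \<xi>|lborel. \<psi> \<xi> * exp (z * complex_of_real \<xi>) * ((exp (Y n * complex_of_real \<xi>) - 1) / Y n))" for n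
    proof -
      have "z + Y n \<in> right_half_plane"
        using Y(3)[of n] abs_Re_le_cmod[of "Y n"] by (auto simp: right_half_plane_def x_def)
      then have "?L (z + Y n) - ?L z = (LINT \<xi>|lborel. \<psi> \<xi> * exp ((z + Y n) * complex_of_real \<xi>) - \<psi> \<xi> * exp (z * complex_of_real \<xi>))"
        by (intro Bochner_Integration.integral_diff[symmetric] laplace_integrable z)
      also have "\<dots> / Y n = (LINT \<xi>|lborel. (\<psi> \<xi> * exp ((z + Y n) * complex_of_real \<xi>) - \<psi> \<xi> * exp (z * complex_of_real \<xi>)) / Y n)"
        by (rule integral_divide_zero[symmetric])
      finally show ?thesis
        by (simp add: distrib_right exp_add right_diff_distrib algebra_simps)
    qed
    have "(\<lambda>n. (?L (z + Y n) - ?L z) / Y n) \<longlonglongrightarrow> (LINT \<xi>|lborel. \<psi> \<xi> * exp (z * complex_of_real \<xi>) * complex_of_real \<xi>)"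
      unfolding eq
    proof (rule integral_dominated_convergence[OF _ _ w])
      show "AE \<xi> in lborel. (\<lambda>n. \<psi> \<xi> * exp (z * complex_of_real \<xi>) * ((exp (Y n * complex_of_real \<xi>) - 1) / Y n))
          \<longlonglongrightarrow> \<psi> \<xi> * exp (z * complex_of_real \<xi>) * complex_of_real \<xi>"
      proof (intro AE_I2 tendsto_mult tendsto_const)
        fix \<xi>
        have "((\<lambda>h. exp (h * complex_of_real \<xi>)) has_field_derivative (exp (0 * complex_of_real \<xi>) * complex_of_real \<xi>)) (at 0)"
          by (auto intro!: derivative_eq_intros)
        then have "((\<lambda>h. (exp (h * complex_of_real \<xi>) - 1) / h) \<longlongrightarrow> complex_of_real \<xi>) (at 0)"
          by (simp add: DERIV_def)
        then show "(\<lambda>n. (exp (Y n * complex_of_real \<xi>) - 1) / Y n) \<longlonglongrightarrow> complex_of_real \<xi>"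
          using Y(1) Y0 unfolding tendsto_at_iff_sequentially o_def by auto
      qed
      show "AE \<xi> in lborel. norm (\<psi> \<xi> * exp (z * complex_of_real \<xi>) * ((exp (Y n * complex_of_real \<xi>) - 1) / Y n)) \<le> w \<xi>" for n
        by (intro AE_I2 bound Y)
    qed measurable
    then show "(\<lambda>n. (?L (z + X n) - ?L z) / X n) \<longlonglongrightarrow> (LINT \<xi>|lborel. \<psi> \<xi> * exp (z * complex_of_real \<xi>) * complex_of_real \<xi>)"
      unfolding Y_def by (rule LIMSEQ_offset)
  qed
  then have "(?L has_field_derivative (LINT \<xi>|lborel. \<psi> \<xi> * exp (z * complex_of_real \<xi>) * complex_of_real \<xi>)) (at z)"
    by (simp add: DERIV_def)
  then show "?L field_differentiable at z within right_half_plane"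
    by (meson field_differentiable_at_within field_differentiable_def)
qed

text \<open>On the line \<open>Re z = x\<close>, the Laplace integral is the transform of \<open>e\<^bsup>x\<xi>\<^esup> \<psi>(\<xi>)\<close> evaluated at \<open>-y\<close>, that is, its
inverse Fourier transform.\<close>

lemma laplace_fourier:
  assumes f: "\<And>z. z \<in> right_half_plane \<Longrightarrow> f z = complex_of_real (1 / sqrt (2 * pi)) * (LINT \<xi>|lborel. \<psi> \<xi> * exp (z * complex_of_real \<xi>))"
    and x: "0 < x"
  shows "is_fourier_L2 (\<lambda>y. f (Complex x y)) (\<lambda>\<xi>. exp (complex_of_real (x * \<xi>)) * \<psi> \<xi>)"
proof -
  let ?u = "\<lambda>\<xi>. exp (complex_of_real (x * \<xi>)) * \<psi> \<xi>"
  have "f (Complex x y) = fourier_L1 ?u (- y)" for y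
  proof -
    have "\<psi> \<xi> * exp (Complex x y * complex_of_real \<xi>) = ?u \<xi> * exp (- (\<i> * complex_of_real \<xi> * complex_of_real (- y)))" for \<xi>
    proof -
      have "Complex x y * complex_of_real \<xi> = complex_of_real (x * \<xi>) + - (\<i> * complex_of_real \<xi> * complex_of_real (- y))"
        by (simp add: complex_eq_iff)
      then show ?thesis by (simp only: exp_add) simp
    qed
    then show ?thesis
      using f[of "Complex x y"] x by (simp only: fourier_L1_def) (simp add: right_half_plane_def)
  qed
  moreover have "is_fourier_L2 (\<lambda>y. fourier_L1 ?u (- y)) (\<lambda>\<xi>. ?u (- (- \<xi>)))"
    by (intro is_fourier_L2_reflect Fourier_inversion_L1 exp_mult_weighted_integrable exp_mult_weighted_L2 less_imp_le x)
  ultimately show ?thesis by simp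
qed

lemma laplace_M2_omega:
  assumes f: "\<And>z. z \<in> right_half_plane \<Longrightarrow> f z = complex_of_real (1 / sqrt (2 * pi)) * (LINT \<xi>|lborel. \<psi> \<xi> * exp (z * complex_of_real \<xi>))"
  shows "\<psi> \<in> L2 lborel" "f \<in> M2_omega"
proof -
  show \<psi>_L2: "\<psi> \<in> L2 lborel" using exp_mult_weighted_L2(1)[of 0] by simp
  have hol: "f holomorphic_on right_half_plane"
    using holomorphic_on_mult[OF holomorphic_on_const[of "complex_of_real (1 / sqrt (2 * pi))"] laplace_holomorphic]
    by (rule holomorphic_transform) (simp add: f)
  have "f \<in> H2_strip b" if b: "0 < b" for b
  proof -
    let ?C = "exp (b\<^sup>2 / 2) * L2norm lborel (\<lambda>\<xi>. complex_of_real (exp (exp \<xi>)) * \<psi> \<xi>)"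
    have "(\<integral>\<^sup>+ y. ennreal ((cmod (f (Complex x y)))\<^sup>2) \<partial>lborel) \<le> ennreal (?C\<^sup>2)" if x: "x \<in> {0<..<b}" for x
    proof -
      have F: "is_fourier_L2 (\<lambda>y. f (Complex x y)) (\<lambda>\<xi>. exp (complex_of_real (x * \<xi>)) * \<psi> \<xi>)"
        using x by (intro laplace_fourier f) auto
      have "L2norm lborel (\<lambda>y. f (Complex x y)) \<le> exp (x\<^sup>2 / 2) * L2norm lborel (\<lambda>\<xi>. complex_of_real (exp (exp \<xi>)) * \<psi> \<xi>)"
        using exp_mult_weighted_L2(2)[of x] Plancherel_L2[OF F] x by simp
      also have "\<dots> \<le> ?C"
        using x by (intro mult_right_mono) (auto intro: power_mono)
      finally show ?thesis
        unfolding nn_integral_L2[OF is_fourier_L2D(1)[OF F]] by (intro ennreal_leI power_mono) auto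
    qed
    then have "(SUP x\<in>{0<..<b}. \<integral>\<^sup>+ y. ennreal ((cmod (f (Complex x y)))\<^sup>2) \<partial>lborel) \<le> ennreal (?C\<^sup>2)"
      by (rule SUP_least)
    also have "\<dots> < \<infinity>" by simp
    finally show ?thesis
      using holomorphic_on_subset[OF hol, of "strip b"] by (auto simp: H2_strip_def strip_def right_half_plane_def)
  qed
  moreover have "extend_to_boundary f \<in> L2 omega"
    by (rule extend_to_boundary_L2[OF \<psi>_L2 laplace_fourier[OF f] hol weighted_finite])
  ultimately show "f \<in> M2_omega" using hol by (simp add: M2_omega_def)
qed

end

theorem theorem2:
  shows "(\<forall>f\<in>M2_omega.
           fourier_L2 (boundary_value f) \<in> L2 weighted_lborel \<and>
           M2_omega_norm f = L2norm weighted_lborel (fourier_L2 (boundary_value f)))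
       \<and> (\<forall>\<psi>\<in>L2 weighted_lborel. \<forall>f.
           (\<forall>z\<in>right_half_plane. f z = complex_of_real (1 / sqrt (2 * pi)) *
              (LINT \<xi>|lborel. \<psi> \<xi> * exp (z * complex_of_real \<xi>))) \<longrightarrow>
           (\<forall>z\<in>right_half_plane.
              integrable lborel (\<lambda>\<xi>. \<psi> \<xi> * exp (z * complex_of_real \<xi>))) \<and>
           f \<in> M2_omega \<and>
           M2_omega_norm f = L2norm weighted_lborel (fourier_L2 (boundary_value f)) \<and>
           (AE \<xi> in lborel. \<psi> \<xi> = fourier_L2 (boundary_value f) \<xi>))"
proof (intro conjI ballI allI impI)
  fix f assume f: "f \<in> M2_omega"
  then obtain g where g: "g \<in> L2 lborel"
    "\<And>x. 0 < x \<Longrightarrow> is_fourier_L2 (\<lambda>y. f (Complex x y)) (\<lambda>\<xi>. exp (complex_of_real (x * \<xi>)) * g \<xi>)"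
    using H2_strip_fourier_representation[of f] by (auto simp: M2_omega_def)
  have ext: "extend_to_boundary f \<in> L2 omega" using f by (simp add: M2_omega_def)
  have [measurable]: "extend_to_boundary f \<in> borel_measurable omega" by (rule L2_measurable[OF ext])
  have "(\<integral>\<^sup>+\<xi>. ennreal ((cmod (g \<xi>))\<^sup>2) \<partial>weighted_lborel) = (\<integral>\<^sup>+z. ennreal ((cmod (extend_to_boundary f z))\<^sup>2) \<partial>omega)"
    by (subst nn_integral_omega) (simp_all add: extend_to_boundary_sum[OF g])
  also have "\<dots> < \<infinity>" using ext by (simp add: L2_iff_nn_integral)
  finally have fin: "(\<integral>\<^sup>+\<xi>. ennreal ((cmod (g \<xi>))\<^sup>2) \<partial>weighted_lborel) < \<infinity>" .
  show "fourier_L2 (boundary_value f) \<in> L2 weighted_lborel"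
    "M2_omega_norm f = L2norm weighted_lborel (fourier_L2 (boundary_value f))"
    using M2_omega_norm_eq[OF g fin] by blast+
next
  fix \<psi> f
  assume \<psi>: "\<psi> \<in> L2 weighted_lborel"
    and "\<forall>z\<in>right_half_plane. f z = complex_of_real (1 / sqrt (2 * pi)) * (LINT \<xi>|lborel. \<psi> \<xi> * exp (z * complex_of_real \<xi>))"
  then have f: "\<And>z. z \<in> right_half_plane \<Longrightarrow> f z = complex_of_real (1 / sqrt (2 * pi)) * (LINT \<xi>|lborel. \<psi> \<xi> * exp (z * complex_of_real \<xi>))"
    by blast
  show "integrable lborel (\<lambda>\<xi>. \<psi> \<xi> * exp (z * complex_of_real \<xi>))" if "z \<in> right_half_plane" for z
    by (rule laplace_integrable[OF \<psi> that])
  show "f \<in> M2_omega" by (rule laplace_M2_omega(2)[OF \<psi> f])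
  show "M2_omega_norm f = L2norm weighted_lborel (fourier_L2 (boundary_value f))"
    "AE \<xi> in lborel. \<psi> \<xi> = fourier_L2 (boundary_value f) \<xi>"
    using M2_omega_norm_eq[OF laplace_M2_omega(1)[OF \<psi> f] laplace_fourier[OF \<psi> f] weighted_finite[OF \<psi>]] by blast+
qed

end
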